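(* The flow of the discrete Routh (DR) equations preserves the symplectic form $$\Omega_{\mu,d}=\hat{\mathbb{F}}^*\left(\Omega_S-\pi_{T^*S,S}^*\beta_\mu\right)$$ on $V\subset S\times S$, where $\beta_\mu$ is the 2-form on $S$ obtained by dropping $\mathbf{d}\mathfrak{A}_\mu$ to $S$. That is, $\hat F^*\Omega_{\mu,d}=\Omega_{\mu,d}$ on the domain of $\hat F$, where $\hat F$ is the (locally defined) discrete flow map of the DR equations. Furthermore, $\Omega_{\mu,d}$ can be obtained by dropping to $S\times S$ (i.e. to $V$) the restriction of $\Omega_{L_d}$ to $\mathbf{J}_d^{-1}(\mu)$ (i.e. to $U$); in other words, $$\pi_{\mu,d}^*\Omega_{\mu,d}=\iota_{\mu,d}^*\Omega_{L_d}.$$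
   Context: Setting. $G$ is an abelian Lie group with Lie algebra $\mathfrak{g}$, acting smoothly, freely and properly on a smooth finite-dimensional manifold $Q$; $S=Q/G$ is shape space, $\pi_{Q,G}:Q\to S$, $q\mapsto[q]_G$, is the projection. For $\xi\in\mathfrak{g}$, $\xi_Q$ is the infinitesimal generator on $Q$, and $\operatorname{Ver}(q)=\{\xi_Q(q):\xi\in\mathfrak{g}\}\subset T_qQ$. $G$ acts diagonally on $Q\times Q$. $L_d:Q\times Q\to\mathbb{R}$ is a smooth $G$-invariant discrete Lagrangian; $D_1,D_2$ denote derivatives in the first and second slot. The discrete momentum map $\mathbf{J}_d:Q\times Q\to\mathfrak{g}^*$ is $\mathbf{J}_d(q_0,q_1)\cdot\xi=D_2L_d(q_0,q_1)\cdot\xi_Q(q_1)$; it is $G$-invariant. Fix $\mu\in\mathfrak{g}^*$. Standing assumptions. $L_d$ is regular (for every $q\in Q$ the bilinear form $D_2D_1L_d(q,q):T_qQ\times T_qQ\to\mathbb{R}$ is nondegenerate) and group-regular (its restriction to $\operatorname{Ver}(q)\times\operatorname{Ver}(q)$ is nondegenerate). Localization. Let $O\subset Q\times Q$ be a $G$-invariant open neighborhood of the diagonal on which the discrete Legendre transform $\mathbb{F}L_d=D_2L_d:Q\times Q\to T^*Q$, $(q_0,q_1)\mapsto D_2L_d(q_0,q_1)\in T^*_{q_1}Q$, is a local diffeomorphism; then $\mathbf{J}_d^{-1}(\mu)\cap O$ is a submanifold. Points are taken closely spaced in the following sense: $U\subset\mathbf{J}_d^{-1}(\mu)\cap O$ is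 a fixed $G$-invariant open subset such that $\varphi_\mu:U/G\to S\times S$, $[(q,q')]_G\mapsto([q]_G,[q']_G)$, is a diffeomorphism onto an open set $V\subset S\times S$. Let $\pi_{\mu,d}:U\to V$, $(q,q')\mapsto([q]_G,[q']_G)$, and let $\iota_{\mu,d}:U\hookrightarrow Q\times Q$ be the inclusion. Reduced objects. The discrete reduced Lagrangian $\hat L_d:V\to\mathbb{R}$ is the function with $\hat L_d\circ\pi_{\mu,d}=L_d|_U$. Fix a principal connection $\mathfrak{A}:TQ\to\mathfrak{g}$ on $Q\to Q/G$, and let $\mathfrak{A}_\mu$ be the 1-form on $Q$ with $\mathfrak{A}_\mu(q)\cdot v=\langle\mu,\mathfrak{A}(v)\rangle$ for $v\in T_qQ$. $\beta_\mu$ is the unique 2-form on $S$ with $\pi_{Q,G}^*\beta_\mu=\mathbf{d}\mathfrak{A}_\mu$. Let $\mathcal{A}=\pi_2^*\mathfrak{A}_\mu-\pi_1^*\mathfrak{A}_\mu$ on $Q\times Q$, where $\pi_1,\pi_2:Q\times Q\to Q$ are the projections. $\hat{\mathcal{A}}$ is the (well-defined, unique) 1-form on $V$ with $\pi_{\mu,d}^*\hat{\mathcal{A}}=\iota_{\mu,d}^*\mathcal{A}$, with components defined by $\hat{\mathcal{A}}(x_0,x_1)\cdot(\delta x_0,\delta x_1)=\hat{\mathcal{A}}_1(x_0,x_1)\cdot\delta x_0+\hat{\mathcal{A}}_2(x_0,x_1)\cdot\delta x_1$. The reduced discrete Legendre transform is $\hat{\mathbb{F}}:V\to T^*S$, $\hat{\mathbb{F}}(x_0,x_1)=D_2\hat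 L_d(x_0,x_1)-\hat{\mathcal{A}}_2(x_0,x_1)\in T^*_{x_1}S$. Symplectic forms. $\Omega_{L_d}=-\mathbf{d}\Theta_{L_d}$, where $\Theta_{L_d}$ is the 1-form on $Q\times Q$ given by $\Theta_{L_d}(q_0,q_1)\cdot(\delta q_0,\delta q_1)=D_2L_d(q_0,q_1)\cdot\delta q_1$. $\Omega_S=-\mathbf{d}\Theta_S$ is the canonical symplectic form on $T^*S$, with $\Theta_S$ the canonical (Liouville) 1-form, and $\pi_{T^*S,S}:T^*S\to S$ is the bundle projection. DR flow. The DR equations are $D_2\hat L_d(x_{k-1},x_k)+D_1\hat L_d(x_k,x_{k+1})=\hat{\mathcal{A}}_2(x_{k-1},x_k)+\hat{\mathcal{A}}_1(x_k,x_{k+1})$. The discrete flow map $\hat F$ is the smooth map $(x_0,x_1)\mapsto(x_1,x_2)$, defined on an open subset of $V$ and with values in $V$, such that $x_0,x_1,x_2$ satisfy the DR equation with $k=1$; the flow consists of the iterates of $\hat F$, wherever they are defined. *)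

theory Defs
  imports "HOL-Analysis.Analysis" "HOL-Algebra.Group_Action"
begin

section \<open>Smooth maps between normed spaces\<close>

text \<open>To be used on open sets of finite-dimensional spaces. There the continuity of all iterated
  directional derivatives, together with differentiability at each stage, is the usual
  \<open>C\<close>-infinity condition.\<close>

primrec Ck_on :: "nat \<Rightarrow> 'a::real_normed_vector set \<Rightarrow> ('a \<Rightarrow> 'b::real_normed_vector) \<Rightarrow> bool" where
  "Ck_on 0 D f \<longleftrightarrow> continuous_on D f"
| "Ck_on (Suc k) D f \<longleftrightarrow> (\<forall>x\<in>D. f differentiable (at x)) \<and>
     (\<forall>v. Ck_on k D (\<lambda>x. frechet_derivative f (at x) v))"

definition smooth_on :: "'a::real_normed_vector set \<Rightarrow> ('a \<Rightarrow> 'b::real_normed_vector) \<Rightarrow> bool" where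
  "smooth_on D f \<longleftrightarrow> (\<forall>k. Ck_on k D f)"


section \<open>Smooth manifolds\<close>

text \<open>A manifold is given by its set of points and by an atlas in which every point \<open>p\<close> has
  its own chart, with domain \<open>chart_dom M p\<close> containing \<open>p\<close>. An arbitrary atlas can be brought
  into this form by choosing one of its charts around each point, without changing the smooth
  structure. The gain is that the tangent space at \<open>p\<close> can be
  identified with the model space by means of the chart at \<open>p\<close>: a tangent vector at \<open>p\<close> is
  written as its coordinate vector in that chart. For products this identification is
  compatible with the decomposition of the tangent space into the tangent spaces of the factors.

  The model space is a finite-dimensional inner product space. The class of Euclidean spaces
  is not used, because it excludes dimension zero (for instance a trivial or discrete group).\<close>

record ('m, 'e) mfd =
  points :: "'m set"
  chart_dom :: "'m \<Rightarrow> 'm set"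
  chart :: "'m \<Rightarrow> 'm \<Rightarrow> 'e"

definition chart_inv :: "('m, 'e) mfd \<Rightarrow> 'm \<Rightarrow> 'e \<Rightarrow> 'm" where
  "chart_inv M p = inv_into (chart_dom M p) (chart M p)"

definition mfd_open :: "('m, 'e::real_inner) mfd \<Rightarrow> 'm set \<Rightarrow> bool" where
  "mfd_open M X \<longleftrightarrow> X \<subseteq> points M \<and>
     (\<forall>p\<in>points M. \<exists>A. open A \<and> X \<inter> chart_dom M p = {y \<in> chart_dom M p. chart M p y \<in> A})"

definition mfd_top :: "('m, 'e::real_inner) mfd \<Rightarrow> 'm topology" where
  "mfd_top M = topology (mfd_open M)"

lemma istopology_mfd_open: "istopology (mfd_open M)"
  unfolding istopology_def
proof (intro conjI allI impI)
  fix X Y assume X: "mfd_open M X" and Y: "mfd_open M Y"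
  show "mfd_open M (X \<inter> Y)"
    unfolding mfd_open_def
  proof (intro conjI ballI)
    show "X \<inter> Y \<subseteq> points M" using X by (auto simp: mfd_open_def)
    fix p assume p: "p \<in> points M"
    obtain A where A: "open A" "X \<inter> chart_dom M p = {y \<in> chart_dom M p. chart M p y \<in> A}"
      using X p unfolding mfd_open_def by blast
    obtain B where B: "open B" "Y \<inter> chart_dom M p = {y \<in> chart_dom M p. chart M p y \<in> B}"
      using Y p unfolding mfd_open_def by blast
    have "X \<inter> Y \<inter> chart_dom M p = {y \<in> chart_dom M p. chart M p y \<in> A \<inter> B}"
      using A(2) B(2) by blast
    then show "\<exists>C. open C \<and> X \<inter> Y \<inter> chart_dom M p = {y \<in> chart_dom M p. chart M p y \<in> C}"
      using A(1) B(1) by blast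
  qed
next
  fix K assume K: "\<forall>X\<in>K. mfd_open M X"
  show "mfd_open M (\<Union>K)"
    unfolding mfd_open_def
  proof (intro conjI ballI)
    show "\<Union>K \<subseteq> points M" using K by (auto simp: mfd_open_def)
    fix p assume p: "p \<in> points M"
    have "\<forall>X\<in>K. \<exists>A. open A \<and> X \<inter> chart_dom M p = {y \<in> chart_dom M p. chart M p y \<in> A}"
      using K p unfolding mfd_open_def by blast
    then obtain A where A: "\<And>X. X \<in> K \<Longrightarrow> open (A X)"
        "\<And>X. X \<in> K \<Longrightarrow> X \<inter> chart_dom M p = {y \<in> chart_dom M p. chart M p y \<in> A X}"
      by metis
    have "\<Union>K \<inter> chart_dom M p = {y \<in> chart_dom M p. chart M p y \<in> \<Union>(A ` K)}"
      using A(2) by blast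
    moreover have "open (\<Union>(A ` K))" using A(1) by blast
    ultimately show "\<exists>C. open C \<and> \<Union>K \<inter> chart_dom M p = {y \<in> chart_dom M p. chart M p y \<in> C}"
      by blast
  qed
qed

lemma openin_mfd_top: "openin (mfd_top M) X \<longleftrightarrow> mfd_open M X"
  by (simp add: mfd_top_def istopology_mfd_open topology_inverse')

definition smooth_manifold :: "('m, 'e::real_inner) mfd \<Rightarrow> bool" where
  "smooth_manifold M \<longleftrightarrow>
     (\<exists>B::'e set. finite B \<and> span B = UNIV) \<and>
     (\<forall>p\<in>points M. p \<in> chart_dom M p \<and> chart_dom M p \<subseteq> points M \<and>
        inj_on (chart M p) (chart_dom M p) \<and> open (chart M p ` chart_dom M p)) \<and>
     (\<forall>p\<in>points M. \<forall>q\<in>points M.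
        open (chart M p ` (chart_dom M p \<inter> chart_dom M q)) \<and>
        smooth_on (chart M p ` (chart_dom M p \<inter> chart_dom M q)) (chart M q \<circ> chart_inv M p)) \<and>
     Hausdorff_space (mfd_top M) \<and> second_countable (mfd_top M)"

definition open_sub :: "('m, 'e) mfd \<Rightarrow> 'm set \<Rightarrow> ('m, 'e) mfd" where
  "open_sub M X = \<lparr>points = X, chart_dom = (\<lambda>p. chart_dom M p \<inter> X), chart = chart M\<rparr>"

definition prod_mfd :: "('m, 'e) mfd \<Rightarrow> ('n, 'f) mfd \<Rightarrow> ('m \<times> 'n, 'e \<times> 'f) mfd" where
  "prod_mfd M N = \<lparr>points = points M \<times> points N,
     chart_dom = (\<lambda>(p, q). chart_dom M p \<times> chart_dom N q),
     chart = (\<lambda>(p, q) (x, y). (chart M p x, chart N q y))\<rparr>"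

definition vec_mfd :: "('v, 'v) mfd" where
  "vec_mfd = \<lparr>points = UNIV, chart_dom = (\<lambda>_. UNIV), chart = (\<lambda>_ x. x)\<rparr>"

definition smooth_map ::
  "('m, 'e::real_inner) mfd \<Rightarrow> ('n, 'f::real_inner) mfd \<Rightarrow> ('m \<Rightarrow> 'n) \<Rightarrow> bool" where
  "smooth_map M N f \<longleftrightarrow> f ` points M \<subseteq> points N \<and>
     (\<forall>p\<in>points M. \<exists>X. openin (mfd_top M) X \<and> p \<in> X \<and> X \<subseteq> chart_dom M p \<and>
        f ` X \<subseteq> chart_dom N (f p) \<and>
        smooth_on (chart M p ` X) (chart N (f p) \<circ> f \<circ> chart_inv M p))"

definition diffeo ::
  "('m, 'e::real_inner) mfd \<Rightarrow> ('n, 'f::real_inner) mfd \<Rightarrow> ('m \<Rightarrow> 'n) \<Rightarrow> bool" where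
  "diffeo M N f \<longleftrightarrow> bij_betw f (points M) (points N) \<and> smooth_map M N f \<and>
     smooth_map N M (inv_into (points M) f)"

definition local_diffeo ::
  "('m, 'e::real_inner) mfd \<Rightarrow> ('n, 'f::real_inner) mfd \<Rightarrow> ('m \<Rightarrow> 'n) \<Rightarrow> bool" where
  "local_diffeo M N f \<longleftrightarrow> (\<forall>p\<in>points M. \<exists>X. openin (mfd_top M) X \<and> p \<in> X \<and>
     openin (mfd_top N) (f ` X) \<and> diffeo (open_sub M X) (open_sub N (f ` X)) f)"

text \<open>The tangent map at \<open>p\<close>, in the charts at \<open>p\<close> and at \<open>f p\<close>.\<close>

definition tmap ::
  "('m, 'e::real_inner) mfd \<Rightarrow> ('n, 'f::real_inner) mfd \<Rightarrow> ('m \<Rightarrow> 'n) \<Rightarrow> 'm \<Rightarrow> 'e \<Rightarrow> 'f" where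
  "tmap M N f p = frechet_derivative (chart N (f p) \<circ> f \<circ> chart_inv M p) (at (chart M p p))"

definition embedded_submanifold ::
  "('m, 'p::real_inner) mfd \<Rightarrow> ('m, 'e::real_inner) mfd \<Rightarrow> bool" where
  "embedded_submanifold P M \<longleftrightarrow> smooth_manifold P \<and> points P \<subseteq> points M \<and>
     smooth_map P M (\<lambda>x. x) \<and> (\<forall>p\<in>points P. inj (tmap P M (\<lambda>x. x) p)) \<and>
     mfd_top P = subtopology (mfd_top M) (points P)"


section \<open>Differential forms\<close>

text \<open>\<open>tcoord M p y\<close> takes the components, in the chart at \<open>p\<close>, of a tangent vector at \<open>y\<close>
  to its components in the chart at \<open>y\<close>.\<close>

definition tcoord :: "('m, 'e::real_inner) mfd \<Rightarrow> 'm \<Rightarrow> 'm \<Rightarrow> 'e \<Rightarrow> 'e" where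
  "tcoord M p y = frechet_derivative (chart M y \<circ> chart_inv M p) (at (chart M p y))"

definition loc1 ::
  "('m, 'e::real_inner) mfd \<Rightarrow> ('m \<Rightarrow> 'e \<Rightarrow> 'v) \<Rightarrow> 'm \<Rightarrow> 'e \<Rightarrow> 'e \<Rightarrow> 'v" where
  "loc1 M \<alpha> p x v = (let y = chart_inv M p x in \<alpha> y (tcoord M p y v))"

definition loc2 ::
  "('m, 'e::real_inner) mfd \<Rightarrow> ('m \<Rightarrow> 'e \<Rightarrow> 'e \<Rightarrow> 'v) \<Rightarrow> 'm \<Rightarrow> 'e \<Rightarrow> 'e \<Rightarrow> 'e \<Rightarrow> 'v" where
  "loc2 M \<omega> p x u v = (let y = chart_inv M p x in \<omega> y (tcoord M p y u) (tcoord M p y v))"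

definition one_form ::
  "('m, 'e::real_inner) mfd \<Rightarrow> ('m \<Rightarrow> 'e \<Rightarrow> 'v::real_normed_vector) \<Rightarrow> bool" where
  "one_form M \<alpha> \<longleftrightarrow> (\<forall>p\<in>points M. linear (\<alpha> p) \<and>
     (\<forall>v. smooth_on (chart M p ` chart_dom M p) (\<lambda>x. loc1 M \<alpha> p x v)))"

definition two_form ::
  "('m, 'e::real_inner) mfd \<Rightarrow> ('m \<Rightarrow> 'e \<Rightarrow> 'e \<Rightarrow> real) \<Rightarrow> bool" where
  "two_form M \<omega> \<longleftrightarrow> (\<forall>p\<in>points M. bilinear (\<omega> p) \<and> (\<forall>v. \<omega> p v v = 0) \<and>
     (\<forall>u v. smooth_on (chart M p ` chart_dom M p) (\<lambda>x. loc2 M \<omega> p x u v)))"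

text \<open>The exterior derivatives at \<open>p\<close> are computed in the chart at \<open>p\<close>, without factor
  \<open>1/2\<close> or \<open>1/3\<close>.\<close>

definition ext_deriv1 ::
  "('m, 'e::real_inner) mfd \<Rightarrow> ('m \<Rightarrow> 'e \<Rightarrow> real) \<Rightarrow> 'm \<Rightarrow> 'e \<Rightarrow> 'e \<Rightarrow> real" where
  "ext_deriv1 M \<alpha> p u v =
     frechet_derivative (\<lambda>x. loc1 M \<alpha> p x v) (at (chart M p p)) u
   - frechet_derivative (\<lambda>x. loc1 M \<alpha> p x u) (at (chart M p p)) v"

definition ext_deriv2 ::
  "('m, 'e::real_inner) mfd \<Rightarrow> ('m \<Rightarrow> 'e \<Rightarrow> 'e \<Rightarrow> real) \<Rightarrow> 'm \<Rightarrow> 'e \<Rightarrow> 'e \<Rightarrow> 'e \<Rightarrow> real" where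
  "ext_deriv2 M \<omega> p u v w =
     frechet_derivative (\<lambda>x. loc2 M \<omega> p x v w) (at (chart M p p)) u
   - frechet_derivative (\<lambda>x. loc2 M \<omega> p x u w) (at (chart M p p)) v
   + frechet_derivative (\<lambda>x. loc2 M \<omega> p x u v) (at (chart M p p)) w"

definition pull1 :: "('m, 'e::real_inner) mfd \<Rightarrow> ('n, 'f::real_inner) mfd \<Rightarrow> ('m \<Rightarrow> 'n) \<Rightarrow>
    ('n \<Rightarrow> 'f \<Rightarrow> real) \<Rightarrow> 'm \<Rightarrow> 'e \<Rightarrow> real" where
  "pull1 M N f \<alpha> p v = \<alpha> (f p) (tmap M N f p v)"

definition pull2 :: "('m, 'e::real_inner) mfd \<Rightarrow> ('n, 'f::real_inner) mfd \<Rightarrow> ('m \<Rightarrow> 'n) \<Rightarrow>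
    ('n \<Rightarrow> 'f \<Rightarrow> 'f \<Rightarrow> real) \<Rightarrow> 'm \<Rightarrow> 'e \<Rightarrow> 'e \<Rightarrow> real" where
  "pull2 M N f \<omega> p u v = \<omega> (f p) (tmap M N f p u) (tmap M N f p v)"

definition nondegenerate_on :: "'e set \<Rightarrow> ('e::real_vector \<Rightarrow> 'e \<Rightarrow> real) \<Rightarrow> bool" where
  "nondegenerate_on E B \<longleftrightarrow>
     (\<forall>u\<in>E. (\<forall>v\<in>E. B u v = 0) \<longrightarrow> u = 0) \<and> (\<forall>v\<in>E. (\<forall>u\<in>E. B u v = 0) \<longrightarrow> v = 0)"

definition symplectic_form ::
  "('m, 'e::real_inner) mfd \<Rightarrow> ('m \<Rightarrow> 'e \<Rightarrow> 'e \<Rightarrow> real) \<Rightarrow> bool" where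
  "symplectic_form M \<omega> \<longleftrightarrow> two_form M \<omega> \<and>
     (\<forall>p\<in>points M. (\<forall>u v w. ext_deriv2 M \<omega> p u v w = 0) \<and> nondegenerate_on UNIV (\<omega> p))"


section \<open>Cotangent bundle\<close>

text \<open>Covectors at \<open>y\<close> are linear functionals on the model space, i.e. on the tangent space at
  \<open>y\<close>. In the chart of the cotangent bundle induced by the chart of \<open>S\<close> at \<open>x\<close>, the fibre
  coordinate of a covector \<open>r\<close> at \<open>y\<close> is the vector whose components are those of \<open>r\<close> with
  respect to the coordinate frame of the chart at \<open>x\<close>.\<close>

definition riesz :: "('e::real_inner \<Rightarrow> real) \<Rightarrow> 'e" where
  "riesz l = (THE a. \<forall>v. a \<bullet> v = l v)"

definition cotangent :: "('m, 'e::real_inner) mfd \<Rightarrow> ('m \<times> ('e \<Rightarrow> real), 'e \<times> 'e) mfd" where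
  "cotangent S = \<lparr>points = {(y, r). y \<in> points S \<and> linear r},
     chart_dom = (\<lambda>(x, _). {(y, r). y \<in> chart_dom S x \<and> linear r}),
     chart = (\<lambda>(x, _) (y, r). (chart S x y, riesz (\<lambda>v. r (tcoord S x y v))))\<rparr>"

definition liouville ::
  "('m, 'e::real_inner) mfd \<Rightarrow> 'm \<times> ('e \<Rightarrow> real) \<Rightarrow> 'e \<times> 'e \<Rightarrow> real" where
  "liouville S z w = snd z (tmap (cotangent S) S fst z w)"

definition canonical_symplectic ::
  "('m, 'e::real_inner) mfd \<Rightarrow> 'm \<times> ('e \<Rightarrow> real) \<Rightarrow> 'e \<times> 'e \<Rightarrow> 'e \<times> 'e \<Rightarrow> real" where
  "canonical_symplectic S z u v = - ext_deriv1 (cotangent S) (liouville S) z u v"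


section \<open>Lie group actions, quotients and connections\<close>

definition lie_group :: "('g, 'x) monoid_scheme \<Rightarrow> ('g, 'l::real_inner) mfd \<Rightarrow> bool" where
  "lie_group G GM \<longleftrightarrow> group G \<and> smooth_manifold GM \<and> points GM = carrier G \<and>
     smooth_map (prod_mfd GM GM) GM (\<lambda>(g, h). g \<otimes>\<^bsub>G\<^esub> h) \<and>
     smooth_map GM GM (\<lambda>g. inv\<^bsub>G\<^esub> g)"

definition smooth_action :: "('g, 'x) monoid_scheme \<Rightarrow> ('g, 'l::real_inner) mfd \<Rightarrow>
    ('m, 'e::real_inner) mfd \<Rightarrow> ('g \<Rightarrow> 'm \<Rightarrow> 'm) \<Rightarrow> bool" where
  "smooth_action G GM M act \<longleftrightarrow> group_action G (points M) act \<and>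
     smooth_map (prod_mfd GM M) M (\<lambda>(g, q). act g q)"

definition free_action :: "('g, 'x) monoid_scheme \<Rightarrow> ('m, 'e) mfd \<Rightarrow> ('g \<Rightarrow> 'm \<Rightarrow> 'm) \<Rightarrow> bool" where
  "free_action G M act \<longleftrightarrow> (\<forall>g\<in>carrier G. \<forall>q\<in>points M. act g q = q \<longrightarrow> g = \<one>\<^bsub>G\<^esub>)"

definition proper_action ::
  "('g, 'l::real_inner) mfd \<Rightarrow> ('m, 'e::real_inner) mfd \<Rightarrow> ('g \<Rightarrow> 'm \<Rightarrow> 'm) \<Rightarrow> bool" where
  "proper_action GM M act \<longleftrightarrow>
     proper_map (mfd_top (prod_mfd GM M)) (mfd_top (prod_mfd M M)) (\<lambda>(g, q). (q, act g q))"

definition diag_act :: "('g \<Rightarrow> 'm \<Rightarrow> 'm) \<Rightarrow> 'g \<Rightarrow> 'm \<times> 'm \<Rightarrow> 'm \<times> 'm" where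
  "diag_act act g = (\<lambda>(a, b). (act g a, act g b))"

definition invariant_set ::
  "('g, 'x) monoid_scheme \<Rightarrow> ('g \<Rightarrow> 'm \<Rightarrow> 'm) \<Rightarrow> 'm set \<Rightarrow> bool" where
  "invariant_set G act X \<longleftrightarrow> (\<forall>g\<in>carrier G. \<forall>z\<in>X. act g z \<in> X)"

text \<open>\<open>B\<close> is the quotient manifold of \<open>M\<close> by the action: its points are the orbits and the
  projection is a principal bundle, with local sections \<open>\<sigma>\<close> giving local trivializations.
  Such a smooth structure on the orbit set is unique, and for a free and proper action it exists.\<close>

definition quotient_manifold :: "('g, 'x) monoid_scheme \<Rightarrow> ('g, 'l::real_inner) mfd \<Rightarrow>
    ('m, 'e::real_inner) mfd \<Rightarrow> ('g \<Rightarrow> 'm \<Rightarrow> 'm) \<Rightarrow> ('m set, 's::real_inner) mfd \<Rightarrow> bool" where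
  "quotient_manifold G GM M act B \<longleftrightarrow>
     smooth_manifold B \<and> points B = orbits G (points M) act \<and>
     smooth_map M B (orbit G act) \<and>
     (\<forall>b\<in>points B. \<exists>X \<sigma>. openin (mfd_top B) X \<and> b \<in> X \<and>
        smooth_map (open_sub B X) M \<sigma> \<and> (\<forall>x\<in>X. orbit G act (\<sigma> x) = x) \<and>
        diffeo (prod_mfd GM (open_sub B X)) (open_sub M {q \<in> points M. orbit G act q \<in> X})
          (\<lambda>(g, x). act g (\<sigma> x)))"

text \<open>The Lie algebra is the tangent space of the group at the identity. The infinitesimal
  generator of \<open>\<xi>\<close> at \<open>q\<close> is the velocity at \<open>t = 0\<close> of \<open>exp (t \<xi>)\<close> acting on \<open>q\<close>, that is, the
  image of \<open>\<xi>\<close> under the tangent map of the orbit map.\<close>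

definition inf_gen :: "('g, 'x) monoid_scheme \<Rightarrow> ('g, 'l::real_inner) mfd \<Rightarrow>
    ('m, 'e::real_inner) mfd \<Rightarrow> ('g \<Rightarrow> 'm \<Rightarrow> 'm) \<Rightarrow> 'l \<Rightarrow> 'm \<Rightarrow> 'e" where
  "inf_gen G GM M act \<xi> q = tmap GM M (\<lambda>g. act g q) \<one>\<^bsub>G\<^esub> \<xi>"

definition vertical :: "('g, 'x) monoid_scheme \<Rightarrow> ('g, 'l::real_inner) mfd \<Rightarrow>
    ('m, 'e::real_inner) mfd \<Rightarrow> ('g \<Rightarrow> 'm \<Rightarrow> 'm) \<Rightarrow> 'm \<Rightarrow> 'e set" where
  "vertical G GM M act q = range (\<lambda>\<xi>. inf_gen G GM M act \<xi> q)"

definition Ad :: "('g, 'x) monoid_scheme \<Rightarrow> ('g, 'l::real_inner) mfd \<Rightarrow> 'g \<Rightarrow> 'l \<Rightarrow> 'l" where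
  "Ad G GM g \<xi> = tmap GM GM (\<lambda>h. g \<otimes>\<^bsub>G\<^esub> h \<otimes>\<^bsub>G\<^esub> inv\<^bsub>G\<^esub> g) \<one>\<^bsub>G\<^esub> \<xi>"

definition principal_connection :: "('g, 'x) monoid_scheme \<Rightarrow> ('g, 'l::real_inner) mfd \<Rightarrow>
    ('m, 'e::real_inner) mfd \<Rightarrow> ('g \<Rightarrow> 'm \<Rightarrow> 'm) \<Rightarrow> ('m \<Rightarrow> 'e \<Rightarrow> 'l) \<Rightarrow> bool" where
  "principal_connection G GM M act \<AA> \<longleftrightarrow> one_form M \<AA> \<and>
     (\<forall>q\<in>points M. \<forall>\<xi>. \<AA> q (inf_gen G GM M act \<xi> q) = \<xi>) \<and>
     (\<forall>g\<in>carrier G. \<forall>q\<in>points M. \<forall>v.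
        \<AA> (act g q) (tmap M M (act g) q v) = Ad G GM g (\<AA> q v))"


section \<open>Discrete mechanics\<close>

definition slot1 :: "('m, 'e::real_inner) mfd \<Rightarrow> ('m \<times> 'm \<Rightarrow> real) \<Rightarrow> 'm \<times> 'm \<Rightarrow> 'e \<Rightarrow> real" where
  "slot1 M f z = tmap M vec_mfd (\<lambda>x. f (x, snd z)) (fst z)"

definition slot2 :: "('m, 'e::real_inner) mfd \<Rightarrow> ('m \<times> 'm \<Rightarrow> real) \<Rightarrow> 'm \<times> 'm \<Rightarrow> 'e \<Rightarrow> real" where
  "slot2 M f z = tmap M vec_mfd (\<lambda>y. f (fst z, y)) (snd z)"

definition slot21 ::
  "('m, 'e::real_inner) mfd \<Rightarrow> ('m \<times> 'm \<Rightarrow> real) \<Rightarrow> 'm \<times> 'm \<Rightarrow> 'e \<Rightarrow> 'e \<Rightarrow> real" where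
  "slot21 M f z u v = tmap M vec_mfd (\<lambda>y. slot1 M f (fst z, y) u) (snd z) v"

definition momentum :: "('g, 'x) monoid_scheme \<Rightarrow> ('g, 'l::real_inner) mfd \<Rightarrow>
    ('m, 'e::real_inner) mfd \<Rightarrow> ('g \<Rightarrow> 'm \<Rightarrow> 'm) \<Rightarrow> ('m \<times> 'm \<Rightarrow> real) \<Rightarrow> 'm \<times> 'm \<Rightarrow> 'l \<Rightarrow> real" where
  "momentum G GM Q act L z \<xi> = slot2 Q L z (inf_gen G GM Q act \<xi> (snd z))"

definition discrete_legendre ::
  "('m, 'e::real_inner) mfd \<Rightarrow> ('m \<times> 'm \<Rightarrow> real) \<Rightarrow> 'm \<times> 'm \<Rightarrow> 'm \<times> ('e \<Rightarrow> real)" where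
  "discrete_legendre Q L z = (snd z, slot2 Q L z)"

definition Theta_L ::
  "('m, 'e::real_inner) mfd \<Rightarrow> ('m \<times> 'm \<Rightarrow> real) \<Rightarrow> 'm \<times> 'm \<Rightarrow> 'e \<times> 'e \<Rightarrow> real" where
  "Theta_L Q L z w = slot2 Q L z (snd w)"

definition Omega_L ::
  "('m, 'e::real_inner) mfd \<Rightarrow> ('m \<times> 'm \<Rightarrow> real) \<Rightarrow> 'm \<times> 'm \<Rightarrow> 'e \<times> 'e \<Rightarrow> 'e \<times> 'e \<Rightarrow> real" where
  "Omega_L Q L z u v = - ext_deriv1 (prod_mfd Q Q) (Theta_L Q L) z u v"

definition mu_form :: "('l \<Rightarrow> real) \<Rightarrow> ('m \<Rightarrow> 'e \<Rightarrow> 'l) \<Rightarrow> 'm \<Rightarrow> 'e \<Rightarrow> real" where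
  "mu_form \<mu> \<AA> q v = \<mu> (\<AA> q v)"

text \<open>The difference of the pullbacks of a one-form along the second and first projections.\<close>

definition diff_form ::
  "('m, 'e::real_inner) mfd \<Rightarrow> ('m \<Rightarrow> 'e \<Rightarrow> real) \<Rightarrow> 'm \<times> 'm \<Rightarrow> 'e \<times> 'e \<Rightarrow> real" where
  "diff_form Q \<alpha> z w = pull1 (prod_mfd Q Q) Q snd \<alpha> z w - pull1 (prod_mfd Q Q) Q fst \<alpha> z w"

definition comp1 :: "('m \<times> 'm \<Rightarrow> 'e \<times> 'e \<Rightarrow> real) \<Rightarrow> 'm \<times> 'm \<Rightarrow> 'e::zero \<Rightarrow> real" where
  "comp1 \<alpha> z a = \<alpha> z (a, 0)"

definition comp2 :: "('m \<times> 'm \<Rightarrow> 'e \<times> 'e \<Rightarrow> real) \<Rightarrow> 'm \<times> 'm \<Rightarrow> 'e::zero \<Rightarrow> real" where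
  "comp2 \<alpha> z b = \<alpha> z (0, b)"

definition pair_proj :: "('g, 'x) monoid_scheme \<Rightarrow> ('g \<Rightarrow> 'm \<Rightarrow> 'm) \<Rightarrow>
    'm \<times> 'm \<Rightarrow> 'm set \<times> 'm set" where
  "pair_proj G act = (\<lambda>(a, b). (orbit G act a, orbit G act b))"

definition reduced_legendre :: "('s, 'f::real_inner) mfd \<Rightarrow> ('s \<times> 's \<Rightarrow> real) \<Rightarrow>
    ('s \<times> 's \<Rightarrow> 'f \<times> 'f \<Rightarrow> real) \<Rightarrow> 's \<times> 's \<Rightarrow> 's \<times> ('f \<Rightarrow> real)" where
  "reduced_legendre S Lh Ah z = (snd z, \<lambda>v. slot2 S Lh z v - comp2 Ah z v)"

definition Omega_mu :: "('s, 'f::real_inner) mfd \<Rightarrow> ('s \<times> 's) set \<Rightarrow> ('s \<times> 's \<Rightarrow> real) \<Rightarrow>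
    ('s \<times> 's \<Rightarrow> 'f \<times> 'f \<Rightarrow> real) \<Rightarrow> ('s \<Rightarrow> 'f \<Rightarrow> 'f \<Rightarrow> real) \<Rightarrow>
    's \<times> 's \<Rightarrow> 'f \<times> 'f \<Rightarrow> 'f \<times> 'f \<Rightarrow> real" where
  "Omega_mu S V Lh Ah \<beta> =
     pull2 (open_sub (prod_mfd S S) V) (cotangent S) (reduced_legendre S Lh Ah)
       (\<lambda>z u v. canonical_symplectic S z u v - pull2 (cotangent S) S fst \<beta> z u v)"

definition DR_equation :: "('s, 'f::real_inner) mfd \<Rightarrow> ('s \<times> 's \<Rightarrow> real) \<Rightarrow>
    ('s \<times> 's \<Rightarrow> 'f \<times> 'f \<Rightarrow> real) \<Rightarrow> 's \<Rightarrow> 's \<Rightarrow> 's \<Rightarrow> bool" where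
  "DR_equation S Lh Ah x0 x1 x2 \<longleftrightarrow> (\<forall>v.
     slot2 S Lh (x0, x1) v + slot1 S Lh (x1, x2) v = comp2 Ah (x0, x1) v + comp1 Ah (x1, x2) v)"

text \<open>The smooth map \<open>F\<close> is a discrete flow map of the DR equations, with domain \<open>W\<close>.\<close>

definition DR_flow_map :: "('s, 'f::real_inner) mfd \<Rightarrow> ('s \<times> 's) set \<Rightarrow> ('s \<times> 's \<Rightarrow> real) \<Rightarrow>
    ('s \<times> 's \<Rightarrow> 'f \<times> 'f \<Rightarrow> real) \<Rightarrow> ('s \<times> 's) set \<Rightarrow> ('s \<times> 's \<Rightarrow> 's \<times> 's) \<Rightarrow> bool" where
  "DR_flow_map S V Lh Ah W F \<longleftrightarrow> W \<subseteq> V \<and> openin (mfd_top (prod_mfd S S)) W \<and>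
     smooth_map (open_sub (prod_mfd S S) W) (open_sub (prod_mfd S S) V) F \<and>
     (\<forall>x0 x1. (x0, x1) \<in> W \<longrightarrow>
        (\<exists>x2. F (x0, x1) = (x1, x2) \<and> DR_equation S Lh Ah x0 x1 x2))"

definition flow_dom :: "'a set \<Rightarrow> 'a set \<Rightarrow> ('a \<Rightarrow> 'a) \<Rightarrow> nat \<Rightarrow> 'a set" where
  "flow_dom V W F n = {z \<in> V. \<forall>i<n. (F ^^ i) z \<in> W}"

end

theory Submission
  imports Defs
begin

text \<open>Write \<open>\<eta> = dLh - Ah\<close> on \<open>V\<close> and let \<open>\<Gamma>\<close> be its second component, viewed as a one-form.
  Naturality of the exterior derivative under the reduced Legendre transform gives
  \<open>\<Omega> = - d\<Gamma> - p2^* \<beta>\<close>, where \<open>p1\<close>, \<open>p2\<close> are the projections of \<open>S \<times> S\<close>. On the level set of the momentum map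
  the form \<open>dL - \<A>\<close> kills vertical vectors in each slot separately, so \<open>\<Gamma>\<close> pulls back to
  \<open>\<Theta>_L - \<pi>2^* A\<close>; differentiating gives the pullback formula. The same argument gives
  \<open>dAh = p2^* \<beta> - p1^* \<beta>\<close>, hence also \<open>\<Omega> = - d\<Gamma>' - p1^* \<beta>\<close> with \<open>\<Gamma>' = \<Gamma> - \<eta>\<close>. The DR equation says
  \<open>F^* \<Gamma>' = \<Gamma>\<close>, and \<open>p1 \<circ> F = p2\<close>, so \<open>F\<close> preserves \<open>\<Omega>\<close>. The form is closed because \<open>\<beta>\<close> is locally
  exact, and nondegenerate because vectors \<open>(a, 0)\<close> lift to vectors \<open>(c, 0)\<close> tangent to the level set, on
  which the discrete Legendre transform is injective.\<close>

section \<open>Finite-dimensional inner product spaces\<close>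

text \<open>Identities between forms on \<open>V\<close> are checked after pullback to
  \<open>U\<close>. This loses nothing, because the projection from \<open>U\<close> to
  \<open>V\<close> has a local section through every point of \<open>U\<close> and is therefore
  surjective on points and on tangent vectors. The vertical vanishing has a different source in each
  slot. In the second, the momentum condition and the reproducing property of the connection both
  give \<mu> applied to the generator. In the first no momentum condition is at hand; instead the
  form on \<open>U\<close> comes from \<open>V\<close>, hence kills diagonal generators, and the
  second-slot part is subtracted. A vector \<open>(0, b)\<close> need not be tangent to the level
  set, so this splitting has to take place in the tangent space of \<open>Q \<times> Q\<close>. For
  nondegeneracy, \<Omega> vanishes on pairs of vectors from the first factor; all depends on one
  mixed block, whose injectivity on one side comes from the Legendre transform and on the other from
  equality of dimensions. A tangent vector is written in the chart of its own base point, so the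
  chart varies with the point; chart independence of the exterior derivative is obtained as
  naturality under the identity map.\<close>

definition onb :: "'e::real_inner set \<Rightarrow> bool" where
  "onb B \<longleftrightarrow> finite B \<and> (\<forall>b\<in>B. \<forall>c\<in>B. b \<bullet> c = (if b = c then 1 else 0)) \<and>
     (\<forall>x. (\<Sum>b\<in>B. (x \<bullet> b) *\<^sub>R b) = x)"

text \<open>Finite dimensionality is a property of the model type, hence the type token. Dimension
  zero is included: there the empty set is an orthonormal basis.\<close>

definition fdim :: "'e::real_inner itself \<Rightarrow> bool" where
  "fdim _ \<longleftrightarrow> (\<exists>B::'e set. onb B)"

text \<open>Gram-Schmidt: the part of the new vector orthogonal to the family built so far is
  normalised and adjoined, or nothing is adjoined when that part vanishes.\<close>

lemma gram_schmidt:
  fixes B :: "'e::real_inner set"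
  assumes "finite B"
  shows "\<exists>E. finite E \<and> (\<forall>b\<in>E. \<forall>c\<in>E. b \<bullet> c = (if b = c then 1 else 0)) \<and> B \<subseteq> span E"
  using assms
proof (induction B)
  case empty
  then show ?case by (intro exI[of _ "{}"]) auto
next
  case (insert x B)
  then obtain E where E: "finite E" "\<And>b c. b \<in> E \<Longrightarrow> c \<in> E \<Longrightarrow> b \<bullet> c = (if b = c then 1 else 0)"
    "B \<subseteq> span E" by blast
  define y where "y = x - (\<Sum>b\<in>E. (x \<bullet> b) *\<^sub>R b)"
  have yE: "y \<bullet> c = 0" if "c \<in> E" for c
  proof -
    have "(\<Sum>b\<in>E. (x \<bullet> b) *\<^sub>R b) \<bullet> c = (\<Sum>b\<in>E. if b = c then x \<bullet> c else 0)"
      unfolding inner_sum_left by (intro sum.cong) (auto simp: E(2) that)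
    then show ?thesis using that E(1) by (simp add: y_def inner_diff_left)
  qed
  have x: "x = y + (\<Sum>b\<in>E. (x \<bullet> b) *\<^sub>R b)" by (simp add: y_def)
  have sp: "(\<Sum>b\<in>E. (x \<bullet> b) *\<^sub>R b) \<in> span E" by (intro span_sum span_scale span_base)
  show ?case
  proof (cases "y = 0")
    case True
    then have "x \<in> span E" using x sp by simp
    then show ?thesis using E by blast
  next
    case False
    define z where "z = (1 / norm y) *\<^sub>R y"
    have zz: "z \<bullet> z = 1" using False by (simp add: z_def dot_square_norm power2_eq_square)
    have zE: "z \<bullet> c = 0" "c \<bullet> z = 0" if "c \<in> E" for c
      using yE[OF that] by (simp_all add: z_def inner_commute)
    have "y = norm y *\<^sub>R z" using False by (simp add: z_def)
    then have "y \<in> span (insert z E)" by (metis span_base span_scale insertI1)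
    moreover have "(\<Sum>b\<in>E. (x \<bullet> b) *\<^sub>R b) \<in> span (insert z E)"
      using sp span_mono[of E "insert z E"] by blast
    ultimately have "x \<in> span (insert z E)" using x span_add by metis
    moreover have "B \<subseteq> span (insert z E)" using E(3) span_mono[of E "insert z E"] by blast
    moreover have "\<forall>b\<in>insert z E. \<forall>c\<in>insert z E. b \<bullet> c = (if b = c then 1 else 0)"
      using zz zE E(2) by (metis insert_iff zero_neq_one)
    ultimately show ?thesis using E(1) by (intro exI[of _ "insert z E"]) blast
  qed
qed

text \<open>Connects the spanning condition in \<open>smooth_manifold\<close> with the orthonormal
  expansion on which all coordinate computations below rest.\<close>

lemma fdim_iff: "fdim TYPE('e::real_inner) \<longleftrightarrow> (\<exists>B::'e::real_inner set. finite B \<and> span B = UNIV)"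
proof
  assume "\<exists>B::'e set. finite B \<and> span B = UNIV"
  then obtain B :: "'e set" where "finite B" "span B = UNIV" by blast
  then obtain E where E: "finite E" "\<And>b c. b \<in> E \<Longrightarrow> c \<in> E \<Longrightarrow> b \<bullet> c = (if b = c then 1 else 0)"
    "B \<subseteq> span E" using gram_schmidt[of B] by blast
  have sp: "x \<in> span E" for x
    using E(3) \<open>span B = UNIV\<close> by (metis UNIV_I span_minimal subspace_span subsetD)
  have "(\<Sum>b\<in>E. (x \<bullet> b) *\<^sub>R b) = x" for x
    using sp[of x]
  proof (induction rule: span_induct_alt)
    case base
    then show ?case by simp
  next
    case (step c z y)
    have "(\<Sum>b\<in>E. (z \<bullet> b) *\<^sub>R b) = (\<Sum>b\<in>E. if b = z then z else 0)"
      by (intro sum.cong) (auto simp: E(2) step)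
    then have "(\<Sum>b\<in>E. (z \<bullet> b) *\<^sub>R b) = z" using step E(1) by simp
    then have "(\<Sum>b\<in>E. c *\<^sub>R ((z \<bullet> b) *\<^sub>R b)) = c *\<^sub>R z" by (metis scaleR_sum_right)
    then show ?case using step by (simp add: inner_add_left scaleR_add_left sum.distrib)
  qed
  then show "fdim TYPE('e)" using E unfolding fdim_def onb_def by blast
next
  assume "fdim TYPE('e)"
  then obtain B :: "'e set" where B: "finite B" "\<And>x. (\<Sum>b\<in>B. (x \<bullet> b) *\<^sub>R b) = x"
    unfolding fdim_def onb_def by blast
  have "x \<in> span B" for x
    by (subst B(2)[symmetric]) (intro span_sum span_scale span_base)
  then show "\<exists>B::'e set. finite B \<and> span B = UNIV" using B(1) by blast
qed

lemma fdimE: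
  assumes "fdim TYPE('e::real_inner)"
  obtains B :: "'e::real_inner set" where "finite B" "\<And>x. (\<Sum>b\<in>B. (x \<bullet> b) *\<^sub>R b) = x"
    "\<And>b c. b \<in> B \<Longrightarrow> c \<in> B \<Longrightarrow> b \<bullet> c = (if b = c then 1 else 0)"
  using assms unfolding fdim_def onb_def by blast

lemma linear_expand:
  assumes "finite B" "\<And>x. (\<Sum>b\<in>B. (x \<bullet> b) *\<^sub>R b) = x" "linear f"
  shows "f x = (\<Sum>b\<in>B. (x \<bullet> b) *\<^sub>R f b)"
proof -
  have "f x = f (\<Sum>b\<in>B. (x \<bullet> b) *\<^sub>R b)" using assms(2) by simp
  also have "\<dots> = (\<Sum>b\<in>B. f ((x \<bullet> b) *\<^sub>R b))" using assms(3) by (rule linear_sum)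
  finally show ?thesis using assms(3) by (simp add: linear_scale)
qed

text \<open>Expanded in an orthonormal basis, a linear map is a finite sum of bounded functionals
  times constant vectors.\<close>

lemma fdim_bounded_linear:
  fixes f :: "'a::real_inner \<Rightarrow> 'b::real_normed_vector"
  assumes "fdim TYPE('a)" "linear f"
  shows "bounded_linear f"
proof -
  obtain B :: "'a set" where B: "finite B" "\<And>x. (\<Sum>b\<in>B. (x \<bullet> b) *\<^sub>R b) = x"
    using fdimE[OF assms(1)] by metis
  have "f = (\<lambda>x. \<Sum>b\<in>B. (x \<bullet> b) *\<^sub>R f b)" using linear_expand[OF B assms(2)] by blast
  moreover have "bounded_linear (\<lambda>x. \<Sum>b\<in>B. (x \<bullet> b) *\<^sub>R f b)"
    by (intro bounded_linear_sum bounded_linear_scaleR_const bounded_linear_inner_left)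
  ultimately show ?thesis by simp
qed

lemma fdim_prod:
  assumes "fdim TYPE('a::real_inner)" "fdim TYPE('b::real_inner)"
  shows "fdim TYPE('a \<times> 'b)"
proof -
  obtain A :: "'a set" where A: "finite A" "\<And>x. (\<Sum>b\<in>A. (x \<bullet> b) *\<^sub>R b) = x"
    using fdimE[OF assms(1)] by metis
  obtain B :: "'b set" where B: "finite B" "\<And>x. (\<Sum>b\<in>B. (x \<bullet> b) *\<^sub>R b) = x"
    using fdimE[OF assms(2)] by metis
  let ?E = "(\<lambda>a. (a, 0)) ` A \<union> (\<lambda>b. (0, b)) ` B"
  have "z \<in> span ?E" for z
  proof -
    have "z = (\<Sum>a\<in>A. (fst z \<bullet> a) *\<^sub>R (a, 0)) + (\<Sum>b\<in>B. (snd z \<bullet> b) *\<^sub>R (0, b))"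
      by (intro prod_eqI) (simp_all add: fst_sum snd_sum A B)
    also have "\<dots> \<in> span ?E" by (intro span_add span_sum span_scale span_base) auto
    finally show ?thesis .
  qed
  then have "finite ?E \<and> span ?E = UNIV" using A(1) B(1) by blast
  then show ?thesis unfolding fdim_iff by blast
qed

text \<open>\<open>riesz\<close> is a definite description, so both existence (the basis expansion)
  and uniqueness (nondegeneracy of the inner product) enter before its value can be used.\<close>

lemma riesz_inner:
  assumes "fdim TYPE('a::real_inner)" "linear (l :: 'a \<Rightarrow> real)"
  shows "riesz l \<bullet> v = l v"
proof -
  obtain B :: "'a set" where B: "finite B" "\<And>x. (\<Sum>b\<in>B. (x \<bullet> b) *\<^sub>R b) = x"
    using fdimE[OF assms(1)] by metis
  have ex: "\<forall>v. (\<Sum>b\<in>B. l b *\<^sub>R b) \<bullet> v = l v"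
  proof
    fix v
    show "(\<Sum>b\<in>B. l b *\<^sub>R b) \<bullet> v = l v"
      unfolding linear_expand[OF B assms(2), of v]
      by (simp add: inner_sum_left inner_commute[of v] mult.commute)
  qed
  have "\<exists>!a. \<forall>v. a \<bullet> v = l v"
  proof (rule ex1I[of _ "\<Sum>b\<in>B. l b *\<^sub>R b"])
    show "\<forall>v. (\<Sum>b\<in>B. l b *\<^sub>R b) \<bullet> v = l v" by (rule ex)
    fix a assume "\<forall>v. a \<bullet> v = l v"
    with ex have "\<forall>v. v \<bullet> a = v \<bullet> (\<Sum>b\<in>B. l b *\<^sub>R b)" by (simp add: inner_commute)
    then show "a = (\<Sum>b\<in>B. l b *\<^sub>R b)" by (simp only: vector_eq_ldot)
  qed
  from theI'[OF this] show ?thesis unfolding riesz_def by blast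
qed

lemma riesz_unique:
  assumes "fdim TYPE('a::real_inner)" "linear (l :: 'a \<Rightarrow> real)" "\<And>v. a \<bullet> v = l v"
  shows "riesz l = a"
proof -
  have "\<forall>v. riesz l \<bullet> v = a \<bullet> v" using riesz_inner[OF assms(1,2)] assms(3) by simp
  then show ?thesis by (simp only: vector_eq_rdot)
qed

text \<open>The explicit formula from which smoothness of the fibre coordinate of a covector in a
  parameter is read off.\<close>

lemma riesz_eq_sum:
  fixes l :: "'a::real_inner \<Rightarrow> real"
  assumes "fdim TYPE('a)" "linear l" "finite B" "\<And>x. (\<Sum>b\<in>B. (x \<bullet> b) *\<^sub>R b) = x"
  shows "riesz l = (\<Sum>b\<in>B. l b *\<^sub>R b)"
proof (rule riesz_unique[OF assms(1,2)])
  show "(\<Sum>b\<in>B. l b *\<^sub>R b) \<bullet> v = l v" for v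
    unfolding linear_expand[OF assms(3,4,2), of v]
    by (simp add: inner_sum_left inner_commute[of v] mult.commute)
qed

text \<open>A bilinear form on one finite-dimensional space is represented by a square matrix, so an
  injective one is surjective.\<close>

lemma bilinear_left_right_nondegenerate:
  fixes b :: "'a::real_inner \<Rightarrow> 'a \<Rightarrow> real"
  assumes fd: "fdim TYPE('a)" and b: "bilinear b"
    and left: "\<And>x. (\<And>y. b x y = 0) \<Longrightarrow> x = 0"
    and y: "\<And>x. b x y = 0"
  shows "y = 0"
proof -
  have lin: "linear (b x)" for x using b by (simp add: bilinear_def)
  define f where "f x = riesz (b x)" for x
  have f: "f x \<bullet> v = b x v" for x v unfolding f_def by (rule riesz_inner[OF fd lin])
  have linf: "linear f"
  proof (rule linearI)
    have "\<forall>v. f (x + y) \<bullet> v = (f x + f y) \<bullet> v" for x y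
      by (simp add: f inner_add_left bilinear_ladd[OF b])
    then show "f (x + y) = f x + f y" for x y by (simp only: vector_eq_rdot)
    have "\<forall>v. f (c *\<^sub>R x) \<bullet> v = (c *\<^sub>R f x) \<bullet> v" for c x
      by (simp add: f bilinear_lmul[OF b])
    then show "f (c *\<^sub>R x) = c *\<^sub>R f x" for c x by (simp only: vector_eq_rdot)
  qed
  have inj: "inj f"
    unfolding linear_injective_0[OF linf] using left f by (metis inner_zero_left)
  obtain B :: "'a set" where B: "finite B" "\<And>x. (\<Sum>b\<in>B. (x \<bullet> b) *\<^sub>R b) = x"
    "\<And>b c. b \<in> B \<Longrightarrow> c \<in> B \<Longrightarrow> b \<bullet> c = (if b = c then 1 else 0)"
    using fdimE[OF fd] by metis
  have spB: "span B = UNIV"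
  proof -
    have "x \<in> span B" for x
      by (subst B(2)[symmetric]) (intro span_sum span_scale span_base)
    then show ?thesis by blast
  qed
  have indB: "independent B"
  proof (rule pairwise_orthogonal_independent)
    show "pairwise orthogonal B"
      by (auto simp: pairwise_def orthogonal_def B(3))
    show "0 \<notin> B" using B(3)[of 0 0] by auto
  qed
  have ind: "independent (f ` B)"
    by (rule linear_independent_injective_image[OF linf indB]) (rule inj_on_subset[OF inj subset_UNIV])
  have card: "card (f ` B) = card B" using inj by (meson card_image inj_on_subset subset_UNIV)
  \<comment> \<open>The images of the basis vectors are independent and as many as a spanning set,
    so no vector outside their span can be adjoined without exceeding the dimension.\<close>
  have "y \<in> span (f ` B)"
  proof (rule ccontr)
    assume ny: "y \<notin> span (f ` B)"
    then have "independent (insert y (f ` B))" using ind by (simp add: independent_insert)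
    then have "card (insert y (f ` B)) \<le> card B"
      by (rule independent_span_bound[OF B(1), THEN conjunct2]) (simp add: spB)
    moreover have "y \<notin> f ` B" by (rule contrapos_nn[OF ny]) (rule span_base)
    ultimately show False using card B(1) by simp
  qed
  \<comment> \<open>With \<open>y = f x\<close>, the inner product of \<open>y\<close> with itself
    is \<open>b x y\<close>, which is zero.\<close>
  then obtain x where "y = f x"
    using linear_span_image[OF linf] by blast
  then show ?thesis using y f by (metis inner_eq_zero_iff)
qed


section \<open>Calculus of smooth maps\<close>

abbreviation frd :: "('a::real_normed_vector \<Rightarrow> 'b::real_normed_vector) \<Rightarrow> 'a \<Rightarrow> 'a \<Rightarrow> 'b" where
  "frd f x \<equiv> frechet_derivative f (at x)"

lemma frd_eqI: "(f has_derivative f') (at x) \<Longrightarrow> frd f x = f'"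
  using frechet_derivative_at by metis

text \<open>\<open>frechet_derivative\<close> is a choice over all derivatives; the two functions
  have exactly the same ones at \<open>x\<close>, so the choices coincide, whether or not a
  derivative exists.\<close>

lemma frd_cong:
  assumes "open D" "x \<in> D" "\<And>y. y \<in> D \<Longrightarrow> f y = g y"
  shows "frd f x = frd g x"
proof -
  have "(f has_derivative F) (at x) \<longleftrightarrow> (g has_derivative F) (at x)" for F
    using has_derivative_transform_within_open[OF _ assms(1,2), of f F UNIV g]
      has_derivative_transform_within_open[OF _ assms(1,2), of g F UNIV f] assms(3) by auto
  then show ?thesis unfolding frechet_derivative_def by simp
qed

lemma differentiable_cong_open:
  assumes "open D" "x \<in> D" "\<And>y. y \<in> D \<Longrightarrow> f y = g y" "f differentiable (at x)"
  shows "g differentiable (at x)"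
  using assms has_derivative_transform_within_open[OF _ assms(1,2), of f _ UNIV g]
  unfolding differentiable_def by blast

lemma Ck_on_cong:
  assumes "open D" "\<And>x. x \<in> D \<Longrightarrow> f x = g x" "Ck_on k D f"
  shows "Ck_on k D g"
  using assms(2,3)
proof (induction k arbitrary: f g)
  case 0
  then show ?case by (simp cong: continuous_on_cong)
next
  case (Suc k)
  have "frd f x = frd g x" if "x \<in> D" for x
    using frd_cong[OF assms(1) that, of f g] Suc.prems(1) by blast
  then have "Ck_on k D (\<lambda>x. frd g x v)" for v
    using Suc.IH[of "\<lambda>x. frd f x v" "\<lambda>x. frd g x v"] Suc.prems(2) by simp
  moreover have "g differentiable (at x)" if "x \<in> D" for x
    using differentiable_cong_open[OF assms(1) that, of f g] Suc.prems that by simp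
  ultimately show ?case by simp
qed

lemma Ck_on_subset: "Ck_on k D f \<Longrightarrow> E \<subseteq> D \<Longrightarrow> Ck_on k E f"
  by (induction k arbitrary: f) (auto intro: continuous_on_subset)

lemma Ck_on_SucD: "Ck_on (Suc k) D f \<Longrightarrow> Ck_on k D f"
proof (induction k arbitrary: f)
  case 0
  then show ?case
    by (auto intro!: continuous_at_imp_continuous_on differentiable_imp_continuous_within)
next
  case (Suc k)
  have "Ck_on k D (\<lambda>x. frd f x v)" for v
    by (rule Suc.IH) (rule Suc.prems[unfolded Ck_on.simps(2)[of "Suc k"], THEN conjunct2, rule_format])
  then show ?case using Suc.prems by simp
qed

text \<open>Derivatives are taken in the full space and continuity on an open set is pointwise, so
  every clause of \<open>Ck_on\<close> can be tested on a neighbourhood of each point.\<close>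

lemma Ck_on_local:
  assumes "\<And>x. x \<in> D \<Longrightarrow> \<exists>A. open A \<and> x \<in> A \<and> Ck_on k A f"
  shows "Ck_on k D f"
  using assms
proof (induction k arbitrary: f)
  case 0
  then show ?case
    by (metis Ck_on.simps(1) continuous_at_imp_continuous_on continuous_on_eq_continuous_at)
next
  case (Suc k)
  have "f differentiable (at x)" if "x \<in> D" for x
    using Suc.prems[OF that] by auto
  moreover have "Ck_on k D (\<lambda>x. frd f x v)" for v
    by (rule Suc.IH) (use Suc.prems in fastforce)
  ultimately show ?case by simp
qed

lemma Ck_on_const: "Ck_on k D (\<lambda>x. c)"
  by (induction k arbitrary: c) auto

lemma Ck_on_add:
  assumes "Ck_on k D f" "Ck_on k D g" "open D"
  shows "Ck_on k D (\<lambda>x. f x + g x)"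
  using assms(1,2)
proof (induction k arbitrary: f g)
  case 0
  then show ?case by (simp add: continuous_on_add)
next
  case (Suc k)
  have "frd (\<lambda>x. f x + g x) x v = frd f x v + frd g x v" if "x \<in> D" for x v
    using Suc.prems that
    by (subst frd_eqI[OF has_derivative_add[OF frechet_derivative_works[THEN iffD1] frechet_derivative_works[THEN iffD1]]]) auto
  moreover have "Ck_on k D (\<lambda>x. frd f x v + frd g x v)" for v
    using Suc by auto
  ultimately have "Ck_on k D (\<lambda>x. frd (\<lambda>x. f x + g x) x v)" for v
    using Ck_on_cong[OF assms(3)] by (metis (no_types, lifting))
  then show ?case using Suc.prems by (auto intro: differentiable_add)
qed

lemma Ck_on_sum:
  assumes "\<And>i. i \<in> I \<Longrightarrow> Ck_on k D (f i)" "open D"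
  shows "Ck_on k D (\<lambda>x. \<Sum>i\<in>I. f i x)"
  using assms(1)
  by (induction I rule: infinite_finite_induct) (auto simp: Ck_on_const intro: Ck_on_add[OF _ _ assms(2)])

text \<open>The product rule leaves two products of one order less; the factor that is not
  differentiated is lowered by \<open>Ck_on_SucD\<close>.\<close>

lemma (in bounded_bilinear) Ck_on:
  assumes "Ck_on k D f" "Ck_on k D g" "open D"
  shows "Ck_on k D (\<lambda>x. prod (f x) (g x))"
  using assms(1,2)
proof (induction k arbitrary: f g)
  case 0
  then show ?case by (simp add: continuous_on)
next
  case (Suc k)
  have hd: "((\<lambda>x. prod (f x) (g x)) has_derivative (\<lambda>v. prod (f x) (frd g x v) + prod (frd f x v) (g x))) (at x)"
    if "x \<in> D" for x
    using Suc.prems that by (intro FDERIV) (auto simp: frechet_derivative_works[symmetric])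
  have "Ck_on k D (\<lambda>x. prod (f x) (frd g x v) + prod (frd f x v) (g x))" for v
    using Suc.prems Ck_on_SucD[OF Suc.prems(1)] Ck_on_SucD[OF Suc.prems(2)]
    by (intro Ck_on_add[OF _ _ assms(3)] Suc.IH) auto
  then have "Ck_on k D (\<lambda>x. frd (\<lambda>x. prod (f x) (g x)) x v)" for v
    by (rule Ck_on_cong[OF assms(3), rotated]) (simp add: frd_eqI[OF hd])
  then show ?case using hd by (auto simp: differentiable_def)
qed

lemma Ck_on_ident: "Ck_on k D (\<lambda>x. x)"
  by (cases k) (auto simp: Ck_on_const)

lemma Ck_on_bounded_linear:
  assumes "bounded_linear h"
  shows "Ck_on k D h"
proof (cases k)
  case 0
  then show ?thesis using assms by (simp add: linear_continuous_on)
next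
  case (Suc k)
  have "frd h x = h" for x by (rule frd_eqI) (rule bounded_linear_imp_has_derivative[OF assms])
  then show ?thesis
    using Suc assms by (auto simp: Ck_on_const bounded_linear_imp_differentiable)
qed

text \<open>The chain rule feeds \<open>frd g (f x)\<close> a direction that varies with
  \<open>x\<close>, while \<open>Ck_on\<close> speaks of fixed directions only. Expansion of that
  direction in an orthonormal basis gives a finite sum of products of scalar coefficients with
  derivatives of \<open>g\<close> in fixed directions, to which the induction hypothesis
  applies.\<close>

lemma Ck_on_compose:
  fixes f :: "'a::real_normed_vector \<Rightarrow> 'b::real_inner" and g :: "'b \<Rightarrow> 'c::real_normed_vector"
  assumes fd: "fdim TYPE('b)" and "Ck_on k D f" "Ck_on k E g" and D: "open D" "f ` D \<subseteq> E"
  shows "Ck_on k D (\<lambda>x. g (f x))"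
  using assms(2,3)
proof (induction k arbitrary: g)
  case 0
  then show ?case using D by (auto intro: continuous_on_compose2)
next
  case (Suc k)
  obtain B :: "'b set" where B: "finite B" "\<And>x. (\<Sum>b\<in>B. (x \<bullet> b) *\<^sub>R b) = x"
    using fdimE[OF fd] by metis
  have hd: "((\<lambda>x. g (f x)) has_derivative (\<lambda>v. frd g (f x) (frd f x v))) (at x)" if "x \<in> D" for x
    using Suc.prems that D(2)
    by (intro has_derivative_compose[where g = g and f = f]) (auto simp: frechet_derivative_works[symmetric])
  have eq: "(\<Sum>b\<in>B. (frd f x v \<bullet> b) *\<^sub>R frd g (f x) b) = frd (\<lambda>x. g (f x)) x v" if "x \<in> D" for x v
    unfolding frd_eqI[OF hd[OF that]]
    by (rule linear_expand[OF B, symmetric], rule linear_frechet_derivative)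
      (use Suc.prems that D in auto)
  have "Ck_on k D (\<lambda>x. \<Sum>b\<in>B. (frd f x v \<bullet> b) *\<^sub>R frd g (f x) b)" for v
    using Suc.prems Ck_on_SucD[OF Suc.prems(1)]
    by (intro Ck_on_sum D(1) bounded_bilinear.Ck_on[OF bounded_bilinear_scaleR] Suc.IH
        bounded_bilinear.Ck_on[OF bounded_bilinear_inner] Ck_on_const) auto
  then have "Ck_on k D (\<lambda>x. frd (\<lambda>x. g (f x)) x v)" for v
    by (rule Ck_on_cong[OF D(1), rotated]) (rule eq)
  then show ?case using hd by (auto simp: differentiable_def)
qed

lemma smooth_on_cong: "open D \<Longrightarrow> (\<And>x. x \<in> D \<Longrightarrow> f x = g x) \<Longrightarrow> smooth_on D f \<Longrightarrow> smooth_on D g"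
  unfolding smooth_on_def using Ck_on_cong by blast

lemma smooth_on_subset: "smooth_on D f \<Longrightarrow> E \<subseteq> D \<Longrightarrow> smooth_on E f"
  unfolding smooth_on_def using Ck_on_subset by blast

lemma smooth_on_local:
  assumes "\<And>x. x \<in> D \<Longrightarrow> \<exists>A. open A \<and> x \<in> A \<and> smooth_on A f"
  shows "smooth_on D f"
  unfolding smooth_on_def using assms Ck_on_local unfolding smooth_on_def by metis

lemma smooth_on_const: "smooth_on D (\<lambda>x. c)"
  by (simp add: smooth_on_def Ck_on_const)

lemma smooth_on_ident: "smooth_on D (\<lambda>x. x)"
  by (simp add: smooth_on_def Ck_on_ident)

lemma smooth_on_bounded_linear: "bounded_linear h \<Longrightarrow> smooth_on D h"
  by (simp add: smooth_on_def Ck_on_bounded_linear)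

lemma smooth_on_add: "smooth_on D f \<Longrightarrow> smooth_on D g \<Longrightarrow> open D \<Longrightarrow> smooth_on D (\<lambda>x. f x + g x)"
  by (simp add: smooth_on_def Ck_on_add)

lemma smooth_on_sum:
  "(\<And>i. i \<in> I \<Longrightarrow> smooth_on D (f i)) \<Longrightarrow> open D \<Longrightarrow> smooth_on D (\<lambda>x. \<Sum>i\<in>I. f i x)"
  by (simp add: smooth_on_def Ck_on_sum)

lemma (in bounded_bilinear) smooth_on:
  "smooth_on D f \<Longrightarrow> smooth_on D g \<Longrightarrow> open D \<Longrightarrow> smooth_on D (\<lambda>x. prod (f x) (g x))"
  by (simp add: smooth_on_def Ck_on)

lemmas smooth_on_inner = bounded_bilinear.smooth_on[OF bounded_bilinear_inner]
  and smooth_on_scaleR = bounded_bilinear.smooth_on[OF bounded_bilinear_scaleR]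

lemma smooth_on_diff:
  assumes "smooth_on D f" "smooth_on D g" "open D"
  shows "smooth_on D (\<lambda>x. f x - g x)"
proof -
  have "smooth_on D (\<lambda>x. f x + (- 1) *\<^sub>R g x)"
    by (intro smooth_on_add smooth_on_scaleR smooth_on_const assms)
  then show ?thesis by simp
qed

lemma smooth_on_compose:
  fixes f :: "'a::real_normed_vector \<Rightarrow> 'b::real_inner"
  assumes "fdim TYPE('b)" "smooth_on D f" "smooth_on E g" "open D" "f ` D \<subseteq> E"
  shows "smooth_on D (\<lambda>x. g (f x))"
  using assms Ck_on_compose unfolding smooth_on_def by blast

lemma smooth_on_linear_compose:
  fixes f :: "'a::real_normed_vector \<Rightarrow> 'b::real_inner"
  assumes "fdim TYPE('b)" "smooth_on D f" "linear h" "open D"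
  shows "smooth_on D (\<lambda>x. h (f x))"
  by (rule smooth_on_compose[OF assms(1,2) smooth_on_bounded_linear[of h UNIV] assms(4)])
    (use assms fdim_bounded_linear in auto)

lemma smooth_on_Pair:
  fixes f :: "'a::real_normed_vector \<Rightarrow> 'b::real_normed_vector" and g :: "'a \<Rightarrow> 'c::real_normed_vector"
  assumes "smooth_on D f" "smooth_on D g" "open D"
  shows "smooth_on D (\<lambda>x. (f x, g x))"
proof -
  have "Ck_on k D (\<lambda>x. (f x, g x))" if "Ck_on k D f" "Ck_on k D g" for k and f :: "'a \<Rightarrow> 'b" and g :: "'a \<Rightarrow> 'c"
    using that
  proof (induction k arbitrary: f g)
    case 0
    then show ?case by (simp add: continuous_on_Pair)
  next
    case (Suc k)
    have hd: "((\<lambda>x. (f x, g x)) has_derivative (\<lambda>v. (frd f x v, frd g x v))) (at x)" if "x \<in> D" for x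
      using Suc.prems that by (intro has_derivative_Pair) (auto simp: frechet_derivative_works[symmetric])
    have "Ck_on k D (\<lambda>x. (frd f x v, frd g x v))" for v using Suc by auto
    then have "Ck_on k D (\<lambda>x. frd (\<lambda>x. (f x, g x)) x v)" for v
      by (rule Ck_on_cong[OF assms(3), rotated]) (simp add: frd_eqI[OF hd])
    then show ?case using hd by (auto simp: differentiable_def)
  qed
  then show ?thesis using assms by (simp add: smooth_on_def)
qed

lemma smooth_on_differentiable: "smooth_on D f \<Longrightarrow> x \<in> D \<Longrightarrow> f differentiable (at x)"
  unfolding smooth_on_def by (metis Ck_on.simps(2))

lemma smooth_on_has_derivative: "smooth_on D f \<Longrightarrow> x \<in> D \<Longrightarrow> (f has_derivative frd f x) (at x)"
  using smooth_on_differentiable frechet_derivative_works by blast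

lemma smooth_on_linear_frd: "smooth_on D f \<Longrightarrow> x \<in> D \<Longrightarrow> linear (frd f x)"
  using smooth_on_differentiable linear_frechet_derivative by blast

lemma smooth_on_frd: "smooth_on D f \<Longrightarrow> smooth_on D (\<lambda>x. frd f x v)"
  unfolding smooth_on_def by (metis Ck_on.simps(2))

lemma smooth_on_continuous_on: "smooth_on D f \<Longrightarrow> continuous_on D f"
  unfolding smooth_on_def by (metis Ck_on.simps(1))

lemma smooth_on_open_preimage:
  assumes "smooth_on D f" "open D" "open A"
  shows "open {x \<in> D. f x \<in> A}"
  using continuous_open_preimage[OF smooth_on_continuous_on[OF assms(1)] assms(2,3)]
  by (simp add: vimage_def Int_def)

text \<open>Smoothness of \<open>a\<close> is known for each fixed vector only; by linearity in the
  vector the moving argument \<open>g x\<close> is reduced to the finitely many basis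
  vectors.\<close>

lemma smooth_on_pairing:
  fixes a :: "'a::real_normed_vector \<Rightarrow> 'c::real_inner \<Rightarrow> 'd::real_normed_vector"
  assumes "fdim TYPE('c)" "\<And>x. x \<in> D \<Longrightarrow> linear (a x)"
    "\<And>v. smooth_on D (\<lambda>x. a x v)" "smooth_on D g" "open D"
  shows "smooth_on D (\<lambda>x. a x (g x))"
proof -
  obtain B :: "'c set" where B: "finite B" "\<And>x. (\<Sum>b\<in>B. (x \<bullet> b) *\<^sub>R b) = x"
    using fdimE[OF assms(1)] by metis
  have "smooth_on D (\<lambda>x. \<Sum>b\<in>B. (g x \<bullet> b) *\<^sub>R a x b)"
    by (intro smooth_on_sum smooth_on_scaleR smooth_on_inner smooth_on_const assms)
  moreover have "(\<Sum>b\<in>B. (g x \<bullet> b) *\<^sub>R a x b) = a x (g x)" if "x \<in> D" for x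
    by (rule linear_expand[OF B assms(2)[OF that], symmetric])
  ultimately show ?thesis by (rule smooth_on_cong[OF assms(5), rotated])
qed

text \<open>Product rule for a family of linear maps applied to a moving vector. The basis expansion
  makes it a statement about finitely many ordinary products, so no norm on the space of linear maps
  is involved.\<close>

lemma has_derivative_pairing:
  fixes a :: "'a::real_normed_vector \<Rightarrow> 'c::real_inner \<Rightarrow> 'd::real_normed_vector"
  assumes fd: "fdim TYPE('c)" and D: "open D" "x \<in> D" and lin: "\<And>y. y \<in> D \<Longrightarrow> linear (a y)"
    and a: "\<And>v. (\<lambda>y. a y v) differentiable (at x)"
    and g: "(g has_derivative g') (at x)"
  shows "((\<lambda>y. a y (g y)) has_derivative (\<lambda>u. a x (g' u) + frd (\<lambda>y. a y (g x)) x u)) (at x)"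
proof -
  obtain B :: "'c set" where B: "finite B" "\<And>x. (\<Sum>b\<in>B. (x \<bullet> b) *\<^sub>R b) = x"
    using fdimE[OF fd] by metis
  have av: "((\<lambda>y. a y v) has_derivative frd (\<lambda>y. a y v) x) (at x)" for v
    using a frechet_derivative_works by blast
  have "((\<lambda>y. \<Sum>b\<in>B. (g y \<bullet> b) *\<^sub>R a y b) has_derivative
      (\<lambda>u. \<Sum>b\<in>B. (g x \<bullet> b) *\<^sub>R frd (\<lambda>y. a y b) x u + (g' u \<bullet> b) *\<^sub>R a x b)) (at x)"
    by (intro has_derivative_sum has_derivative_scaleR has_derivative_inner_left g av)
  moreover have "((\<lambda>y. \<Sum>b\<in>B. (g x \<bullet> b) *\<^sub>R a y b) has_derivative
      (\<lambda>u. \<Sum>b\<in>B. (g x \<bullet> b) *\<^sub>R frd (\<lambda>y. a y b) x u)) (at x)"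
    by (intro has_derivative_sum has_derivative_scaleR_right av)
  then have "((\<lambda>y. a y (g x)) has_derivative
      (\<lambda>u. \<Sum>b\<in>B. (g x \<bullet> b) *\<^sub>R frd (\<lambda>y. a y b) x u)) (at x)"
    by (rule has_derivative_transform_within_open[OF _ D]) (rule linear_expand[OF B lin, symmetric])
  then have "frd (\<lambda>y. a y (g x)) x = (\<lambda>u. \<Sum>b\<in>B. (g x \<bullet> b) *\<^sub>R frd (\<lambda>y. a y b) x u)"
    by (rule frd_eqI)
  ultimately have "((\<lambda>y. \<Sum>b\<in>B. (g y \<bullet> b) *\<^sub>R a y b) has_derivative
      (\<lambda>u. a x (g' u) + frd (\<lambda>y. a y (g x)) x u)) (at x)"
    unfolding sum.distrib linear_expand[OF B lin[OF D(2)], of "g' u" for u, symmetric]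
    by (simp add: add.commute)
  then show ?thesis
    by (rule has_derivative_transform_within_open[OF _ D]) (rule linear_expand[OF B lin, symmetric])
qed


subsection \<open>Symmetry of second derivatives\<close>

text \<open>The mean value theorem is applied along \<open>u\<close> to an increment along
  \<open>v\<close>, and then along \<open>v\<close> to the derivative in direction
  \<open>u\<close>.\<close>

lemma mixed_difference_mvt:
  fixes f :: "'a::real_normed_vector \<Rightarrow> real"
  assumes f: "smooth_on D f" and h: "0 < h"
    and D: "\<And>s t. 0 \<le> s \<Longrightarrow> s \<le> h \<Longrightarrow> 0 \<le> t \<Longrightarrow> t \<le> h \<Longrightarrow> x + s *\<^sub>R u + t *\<^sub>R v \<in> D"
  shows "\<exists>s t. 0 \<le> s \<and> s \<le> h \<and> 0 \<le> t \<and> t \<le> h \<and>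
    f (x + h *\<^sub>R u + h *\<^sub>R v) - f (x + h *\<^sub>R u) - f (x + h *\<^sub>R v) + f x =
    h * h * frd (\<lambda>y. frd f y u) (x + s *\<^sub>R u + t *\<^sub>R v) v"
proof -
  have line: "((\<lambda>s. g (c + s *\<^sub>R w)) has_real_derivative frd g (c + s *\<^sub>R w) w) (at s)"
    if "smooth_on D g" "c + s *\<^sub>R w \<in> D" for g :: "'a \<Rightarrow> real" and c w s
  proof -
    have "((\<lambda>s. c + s *\<^sub>R w) has_derivative (\<lambda>s. s *\<^sub>R w)) (at s)"
      by (auto intro!: derivative_eq_intros)
    from has_derivative_compose[OF this smooth_on_has_derivative[OF that]]
    have "((\<lambda>s. g (c + s *\<^sub>R w)) has_derivative (\<lambda>t. frd g (c + s *\<^sub>R w) (t *\<^sub>R w))) (at s)" .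
    moreover have "(\<lambda>t. frd g (c + s *\<^sub>R w) (t *\<^sub>R w)) = (*) (frd g (c + s *\<^sub>R w) w)"
      using linear_scale[OF smooth_on_linear_frd[OF that]] by auto
    ultimately show ?thesis by (simp add: has_field_derivative_def)
  qed
  \<comment> \<open>The second difference is the increment of this function between \<open>0\<close>
    and \<open>h\<close>.\<close>
  define \<phi> where "\<phi> s = f (x + h *\<^sub>R v + s *\<^sub>R u) - f (x + s *\<^sub>R u)" for s
  have "(\<phi> has_real_derivative (frd f (x + h *\<^sub>R v + s *\<^sub>R u) u - frd f (x + s *\<^sub>R u) u)) (at s)"
    if "0 \<le> s" "s \<le> h" for s
  proof -
    have "x + h *\<^sub>R v + s *\<^sub>R u \<in> D" "x + s *\<^sub>R u \<in> D"
      using D[of s h] D[of s 0] that h by (simp_all add: algebra_simps)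
    then show ?thesis unfolding \<phi>_def by (intro derivative_intros line f)
  qed
  from MVT2[OF h this] obtain s where s: "0 < s" "s < h"
    and 1: "\<phi> h - \<phi> 0 = h * (frd f (x + h *\<^sub>R v + s *\<^sub>R u) u - frd f (x + s *\<^sub>R u) u)" by auto
  have "((\<lambda>t. frd f (x + s *\<^sub>R u + t *\<^sub>R v) u) has_real_derivative
      frd (\<lambda>y. frd f y u) (x + s *\<^sub>R u + t *\<^sub>R v) v) (at t)" if "0 \<le> t" "t \<le> h" for t
    using that s D[of s t] by (intro line smooth_on_frd f) auto
  from MVT2[OF h this] obtain t where t: "0 < t" "t < h"
    and 2: "frd f (x + s *\<^sub>R u + h *\<^sub>R v) u - frd f (x + s *\<^sub>R u) u
      = h * frd (\<lambda>y. frd f y u) (x + s *\<^sub>R u + t *\<^sub>R v) v" by auto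
  have "\<phi> h - \<phi> 0 = h * h * frd (\<lambda>y. frd f y u) (x + s *\<^sub>R u + t *\<^sub>R v) v"
    using 1 2 by (simp add: algebra_simps)
  then show ?thesis using s t
    by (intro exI[of _ s] exI[of _ t]) (simp add: \<phi>_def algebra_simps)
qed

text \<open>The second difference is symmetric in \<open>u\<close> and \<open>v\<close>, and by the
  mean value lemma it equals \<open>h * h\<close> times either mixed derivative at a point near
  \<open>x\<close>. Continuity at \<open>x\<close> then excludes a gap between the two.\<close>

lemma second_derivative_symmetric_real:
  fixes f :: "'a::real_normed_vector \<Rightarrow> real"
  assumes f: "smooth_on D f" and D: "open D" and x: "x \<in> D"
  shows "frd (\<lambda>y. frd f y u) x v = frd (\<lambda>y. frd f y v) x u"
proof (rule ccontr)
  let ?F = "\<lambda>y. frd (\<lambda>y. frd f y u) y v" and ?G = "\<lambda>y. frd (\<lambda>y. frd f y v) y u"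
  assume neq: "?F x \<noteq> ?G x"
  \<comment> \<open>Half the gap: two numbers each closer than this to a common value cannot be that
    far apart.\<close>
  define e where "e = \<bar>?F x - ?G x\<bar> / 2"
  have e: "e > 0" using neq by (simp add: e_def)
  have "continuous_on D ?F" "continuous_on D ?G"
    by (rule smooth_on_continuous_on[OF smooth_on_frd[OF smooth_on_frd[OF f]]])+
  then have cont: "isCont ?F x" "isCont ?G x" using D x by (auto simp: continuous_on_eq_continuous_at)
  obtain d where d: "d > 0" "\<And>y. dist y x < d \<Longrightarrow> y \<in> D \<and> dist (?F y) (?F x) < e \<and> dist (?G y) (?G x) < e"
  proof -
    obtain d1 where "d1 > 0" "\<And>y. dist y x < d1 \<Longrightarrow> y \<in> D"
      using D x unfolding open_dist by blast
    moreover obtain d2 where "d2 > 0" "\<And>y. dist y x < d2 \<Longrightarrow> dist (?F y) (?F x) < e"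
      using cont(1) e unfolding continuous_at_eps_delta by blast
    moreover obtain d3 where "d3 > 0" "\<And>y. dist y x < d3 \<Longrightarrow> dist (?G y) (?G x) < e"
      using cont(2) e unfolding continuous_at_eps_delta by blast
    ultimately show ?thesis using that[of "min d1 (min d2 d3)"] by auto
  qed
  \<comment> \<open>The factor 2 leaves displacements at most \<open>d / 2\<close>, hence strictly
    below \<open>d\<close>; the summand 1 keeps the denominator positive when both directions
    vanish.\<close>
  define h where "h = d / (2 * (norm u + norm v + 1))"
  have pos: "norm u + norm v + 1 > 0" by (simp add: add_nonneg_pos)
  have h: "h > 0" using d pos by (simp add: h_def)
  have half: "d / (2 * N) * N = d / 2" if "N > 0" for N using that by simp
  have near: "dist (x + s *\<^sub>R u + t *\<^sub>R v) x < d" "dist (x + t *\<^sub>R v + s *\<^sub>R u) x < d"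
    if "0 \<le> s" "s \<le> h" "0 \<le> t" "t \<le> h" for s t
  proof -
    have "norm (s *\<^sub>R u + t *\<^sub>R v) \<le> s * norm u + t * norm v"
      using norm_triangle_ineq[of "s *\<^sub>R u" "t *\<^sub>R v"] that by simp
    also have "\<dots> \<le> h * norm u + h * norm v" using that by (intro add_mono mult_right_mono) auto
    also have "\<dots> \<le> h * (norm u + norm v + 1)" using h by (simp add: algebra_simps)
    also have "\<dots> = d / 2" unfolding h_def by (rule half[OF pos])
    also have "\<dots> < d" using d by simp
    finally have "norm (s *\<^sub>R u + t *\<^sub>R v) < d" .
    then show "dist (x + s *\<^sub>R u + t *\<^sub>R v) x < d" "dist (x + t *\<^sub>R v + s *\<^sub>R u) x < d"
      by (simp_all add: dist_norm algebra_simps)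
  qed
  obtain s t where st: "0 \<le> s" "s \<le> h" "0 \<le> t" "t \<le> h"
    "f (x + h *\<^sub>R u + h *\<^sub>R v) - f (x + h *\<^sub>R u) - f (x + h *\<^sub>R v) + f x = h * h * ?F (x + s *\<^sub>R u + t *\<^sub>R v)"
    using mixed_difference_mvt[OF f h, of x u v] near d(2) by blast
  obtain s' t' where st': "0 \<le> s'" "s' \<le> h" "0 \<le> t'" "t' \<le> h"
    "f (x + h *\<^sub>R v + h *\<^sub>R u) - f (x + h *\<^sub>R v) - f (x + h *\<^sub>R u) + f x = h * h * ?G (x + s' *\<^sub>R v + t' *\<^sub>R u)"
    using mixed_difference_mvt[OF f h, of x v u] near d(2) by blast
  have "h * h * ?F (x + s *\<^sub>R u + t *\<^sub>R v) = h * h * ?G (x + s' *\<^sub>R v + t' *\<^sub>R u)"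
    using st(5) st'(5) by (simp add: algebra_simps)
  then have "?F (x + s *\<^sub>R u + t *\<^sub>R v) = ?G (x + s' *\<^sub>R v + t' *\<^sub>R u)" using h by simp
  with d(2)[OF near(1)[OF st(1-4)]]
  have "dist c (?F x) < e" "dist c (?G x) < e" if "c = ?F (x + s *\<^sub>R u + t *\<^sub>R v)" for c
    using that d(2)[OF near(2)[OF st'(3,4,1,2)]] by simp_all
  then have "dist (?F x) (?G x) < e + e"
    using dist_triangle_less_add[of "?F x" "?F (x + s *\<^sub>R u + t *\<^sub>R v)" e "?G x" e]
    by (simp add: dist_commute)
  then show False by (simp add: e_def dist_real_def)
qed

text \<open>Reduced to the real-valued case by taking inner products with an arbitrary constant
  vector.\<close>

lemma second_derivative_symmetric:
  fixes f :: "'a::real_normed_vector \<Rightarrow> 'b::real_inner"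
  assumes f: "smooth_on D f" and D: "open D" and x: "x \<in> D"
  shows "frd (\<lambda>y. frd f y u) x v = frd (\<lambda>y. frd f y v) x u"
proof -
  have inner: "frd (\<lambda>y. g y \<bullet> c) z w = frd g z w \<bullet> c" if "smooth_on D g" "z \<in> D" for g :: "'a \<Rightarrow> 'b" and c z w
    using frd_eqI[OF has_derivative_inner_left[OF smooth_on_has_derivative[OF that], of c]] by simp
  have second: "frd (\<lambda>y. frd (\<lambda>y. f y \<bullet> c) y u) x v = frd (\<lambda>y. frd f y u) x v \<bullet> c" for c u v
  proof -
    have "frd (\<lambda>y. frd (\<lambda>y. f y \<bullet> c) y u) x = frd (\<lambda>y. frd f y u \<bullet> c) x"
      by (rule frd_cong[OF D x]) (simp add: inner[OF f])
    then show ?thesis by (simp add: inner[OF smooth_on_frd[OF f] x])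
  qed
  have "smooth_on D (\<lambda>y. f y \<bullet> c)" for c by (intro smooth_on_inner f smooth_on_const D)
  from second_derivative_symmetric_real[OF this D x]
  have "frd (\<lambda>y. frd f y u) x v \<bullet> c = frd (\<lambda>y. frd f y v) x u \<bullet> c" for c
    using second by metis
  then show ?thesis by (simp flip: vector_eq_rdot[where ?'a = 'b])
qed

text \<open>In coordinates, the exterior derivative commutes with pullback because the second derivative
  of the map cancels by symmetry.\<close>

lemma pullback_exterior_derivative_local:
  fixes f :: "'a::real_inner \<Rightarrow> 'b::real_inner" and \<alpha> :: "'b \<Rightarrow> 'b \<Rightarrow> real"
  assumes fd: "fdim TYPE('b)" and A: "open A" "x \<in> A" and f: "smooth_on A f" "f ` A \<subseteq> B"
    and \<alpha>: "\<And>y. y \<in> B \<Longrightarrow> linear (\<alpha> y)" "\<And>v. smooth_on B (\<lambda>y. \<alpha> y v)"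
  shows "frd (\<lambda>x. \<alpha> (f x) (frd f x v)) x u - frd (\<lambda>x. \<alpha> (f x) (frd f x u)) x v
    = frd (\<lambda>y. \<alpha> y (frd f x v)) (f x) (frd f x u) - frd (\<lambda>y. \<alpha> y (frd f x u)) (f x) (frd f x v)"
proof -
  have hd: "((\<lambda>x. \<alpha> (f x) w) has_derivative (\<lambda>u. frd (\<lambda>y. \<alpha> y w) (f x) (frd f x u))) (at x)" for w
  proof -
    have "f x \<in> B" using A(2) f(2) by blast
    from has_derivative_compose[OF smooth_on_has_derivative[OF f(1) A(2)] smooth_on_has_derivative[OF \<alpha>(2) this]]
    show ?thesis .
  qed
  have "frd (\<lambda>x. \<alpha> (f x) (frd f x v)) x u
    = \<alpha> (f x) (frd (\<lambda>x. frd f x v) x u) + frd (\<lambda>y. \<alpha> y (frd f x v)) (f x) (frd f x u)" for u v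
  proof -
    have "((\<lambda>x. \<alpha> (f x) (frd f x v)) has_derivative
      (\<lambda>u. \<alpha> (f x) (frd (\<lambda>x. frd f x v) x u) + frd (\<lambda>y. \<alpha> (f y) (frd f x v)) x u)) (at x)"
      using f(2) hd
      by (intro has_derivative_pairing[OF fd A] \<alpha>(1) smooth_on_has_derivative[OF smooth_on_frd[OF f(1)]] A)
        (auto simp: differentiable_def)
    from frd_eqI[OF this] show ?thesis by (simp add: frd_eqI[OF hd])
  qed
  then show ?thesis using second_derivative_symmetric[OF f(1) A, of u v] by simp
qed


section \<open>Manifolds in charts\<close>

text \<open>The part of \<^const>\<open>smooth_manifold\<close> that the calculus uses. Dropping the Hausdorff and
  countability axioms makes the predicate immediate for products, open subsets and cotangent bundles.\<close>

definition premanifold :: "('m, 'e::real_inner) mfd \<Rightarrow> bool" where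
  "premanifold M \<longleftrightarrow> fdim TYPE('e) \<and>
     (\<forall>p\<in>points M. p \<in> chart_dom M p \<and> chart_dom M p \<subseteq> points M \<and>
        inj_on (chart M p) (chart_dom M p) \<and> open (chart M p ` chart_dom M p)) \<and>
     (\<forall>p\<in>points M. \<forall>q\<in>points M.
        open (chart M p ` (chart_dom M p \<inter> chart_dom M q)) \<and>
        smooth_on (chart M p ` (chart_dom M p \<inter> chart_dom M q)) (chart M q \<circ> chart_inv M p))"

lemma smooth_manifold_premanifold: "smooth_manifold M \<Longrightarrow> premanifold M"
  by (simp add: smooth_manifold_def premanifold_def fdim_iff)

lemma premanifold_fdim: "premanifold (M :: ('m, 'e::real_inner) mfd) \<Longrightarrow> fdim TYPE('e)"
  by (simp add: premanifold_def)

lemma premanifold_chart: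
  assumes "premanifold M" "p \<in> points M"
  shows "p \<in> chart_dom M p" "chart_dom M p \<subseteq> points M" "inj_on (chart M p) (chart_dom M p)"
    "open (chart M p ` chart_dom M p)"
  using assms by (simp_all add: premanifold_def)

lemma premanifold_transition:
  assumes "premanifold M" "p \<in> points M" "q \<in> points M"
  shows "open (chart M p ` (chart_dom M p \<inter> chart_dom M q))"
    "smooth_on (chart M p ` (chart_dom M p \<inter> chart_dom M q)) (chart M q \<circ> chart_inv M p)"
  using assms by (simp_all add: premanifold_def)

lemma chart_inv_chart [simp]:
  assumes "premanifold M" "p \<in> points M" "y \<in> chart_dom M p"
  shows "chart_inv M p (chart M p y) = y"
  using premanifold_chart(3)[OF assms(1,2)] assms(3) by (simp add: chart_inv_def inv_into_f_f)

lemma mfd_open_subset: "mfd_open M X \<Longrightarrow> X \<subseteq> points M"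
  by (simp add: mfd_open_def)

lemma mfd_open_Int: "mfd_open M X \<Longrightarrow> mfd_open M Y \<Longrightarrow> mfd_open M (X \<inter> Y)"
  using openin_Int[of "mfd_top M" X Y] by (simp add: openin_mfd_top)

lemma mfd_open_subopen:
  "(\<And>x. x \<in> X \<Longrightarrow> \<exists>Y. mfd_open M Y \<and> x \<in> Y \<and> Y \<subseteq> X) \<Longrightarrow> mfd_open M X"
  using openin_subopen[of "mfd_top M" X] by (simp add: openin_mfd_top)

text \<open>Since chart images are open and charts injective, the open set required by
  \<open>mfd_open\<close> may be taken to be the chart image itself.\<close>

lemma mfd_open_iff:
  assumes "premanifold M"
  shows "mfd_open M X \<longleftrightarrow> X \<subseteq> points M \<and> (\<forall>p\<in>points M. open (chart M p ` (X \<inter> chart_dom M p)))"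
proof safe
  assume X: "mfd_open M X"
  then show "x \<in> points M" if "x \<in> X" for x using mfd_open_subset that by blast
  fix p assume p: "p \<in> points M"
  obtain A where A: "open A" "X \<inter> chart_dom M p = {y \<in> chart_dom M p. chart M p y \<in> A}"
    using X p unfolding mfd_open_def by blast
  have "chart M p ` (X \<inter> chart_dom M p) = A \<inter> chart M p ` chart_dom M p"
    using A(2) by auto
  then show "open (chart M p ` (X \<inter> chart_dom M p))"
    using A(1) premanifold_chart(4)[OF assms p] by (simp add: open_Int)
next
  assume X: "X \<subseteq> points M" "\<forall>p\<in>points M. open (chart M p ` (X \<inter> chart_dom M p))"
  have eq: "X \<inter> chart_dom M p = {y \<in> chart_dom M p. chart M p y \<in> chart M p ` (X \<inter> chart_dom M p)}"
    if "p \<in> points M" for p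
    using premanifold_chart(3)[OF assms that] by (auto simp: inj_on_def)
  show "mfd_open M X"
    unfolding mfd_open_def
  proof (intro conjI ballI)
    show "\<exists>A. open A \<and> X \<inter> chart_dom M p = {y \<in> chart_dom M p. chart M p y \<in> A}"
      if "p \<in> points M" for p
      using eq[OF that] X(2) that by (intro exI[of _ "chart M p ` (X \<inter> chart_dom M p)"]) simp
  qed (rule X(1))
qed

lemma mfd_open_chart_dom:
  assumes "premanifold M" "p \<in> points M"
  shows "mfd_open M (chart_dom M p)"
  unfolding mfd_open_iff[OF assms(1)]
  using premanifold_chart(2)[OF assms] premanifold_transition(1)[OF assms(1) _ assms(2)]
  by (simp add: Int_commute)

lemma mfd_open_points: "premanifold M \<Longrightarrow> mfd_open M (points M)"
  unfolding mfd_open_iff by (auto simp: premanifold_def Int_absorb1)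

lemma mfd_open_chart_image:
  assumes "premanifold M" "mfd_open M X" "p \<in> points M" "X \<subseteq> chart_dom M p"
  shows "open (chart M p ` X)"
  using assms(2-4) mfd_open_iff[OF assms(1), of X] by (auto simp: Int_absorb2)

text \<open>In any other chart the set is the preimage of \<open>A\<close> under the transition map,
  which is continuous on an open domain.\<close>

lemma mfd_open_chart_preimage:
  assumes M: "premanifold M" and p: "p \<in> points M" and A: "open A"
  shows "mfd_open M {y \<in> chart_dom M p. chart M p y \<in> A}"
  unfolding mfd_open_iff[OF M]
proof safe
  show "x \<in> points M" if "x \<in> chart_dom M p" for x using premanifold_chart(2)[OF M p] that by blast
  fix q assume q: "q \<in> points M"
  have "chart M q ` ({y \<in> chart_dom M p. chart M p y \<in> A} \<inter> chart_dom M q)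
    = {x \<in> chart M q ` (chart_dom M q \<inter> chart_dom M p). (chart M p \<circ> chart_inv M q) x \<in> A}"
    using chart_inv_chart[OF M q] by auto
  then show "open (chart M q ` ({y \<in> chart_dom M p. chart M p y \<in> A} \<inter> chart_dom M q))"
    using smooth_on_open_preimage[OF premanifold_transition(2,1)[OF M q p] A] by simp
qed


subsection \<open>Smooth maps\<close>

abbreviation rep :: "('m, 'e::real_inner) mfd \<Rightarrow> ('n, 'f::real_inner) mfd \<Rightarrow> ('m \<Rightarrow> 'n) \<Rightarrow> 'm \<Rightarrow> 'n \<Rightarrow> 'e \<Rightarrow> 'f" where
  "rep M N f p q \<equiv> chart N q \<circ> f \<circ> chart_inv M p"

lemma smooth_map_points: "smooth_map M N f \<Longrightarrow> p \<in> points M \<Longrightarrow> f p \<in> points N"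
  by (auto simp: smooth_map_def)

lemma smooth_map_atE:
  assumes "smooth_map M N f" "p \<in> points M"
  obtains X where "mfd_open M X" "p \<in> X" "X \<subseteq> chart_dom M p" "f ` X \<subseteq> chart_dom N (f p)"
    "smooth_on (chart M p ` X) (rep M N f p (f p))"
  using assms unfolding smooth_map_def openin_mfd_top by blast

lemma smooth_mapI:
  assumes "\<And>p. p \<in> points M \<Longrightarrow> f p \<in> points N"
    "\<And>p. p \<in> points M \<Longrightarrow> \<exists>X. mfd_open M X \<and> p \<in> X \<and> X \<subseteq> chart_dom M p \<and>
        f ` X \<subseteq> chart_dom N (f p) \<and> smooth_on (chart M p ` X) (rep M N f p (f p))"
  shows "smooth_map M N f"
  using assms unfolding smooth_map_def openin_mfd_top by auto

text \<open>Continuity of smooth maps: near each point the preimage is cut out by the local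
  representative and carried back through the chart.\<close>

lemma smooth_map_preimage:
  assumes M: "premanifold M" and N: "premanifold N" and f: "smooth_map M N f" and Y: "mfd_open N Y"
  shows "mfd_open M {x \<in> points M. f x \<in> Y}"
proof (rule mfd_open_subopen)
  fix y assume "y \<in> {x \<in> points M. f x \<in> Y}"
  then have y: "y \<in> points M" "f y \<in> Y" by auto
  then have fy: "f y \<in> points N" using Y mfd_open_subset by blast
  obtain X where X: "mfd_open M X" "y \<in> X" "X \<subseteq> chart_dom M y" "f ` X \<subseteq> chart_dom N (f y)"
    "smooth_on (chart M y ` X) (rep M N f y (f y))"
    using smooth_map_atE[OF f y(1)] .
  let ?B = "chart N (f y) ` (Y \<inter> chart_dom N (f y))"
  let ?A = "{x \<in> chart M y ` X. rep M N f y (f y) x \<in> ?B}"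
  have oX: "open (chart M y ` X)" using mfd_open_chart_image[OF M X(1) y(1) X(3)] .
  have oB: "open ?B" using Y fy mfd_open_iff[OF N] by blast
  have "open ?A" by (rule smooth_on_open_preimage[OF X(5) oX oB])
  then have "mfd_open M {z \<in> chart_dom M y. chart M y z \<in> ?A}" by (rule mfd_open_chart_preimage[OF M y(1)])
  \<comment> \<open>Injectivity of the two charts turns membership of coordinates back into
    membership of points.\<close>
  moreover have "{z \<in> chart_dom M y. chart M y z \<in> ?A} = {z \<in> X. f z \<in> Y}"
  proof (intro Set.set_eqI iffI)
    fix z assume "z \<in> {z \<in> chart_dom M y. chart M y z \<in> ?A}"
    then have z: "z \<in> chart_dom M y" "chart M y z \<in> chart M y ` X" "rep M N f y (f y) (chart M y z) \<in> ?B" by auto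
    have zX: "z \<in> X" using z(1,2) X(3) premanifold_chart(3)[OF M y(1)] by (auto simp: inj_on_def)
    have "chart N (f y) (f z) \<in> ?B" using z(3) chart_inv_chart[OF M y(1) z(1)] by simp
    moreover have "f z \<in> chart_dom N (f y)" using zX X(4) by blast
    ultimately have "f z \<in> Y" using premanifold_chart(3)[OF N fy] by (auto simp: inj_on_def)
    then show "z \<in> {z \<in> X. f z \<in> Y}" using zX by simp
  next
    fix z assume "z \<in> {z \<in> X. f z \<in> Y}"
    then have z: "z \<in> X" "f z \<in> Y" "z \<in> chart_dom M y" "f z \<in> chart_dom N (f y)" using X(3,4) by auto
    then show "z \<in> {z \<in> chart_dom M y. chart M y z \<in> ?A}"
      using chart_inv_chart[OF M y(1) z(3)] by auto
  qed
  ultimately show "\<exists>Z. mfd_open M Z \<and> y \<in> Z \<and> Z \<subseteq> {x \<in> points M. f x \<in> Y}"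
    using X(2) y(2) mfd_open_subset[OF X(1)] by (intro exI[of _ "{z \<in> X. f z \<in> Y}"]) auto
qed

abbreviation rep_dom :: "('m, 'e) mfd \<Rightarrow> ('n, 'f) mfd \<Rightarrow> ('m \<Rightarrow> 'n) \<Rightarrow> 'm \<Rightarrow> 'n \<Rightarrow> 'm set" where
  "rep_dom M N f p q \<equiv> {y \<in> chart_dom M p. f y \<in> chart_dom N q}"

lemma mfd_open_rep_dom:
  assumes "premanifold M" "premanifold N" "smooth_map M N f" "p \<in> points M" "q \<in> points N"
  shows "mfd_open M (rep_dom M N f p q)"
proof -
  have "rep_dom M N f p q = chart_dom M p \<inter> {y \<in> points M. f y \<in> chart_dom N q}"
    using premanifold_chart(2)[OF assms(1,4)] by blast
  then show ?thesis
    using mfd_open_Int[OF mfd_open_chart_dom[OF assms(1,4)]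
        smooth_map_preimage[OF assms(1-3) mfd_open_chart_dom[OF assms(2,5)]]] by simp
qed

lemma open_rep_dom:
  assumes "premanifold M" "premanifold N" "smooth_map M N f" "p \<in> points M" "q \<in> points N"
  shows "open (chart M p ` rep_dom M N f p q)"
  using mfd_open_chart_image[OF assms(1) mfd_open_rep_dom[OF assms] assms(4)] by blast

text \<open>\<open>smooth_map\<close> controls only the charts at \<open>p\<close> and
  \<open>f p\<close> on some neighbourhood of \<open>p\<close>. Composition with transition maps on
  both sides gives smoothness on the whole set where an arbitrary pair of charts is usable.\<close>

lemma smooth_on_rep:
  assumes M: "premanifold M" and N: "premanifold N" and f: "smooth_map M N f"
    and p: "p \<in> points M" and q: "q \<in> points N"
  shows "smooth_on (chart M p ` rep_dom M N f p q) (rep M N f p q)"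
proof (rule smooth_on_local)
  fix x assume "x \<in> chart M p ` rep_dom M N f p q"
  then obtain y where y: "y \<in> chart_dom M p" "f y \<in> chart_dom N q" "x = chart M p y" by auto
  have yM: "y \<in> points M" using y premanifold_chart(2)[OF M p] by blast
  have fyN: "f y \<in> points N" using f yM smooth_map_points by metis
  obtain X where X: "mfd_open M X" "y \<in> X" "X \<subseteq> chart_dom M y" "f ` X \<subseteq> chart_dom N (f y)"
    "smooth_on (chart M y ` X) (rep M N f y (f y))"
    using smooth_map_atE[OF f yM] .
  define Z where "Z = X \<inter> rep_dom M N f p q"
  have Z: "mfd_open M Z" unfolding Z_def by (rule mfd_open_Int[OF X(1) mfd_open_rep_dom[OF assms]])
  have oZ: "open (chart M p ` Z)"
    by (rule mfd_open_chart_image[OF M Z p]) (auto simp: Z_def)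
  have 1: "smooth_on (chart M p ` Z) (chart M y \<circ> chart_inv M p)"
    by (rule smooth_on_subset[OF premanifold_transition(2)[OF M p yM]]) (use X(3) in \<open>auto simp: Z_def\<close>)
  have 2: "smooth_on (chart M p ` Z) (\<lambda>x. rep M N f y (f y) ((chart M y \<circ> chart_inv M p) x))"
    by (rule smooth_on_compose[OF premanifold_fdim[OF M] 1 X(5) oZ])
      (auto simp: Z_def chart_inv_chart[OF M p])
  have Zy: "z \<in> chart_dom M y" "f z \<in> chart_dom N (f y)" if "z \<in> Z" for z using that X(3,4) by (auto simp: Z_def)
  have 3: "smooth_on (chart M p ` Z) (\<lambda>x. (chart N q \<circ> chart_inv N (f y)) (rep M N f y (f y) ((chart M y \<circ> chart_inv M p) x)))"
    by (rule smooth_on_compose[OF premanifold_fdim[OF N] 2 premanifold_transition(2)[OF N fyN q] oZ])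
      (use Zy in \<open>auto simp: Z_def chart_inv_chart[OF M p] chart_inv_chart[OF M yM]\<close>)
  have "smooth_on (chart M p ` Z) (rep M N f p q)"
  proof (rule smooth_on_cong[OF oZ _ 3])
    fix x assume "x \<in> chart M p ` Z"
    then obtain z where z: "z \<in> X" "z \<in> chart_dom M p" "f z \<in> chart_dom N q" "x = chart M p z" by (auto simp: Z_def)
    have "z \<in> chart_dom M y" "f z \<in> chart_dom N (f y)" using X z by auto
    then show "(chart N q \<circ> chart_inv N (f y)) (rep M N f y (f y) ((chart M y \<circ> chart_inv M p) x)) = rep M N f p q x"
      using z by (simp add: chart_inv_chart[OF M p] chart_inv_chart[OF M yM] chart_inv_chart[OF N fyN])
  qed
  then show "\<exists>A. open A \<and> x \<in> A \<and> smooth_on A (rep M N f p q)"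
    using oZ y X(2) by (intro exI[of _ "chart M p ` Z"]) (auto simp: Z_def)
qed

lemma smooth_map_compose:
  assumes M: "premanifold M" and N: "premanifold N" and K: "premanifold K"
    and f: "smooth_map M N f" and g: "smooth_map N K g"
  shows "smooth_map M K (\<lambda>x. g (f x))"
proof (rule smooth_mapI)
  fix p assume p: "p \<in> points M"
  have fp: "f p \<in> points N" using f p smooth_map_points by metis
  have gp: "g (f p) \<in> points K" using g fp smooth_map_points by metis
  then show "g (f p) \<in> points K" .
  define X where "X = rep_dom M N f p (f p) \<inter> {y \<in> points M. f y \<in> rep_dom N K g (f p) (g (f p))}"
  have X: "mfd_open M X"
    unfolding X_def
    by (intro mfd_open_Int mfd_open_rep_dom smooth_map_preimage[OF M N f] assms p fp gp)
  have oX: "open (chart M p ` X)" by (rule mfd_open_chart_image[OF M X p]) (auto simp: X_def)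
  have 1: "smooth_on (chart M p ` X) (rep M N f p (f p))"
    by (rule smooth_on_subset[OF smooth_on_rep[OF M N f p fp]]) (auto simp: X_def)
  have 2: "smooth_on (chart M p ` X) (\<lambda>x. rep N K g (f p) (g (f p)) (rep M N f p (f p) x))"
    by (rule smooth_on_compose[OF premanifold_fdim[OF N] 1 smooth_on_rep[OF N K g fp gp] oX])
      (auto simp: X_def chart_inv_chart[OF M p])
  have "smooth_on (chart M p ` X) (rep M K (\<lambda>x. g (f x)) p (g (f p)))"
    by (rule smooth_on_cong[OF oX _ 2])
      (auto simp: X_def chart_inv_chart[OF M p] chart_inv_chart[OF N fp])
  moreover have "p \<in> X"
    using p fp gp premanifold_chart(1)[OF M] premanifold_chart(1)[OF N] premanifold_chart(1)[OF K]
    by (simp add: X_def)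
  ultimately show "\<exists>X. mfd_open M X \<and> p \<in> X \<and> X \<subseteq> chart_dom M p \<and>
        (\<lambda>x. g (f x)) ` X \<subseteq> chart_dom K (g (f p)) \<and> smooth_on (chart M p ` X) (rep M K (\<lambda>x. g (f x)) p (g (f p)))"
    using X by (intro exI[of _ X]) (auto simp: X_def)
qed

lemma smooth_map_ident:
  assumes M: "premanifold M"
  shows "smooth_map M M (\<lambda>x. x)"
proof (rule smooth_mapI)
  fix p assume p: "p \<in> points M"
  have "smooth_on (chart M p ` chart_dom M p) (rep M M (\<lambda>x. x) p p)"
    by (rule smooth_on_cong[OF premanifold_chart(4)[OF M p] _ smooth_on_ident])
      (auto simp: chart_inv_chart[OF M p])
  then show "\<exists>X. mfd_open M X \<and> p \<in> X \<and> X \<subseteq> chart_dom M p \<and>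
        (\<lambda>x. x) ` X \<subseteq> chart_dom M p \<and> smooth_on (chart M p ` X) (rep M M (\<lambda>x. x) p p)"
    using mfd_open_chart_dom[OF M p] premanifold_chart(1)[OF M p] by blast
qed

lemma smooth_map_const:
  assumes M: "premanifold M" and N: "premanifold N" and c: "c \<in> points N"
  shows "smooth_map M N (\<lambda>x. c)"
proof (rule smooth_mapI)
  fix p assume p: "p \<in> points M"
  have "smooth_on (chart M p ` chart_dom M p) (rep M N (\<lambda>x. c) p c)"
    by (rule smooth_on_cong[OF premanifold_chart(4)[OF M p] _ smooth_on_const]) simp
  then show "\<exists>X. mfd_open M X \<and> p \<in> X \<and> X \<subseteq> chart_dom M p \<and>
        (\<lambda>x. c) ` X \<subseteq> chart_dom N c \<and> smooth_on (chart M p ` X) (rep M N (\<lambda>x. c) p c)"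
    using mfd_open_chart_dom[OF M p] premanifold_chart(1)[OF M p] premanifold_chart(1)[OF N c] by blast
qed (rule c)


subsection \<open>Tangent maps in arbitrary charts\<close>

text \<open>The tangent map at \<open>y\<close>, with source vectors written in the chart at
  \<open>p\<close> and target vectors in the chart at \<open>q\<close>. Both \<open>tmap\<close> and
  \<open>tcoord\<close> are special cases, so a single chain rule serves all of them.\<close>

definition trep :: "('m, 'e::real_inner) mfd \<Rightarrow> ('n, 'f::real_inner) mfd \<Rightarrow> ('m \<Rightarrow> 'n) \<Rightarrow>
    'm \<Rightarrow> 'n \<Rightarrow> 'm \<Rightarrow> 'e \<Rightarrow> 'f" where
  "trep M N f p q y = frd (rep M N f p q) (chart M p y)"

lemma tmap_trep: "tmap M N f p = trep M N f p (f p) p"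
  by (simp add: tmap_def trep_def)

lemma tcoord_trep: "tcoord M p y = trep M M (\<lambda>x. x) p y y"
  by (simp add: tcoord_def trep_def comp_def)

lemma trep_has_derivative:
  assumes "premanifold M" "premanifold N" "smooth_map M N f" "p \<in> points M" "q \<in> points N"
    "y \<in> chart_dom M p" "f y \<in> chart_dom N q"
  shows "(rep M N f p q has_derivative trep M N f p q y) (at (chart M p y))"
  unfolding trep_def
  by (rule smooth_on_has_derivative[OF smooth_on_rep[OF assms(1-5)]]) (use assms(6,7) in auto)

lemma trep_linear:
  assumes "premanifold M" "premanifold N" "smooth_map M N f" "p \<in> points M" "q \<in> points N"
    "y \<in> chart_dom M p" "f y \<in> chart_dom N q"
  shows "linear (trep M N f p q y)"
  using trep_has_derivative[OF assms] has_derivative_linear by blast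

lemma trep_cong:
  assumes M: "premanifold M" and p: "p \<in> points M" and X: "mfd_open M X" "y \<in> X" "y \<in> chart_dom M p"
    and eq: "\<And>x. x \<in> X \<Longrightarrow> f x = g x"
  shows "trep M N f p q y = trep M N g p q y"
  unfolding trep_def
proof (rule frd_cong)
  show "open (chart M p ` (X \<inter> chart_dom M p))" using X(1) p mfd_open_iff[OF M] by blast
  show "chart M p y \<in> chart M p ` (X \<inter> chart_dom M p)" using X by blast
  show "rep M N f p q x = rep M N g p q x" if "x \<in> chart M p ` (X \<inter> chart_dom M p)" for x
    using that eq by (auto simp: chart_inv_chart[OF M p])
qed

lemma trep_compose:
  assumes M: "premanifold M" and N: "premanifold N" and K: "premanifold K"
    and f: "smooth_map M N f" and g: "smooth_map N K g"
    and p: "p \<in> points M" and q: "q \<in> points N" and r: "r \<in> points K"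
    and y: "y \<in> chart_dom M p" "f y \<in> chart_dom N q" "g (f y) \<in> chart_dom K r"
  shows "trep M K (\<lambda>x. g (f x)) p r y v = trep N K g q r (f y) (trep M N f p q y v)"
proof -
  have e: "rep M N f p q (chart M p y) = chart N q (f y)" by (simp add: chart_inv_chart[OF M p y(1)])
  have "((\<lambda>x. rep N K g q r (rep M N f p q x)) has_derivative
      (\<lambda>v. trep N K g q r (f y) (trep M N f p q y v))) (at (chart M p y))"
    by (rule has_derivative_compose[OF trep_has_derivative[OF M N f p q y(1,2)]])
      (simp only: e, rule trep_has_derivative[OF N K g q r y(2,3)])
  then have "(rep M K (\<lambda>x. g (f x)) p r has_derivative
      (\<lambda>v. trep N K g q r (f y) (trep M N f p q y v))) (at (chart M p y))"
    by (rule has_derivative_transform_within_open[OF _ open_rep_dom[OF M N f p q]])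
      (use y in \<open>auto simp: chart_inv_chart[OF M p] chart_inv_chart[OF N q]\<close>)
  from frd_eqI[OF this] show ?thesis by (simp add: trep_def)
qed

lemma trep_ident:
  assumes M: "premanifold M" and p: "p \<in> points M" and y: "y \<in> chart_dom M p"
  shows "trep M M (\<lambda>x. x) p p y v = v"
proof -
  have "frd (rep M M (\<lambda>x. x) p p) (chart M p y) = frd (\<lambda>x. x) (chart M p y)"
    by (rule frd_cong[OF premanifold_chart(4)[OF M p]]) (use y in \<open>auto simp: chart_inv_chart[OF M p]\<close>)
  then show ?thesis by (simp add: trep_def)
qed

lemma tcoord_inverse:
  assumes M: "premanifold M" and p: "p \<in> points M" and y: "y \<in> chart_dom M p"
  shows "trep M M (\<lambda>x. x) y p y (tcoord M p y v) = v" "tcoord M p y (trep M M (\<lambda>x. x) y p y v) = v"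
proof -
  have yM: "y \<in> points M" using premanifold_chart(2)[OF M p] y by blast
  have yy: "y \<in> chart_dom M y" using premanifold_chart(1)[OF M yM] .
  show "trep M M (\<lambda>x. x) y p y (tcoord M p y v) = v"
    using trep_compose[OF M M M smooth_map_ident[OF M] smooth_map_ident[OF M] p yM p y yy y, of v]
    unfolding tcoord_trep by (simp add: trep_ident[OF M p y])
  show "tcoord M p y (trep M M (\<lambda>x. x) y p y v) = v"
    using trep_compose[OF M M M smooth_map_ident[OF M] smooth_map_ident[OF M] yM p yM yy y yy, of v]
    unfolding tcoord_trep by (simp add: trep_ident[OF M yM yy])
qed

text \<open>The chain rule for the two factorisations of \<open>f\<close> through an identity map,
  one at the source and one at the target. It allows pullbacks, defined with the moving charts of
  \<open>tmap\<close>, to be computed in one fixed pair of charts.\<close>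

lemma tcoord_trep_eq_tmap:
  assumes M: "premanifold M" and N: "premanifold N" and f: "smooth_map M N f"
    and p: "p \<in> points M" and q: "q \<in> points N"
    and y: "y \<in> chart_dom M p" "f y \<in> chart_dom N q"
  shows "tcoord N q (f y) (trep M N f p q y v) = tmap M N f y (tcoord M p y v)"
proof -
  have yM: "y \<in> points M" using premanifold_chart(2)[OF M p] y by blast
  have yy: "y \<in> chart_dom M y" using premanifold_chart(1)[OF M yM] .
  have fyN: "f y \<in> points N" using smooth_map_points[OF f yM] .
  have ff: "f y \<in> chart_dom N (f y)" using premanifold_chart(1)[OF N fyN] .
  show ?thesis
    using trep_compose[OF M N N f smooth_map_ident[OF N] p q fyN y ff, of v]
      trep_compose[OF M M N smooth_map_ident[OF M] f p yM fyN y(1) yy ff, of v]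
    by (simp add: tcoord_trep tmap_trep)
qed

lemma tcoord_linear:
  assumes "premanifold M" "p \<in> points M" "y \<in> chart_dom M p"
  shows "linear (tcoord M p y)"
proof -
  have y: "y \<in> points M" using premanifold_chart(2)[OF assms(1,2)] assms(3) by blast
  show ?thesis unfolding tcoord_trep
    by (rule trep_linear[OF assms(1,1) smooth_map_ident[OF assms(1)] assms(2) y assms(3) premanifold_chart(1)[OF assms(1) y]])
qed

lemma tmap_linear:
  assumes "premanifold M" "premanifold N" "smooth_map M N f" "p \<in> points M"
  shows "linear (tmap M N f p)"
  unfolding tmap_trep
  by (rule trep_linear[OF assms smooth_map_points[OF assms(3,4)] premanifold_chart(1)[OF assms(1,4)]
        premanifold_chart(1)[OF assms(2) smooth_map_points[OF assms(3,4)]]])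

lemma tmap_compose:
  assumes "premanifold M" "premanifold N" "premanifold K" "smooth_map M N f" "smooth_map N K g" "p \<in> points M"
  shows "tmap M K (\<lambda>x. g (f x)) p v = tmap N K g (f p) (tmap M N f p v)"
proof -
  have fp: "f p \<in> points N" using smooth_map_points[OF assms(4,6)] .
  have gp: "g (f p) \<in> points K" using smooth_map_points[OF assms(5) fp] .
  show ?thesis unfolding tmap_trep
    by (rule trep_compose[OF assms(1-6) fp gp]) (simp_all add: premanifold_chart(1) assms fp gp)
qed

lemma tmap_cong:
  assumes "premanifold M" "p \<in> points M" "mfd_open M X" "p \<in> X" "\<And>x. x \<in> X \<Longrightarrow> f x = g x"
  shows "tmap M N f p = tmap M N g p"
  unfolding tmap_trep assms(5)[OF assms(4)]
  by (rule trep_cong[OF assms(1-4) premanifold_chart(1)[OF assms(1,2)] assms(5)])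

lemma tmap_ident: "premanifold M \<Longrightarrow> p \<in> points M \<Longrightarrow> tmap M M (\<lambda>x. x) p v = v"
  by (simp add: tmap_trep trep_ident premanifold_chart(1))

lemma tmap_const: "tmap M N (\<lambda>x. c) p v = 0"
  by (simp add: tmap_def comp_def)


subsection \<open>Open submanifolds\<close>

lemma open_sub_simps [simp]:
  "points (open_sub M X) = X" "chart_dom (open_sub M X) p = chart_dom M p \<inter> X"
  "chart (open_sub M X) = chart M"
  by (simp_all add: open_sub_def)

text \<open>Restriction shrinks the domain of \<open>inv_into\<close>, so agreement of the inverses
  is asserted only on the image of the smaller domain; this is why every comparison with an open
  submanifold localises first.\<close>

lemma chart_inv_open_sub:
  assumes "premanifold M" "p \<in> points M" "x \<in> chart M p ` (chart_dom M p \<inter> X)"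
  shows "chart_inv (open_sub M X) p x = chart_inv M p x"
proof -
  obtain y where y: "y \<in> chart_dom M p" "y \<in> X" "x = chart M p y" using assms(3) by auto
  have "inj_on (chart M p) (chart_dom M p \<inter> X)"
    using premanifold_chart(3)[OF assms(1,2)] by (rule inj_on_subset) simp
  then have "chart_inv (open_sub M X) p x = y"
    unfolding chart_inv_def using y by (simp add: inv_into_f_f)
  then show ?thesis using y assms(1,2) by simp
qed

lemma premanifold_open_sub:
  assumes M: "premanifold M" and X: "mfd_open M X"
  shows "premanifold (open_sub M X)"
proof -
  have pM: "p \<in> points M" if "p \<in> X" for p using that X mfd_open_subset by blast
  have o: "open (chart M p ` (chart_dom M p \<inter> chart_dom M q \<inter> X))" if "p \<in> X" "q \<in> X" for p q
    by (rule mfd_open_chart_image[OF M mfd_open_Int[OF mfd_open_Int[OF mfd_open_chart_dom mfd_open_chart_dom] X]])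
      (use M that pM in auto)
  have s: "smooth_on (chart M p ` (chart_dom M p \<inter> chart_dom M q \<inter> X)) (chart M q \<circ> chart_inv (open_sub M X) p)"
    if "p \<in> X" "q \<in> X" for p q
  proof (rule smooth_on_cong[OF o[OF that]])
    show "smooth_on (chart M p ` (chart_dom M p \<inter> chart_dom M q \<inter> X)) (chart M q \<circ> chart_inv M p)"
      by (rule smooth_on_subset[OF premanifold_transition(2)[OF M pM pM]]) (use that in auto)
    show "(chart M q \<circ> chart_inv M p) x = (chart M q \<circ> chart_inv (open_sub M X) p) x"
      if "x \<in> chart M p ` (chart_dom M p \<inter> chart_dom M q \<inter> X)" for x
      using that chart_inv_open_sub[OF M pM[OF \<open>p \<in> X\<close>], of x X] by auto
  qed
  have i: "chart_dom M p \<inter> X \<inter> (chart_dom M q \<inter> X) = chart_dom M p \<inter> chart_dom M q \<inter> X" for p q by blast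
  show ?thesis
    unfolding premanifold_def open_sub_simps i
    using o s premanifold_fdim[OF M] premanifold_chart(1,2)[OF M pM]
      inj_on_subset[OF premanifold_chart(3)[OF M pM] Int_lower1] o[where p = p and q = p for p, unfolded Int_absorb]
    by (intro conjI ballI) auto
qed

lemma mfd_open_open_sub:
  assumes M: "premanifold M" and X: "mfd_open M X"
  shows "mfd_open (open_sub M X) Y \<longleftrightarrow> mfd_open M Y \<and> Y \<subseteq> X"
proof safe
  have XM: "X \<subseteq> points M" using X mfd_open_subset by blast
  assume Y: "mfd_open (open_sub M X) Y"
  then show YX: "y \<in> X" if "y \<in> Y" for y using mfd_open_subset that by fastforce
  show "mfd_open M Y"
  proof (rule mfd_open_subopen)
    fix y assume y: "y \<in> Y"
    then have yX: "y \<in> X" "y \<in> points M" using YX XM by auto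
    have "open (chart M y ` (Y \<inter> (chart_dom M y \<inter> X)))"
      using Y mfd_open_iff[OF premanifold_open_sub[OF M X]] yX(1) by auto
    from mfd_open_chart_preimage[OF M yX(2) this]
    have "mfd_open M {z \<in> chart_dom M y. chart M y z \<in> chart M y ` (Y \<inter> (chart_dom M y \<inter> X))}" .
    moreover have "{z \<in> chart_dom M y. chart M y z \<in> chart M y ` (Y \<inter> (chart_dom M y \<inter> X))} \<subseteq> Y"
      using premanifold_chart(3)[OF M yX(2)] by (auto simp: inj_on_def)
    moreover have "y \<in> {z \<in> chart_dom M y. chart M y z \<in> chart M y ` (Y \<inter> (chart_dom M y \<inter> X))}"
      using y yX premanifold_chart(1)[OF M yX(2)] by blast
    ultimately show "\<exists>Z. mfd_open M Z \<and> y \<in> Z \<and> Z \<subseteq> Y" by blast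
  qed
next
  assume Y: "mfd_open M Y" "Y \<subseteq> X"
  have "Y \<inter> (chart_dom M p \<inter> X) = Y \<inter> chart_dom M p" for p using Y(2) by blast
  then show "mfd_open (open_sub M X) Y"
    unfolding mfd_open_iff[OF premanifold_open_sub[OF M X]]
    using Y mfd_open_iff[OF M, of Y] mfd_open_subset[OF X] by auto
qed

lemma trep_open_sub:
  assumes M: "premanifold M" and X: "mfd_open M X" and p: "p \<in> X" and y: "y \<in> chart_dom M p" "y \<in> X"
  shows "trep (open_sub M X) N f p q y = trep M N f p q y"
  unfolding trep_def open_sub_simps
proof (rule frd_cong)
  have pM: "p \<in> points M" using p mfd_open_subset[OF X] by blast
  show "open (chart M p ` (chart_dom M p \<inter> X))"
    by (rule mfd_open_chart_image[OF M mfd_open_Int[OF mfd_open_chart_dom[OF M pM] X] pM]) simp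
  show "chart M p y \<in> chart M p ` (chart_dom M p \<inter> X)" using y by blast
  show "rep (open_sub M X) N f p q x = rep M N f p q x" if "x \<in> chart M p ` (chart_dom M p \<inter> X)" for x
    using chart_inv_open_sub[OF M pM that] by simp
qed

lemma trep_into_open_sub [simp]: "trep M (open_sub N Y) f = trep M N f"
  by (intro ext) (simp add: trep_def)

lemma tmap_into_open_sub [simp]: "tmap M (open_sub N Y) f = tmap M N f"
  by (intro ext) (simp add: tmap_def)

lemma tmap_open_sub:
  assumes "premanifold M" "mfd_open M X" "p \<in> X"
  shows "tmap (open_sub M X) N f p = tmap M N f p"
  unfolding tmap_trep
  by (rule trep_open_sub[OF assms(1-3) premanifold_chart(1)[OF assms(1)] assms(3)])
    (rule subsetD[OF mfd_open_subset[OF assms(2)] assms(3)])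

lemma tcoord_open_sub:
  assumes M: "premanifold M" and X: "mfd_open M X" and p: "p \<in> X" and y: "y \<in> chart_dom M p" "y \<in> X"
  shows "tcoord (open_sub M X) p y = tcoord M p y"
  using trep_open_sub[OF assms, of M "\<lambda>x. x" y] by (simp add: tcoord_trep)

lemma smooth_map_into_open_sub:
  assumes Y: "mfd_open N Y"
  shows "smooth_map M (open_sub N Y) f \<longleftrightarrow> smooth_map M N f \<and> f ` points M \<subseteq> Y"
proof safe
  have YN: "Y \<subseteq> points N" using mfd_open_subset[OF Y] .
  assume f: "smooth_map M (open_sub N Y) f"
  then show fY: "f x \<in> Y" if "x \<in> points M" for x using smooth_map_points[OF f that] by simp
  show "smooth_map M N f"
  proof (rule smooth_mapI)
    fix p assume p: "p \<in> points M"
    then show "f p \<in> points N" using fY YN by blast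
    show "\<exists>X. mfd_open M X \<and> p \<in> X \<and> X \<subseteq> chart_dom M p \<and>
        f ` X \<subseteq> chart_dom N (f p) \<and> smooth_on (chart M p ` X) (rep M N f p (f p))"
      using smooth_map_atE[OF f p] by (simp, metis)
  qed
next
  assume f: "smooth_map M N f" "f ` points M \<subseteq> Y"
  show "smooth_map M (open_sub N Y) f"
  proof (rule smooth_mapI)
    fix p assume p: "p \<in> points M"
    then show "f p \<in> points (open_sub N Y)" using f by auto
    obtain X where X: "mfd_open M X" "p \<in> X" "X \<subseteq> chart_dom M p" "f ` X \<subseteq> chart_dom N (f p)"
      "smooth_on (chart M p ` X) (rep M N f p (f p))"
      using smooth_map_atE[OF f(1) p] .
    moreover have "f ` X \<subseteq> Y" by (rule order_trans[OF image_mono[OF mfd_open_subset[OF X(1)]] f(2)])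
    ultimately show "\<exists>X. mfd_open M X \<and> p \<in> X \<and> X \<subseteq> chart_dom M p \<and>
        f ` X \<subseteq> chart_dom (open_sub N Y) (f p) \<and> smooth_on (chart M p ` X) (rep M (open_sub N Y) f p (f p))"
      by (intro exI[of _ X]) simp
  qed
qed

lemma smooth_map_open_sub:
  assumes M: "premanifold M" and X: "mfd_open M X" and f: "smooth_map M N f"
  shows "smooth_map (open_sub M X) N f"
proof (rule smooth_mapI)
  fix p assume "p \<in> points (open_sub M X)"
  then have p: "p \<in> X" "p \<in> points M" using mfd_open_subset[OF X] by auto
  show "f p \<in> points N" using smooth_map_points[OF f p(2)] .
  obtain Z where Z: "mfd_open M Z" "p \<in> Z" "Z \<subseteq> chart_dom M p" "f ` Z \<subseteq> chart_dom N (f p)"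
    "smooth_on (chart M p ` Z) (rep M N f p (f p))"
    using smooth_map_atE[OF f p(2)] .
  have ZX: "mfd_open M (Z \<inter> X)" using mfd_open_Int[OF Z(1) X] .
  have o: "open (chart M p ` (Z \<inter> X))"
    by (rule mfd_open_chart_image[OF M ZX p(2)]) (use Z in blast)
  have "smooth_on (chart M p ` (Z \<inter> X)) (rep (open_sub M X) N f p (f p))"
  proof (rule smooth_on_cong[OF o])
    show "smooth_on (chart M p ` (Z \<inter> X)) (rep M N f p (f p))"
      by (rule smooth_on_subset[OF Z(5)]) blast
    show "rep M N f p (f p) x = rep (open_sub M X) N f p (f p) x" if "x \<in> chart M p ` (Z \<inter> X)" for x
    proof -
      have "x \<in> chart M p ` (chart_dom M p \<inter> X)" using that Z(3) by blast
      then show ?thesis using chart_inv_open_sub[OF M p(2)] by simp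
    qed
  qed
  then show "\<exists>Z. mfd_open (open_sub M X) Z \<and> p \<in> Z \<and> Z \<subseteq> chart_dom (open_sub M X) p \<and>
        f ` Z \<subseteq> chart_dom N (f p) \<and> smooth_on (chart (open_sub M X) p ` Z) (rep (open_sub M X) N f p (f p))"
    using Z ZX p by (intro exI[of _ "Z \<inter> X"]) (auto simp: mfd_open_open_sub[OF M X])
qed

text \<open>For maps defined by descent, which near each point coincide with a composite through a
  local section but have no global formula of that kind.\<close>

lemma smooth_map_local:
  assumes M: "premanifold M"
    and loc: "\<And>p. p \<in> points M \<Longrightarrow> \<exists>X g. mfd_open M X \<and> p \<in> X \<and> smooth_map (open_sub M X) N g \<and> (\<forall>x\<in>X. f x = g x)"
  shows "smooth_map M N f"
proof (rule smooth_mapI)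
  fix p assume p: "p \<in> points M"
  obtain X g where X: "mfd_open M X" "p \<in> X" "smooth_map (open_sub M X) N g" "\<forall>x\<in>X. f x = g x"
    using loc[OF p] by blast
  have pX: "p \<in> points (open_sub M X)" using X by simp
  show "f p \<in> points N" using smooth_map_points[OF X(3) pX] X(2,4) by simp
  obtain Z where Z: "mfd_open (open_sub M X) Z" "p \<in> Z" "Z \<subseteq> chart_dom (open_sub M X) p"
    "g ` Z \<subseteq> chart_dom N (g p)" "smooth_on (chart (open_sub M X) p ` Z) (rep (open_sub M X) N g p (g p))"
    using smooth_map_atE[OF X(3) pX] .
  have Z1: "mfd_open M Z" "Z \<subseteq> X" using Z(1) mfd_open_open_sub[OF M X(1)] by auto
  have o: "open (chart M p ` Z)" by (rule mfd_open_chart_image[OF M Z1(1) p]) (use Z in auto)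
  have "smooth_on (chart M p ` Z) (rep M N f p (f p))"
  proof (rule smooth_on_cong[OF o])
    show "smooth_on (chart M p ` Z) (rep (open_sub M X) N g p (g p))" using Z(5) by simp
    show "rep (open_sub M X) N g p (g p) x = rep M N f p (f p) x" if "x \<in> chart M p ` Z" for x
    proof -
      obtain z where z: "z \<in> Z" "x = chart M p z" using \<open>x \<in> chart M p ` Z\<close> by blast
      have "z \<in> chart_dom M p" "z \<in> X" using Z(3) z(1) by auto
      moreover have "x \<in> chart M p ` (chart_dom M p \<inter> X)" using Z(3) z by auto
      ultimately show ?thesis
        using chart_inv_open_sub[OF M p, of x X] z X(2,4) by (simp add: chart_inv_chart[OF M p])
    qed
  qed
  moreover have "f ` Z \<subseteq> chart_dom N (f p)" using Z(2,4) Z1(2) X(4) by (auto simp: image_subset_iff subset_iff)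
  ultimately show "\<exists>X. mfd_open M X \<and> p \<in> X \<and> X \<subseteq> chart_dom M p \<and>
        f ` X \<subseteq> chart_dom N (f p) \<and> smooth_on (chart M p ` X) (rep M N f p (f p))"
    using Z Z1(1) by (intro exI[of _ Z]) auto
qed

lemma smooth_map_cong:
  assumes "premanifold M" "smooth_map M N f" "\<And>x. x \<in> points M \<Longrightarrow> f x = g x"
  shows "smooth_map M N g"
  by (rule smooth_map_local[OF assms(1)])
    (metis assms mfd_open_points smooth_map_open_sub)


subsection \<open>Products\<close>

lemma prod_mfd_simps [simp]:
  "points (prod_mfd M N) = points M \<times> points N"
  "chart_dom (prod_mfd M N) (p, q) = chart_dom M p \<times> chart_dom N q"
  "chart (prod_mfd M N) (p, q) (x, y) = (chart M p x, chart N q y)"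
  by (simp_all add: prod_mfd_def)

lemma chart_prod_image: "chart (prod_mfd M N) (p, q) ` (X \<times> Y) = (chart M p ` X) \<times> (chart N q ` Y)"
  by (force simp: image_iff)

lemma chart_prod_inj:
  assumes M: "premanifold M" and N: "premanifold N" and p: "p \<in> points M" "q \<in> points N"
  shows "inj_on (chart (prod_mfd M N) (p, q)) (chart_dom M p \<times> chart_dom N q)"
  using premanifold_chart(3)[OF M p(1)] premanifold_chart(3)[OF N p(2)] by (auto simp: inj_on_def)

lemma chart_inv_prod:
  assumes M: "premanifold M" and N: "premanifold N" and p: "p \<in> points M" "q \<in> points N"
    and x: "x \<in> chart M p ` chart_dom M p" "y \<in> chart N q ` chart_dom N q"
  shows "chart_inv (prod_mfd M N) (p, q) (x, y) = (chart_inv M p x, chart_inv N q y)"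
proof -
  obtain a b where a: "a \<in> chart_dom M p" "x = chart M p a" and b: "b \<in> chart_dom N q" "y = chart N q b"
    using x by blast
  have "chart_inv (prod_mfd M N) (p, q) (chart (prod_mfd M N) (p, q) (a, b)) = (a, b)"
    unfolding chart_inv_def by (rule inv_into_f_f) (use chart_prod_inj[OF M N p] a b in auto)
  then show ?thesis using a b M N p by simp
qed

lemma premanifold_prod:
  assumes M: "premanifold M" and N: "premanifold N"
  shows "premanifold (prod_mfd M N)"
proof -
  have s: "smooth_on (chart (prod_mfd M N) (p, q) ` ((chart_dom M p \<inter> chart_dom M p') \<times> (chart_dom N q \<inter> chart_dom N q')))
      (chart (prod_mfd M N) (p', q') \<circ> chart_inv (prod_mfd M N) (p, q))" (is "smooth_on ?D _")
    and o: "open (chart (prod_mfd M N) (p, q) ` ((chart_dom M p \<inter> chart_dom M p') \<times> (chart_dom N q \<inter> chart_dom N q')))"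
    if p: "p \<in> points M" "q \<in> points N" "p' \<in> points M" "q' \<in> points N" for p q p' q'
  proof -
    show o: "open ?D"
      unfolding chart_prod_image
      by (intro open_Times premanifold_transition(1)[OF M p(1,3)] premanifold_transition(1)[OF N p(2,4)])
    have "smooth_on ?D (\<lambda>x. ((chart M p' \<circ> chart_inv M p) (fst x), (chart N q' \<circ> chart_inv N q) (snd x)))"
      by (intro smooth_on_Pair o
          smooth_on_compose[OF premanifold_fdim[OF M] smooth_on_bounded_linear[OF bounded_linear_fst] premanifold_transition(2)[OF M p(1,3)] o]
          smooth_on_compose[OF premanifold_fdim[OF N] smooth_on_bounded_linear[OF bounded_linear_snd] premanifold_transition(2)[OF N p(2,4)] o])
        (auto simp: chart_prod_image)
    then show "smooth_on ?D (chart (prod_mfd M N) (p', q') \<circ> chart_inv (prod_mfd M N) (p, q))"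
    proof (rule smooth_on_cong[OF o, rotated])
      fix x assume "x \<in> ?D"
      then obtain a b where "x = (a, b)" "a \<in> chart M p ` chart_dom M p" "b \<in> chart N q ` chart_dom N q"
        unfolding chart_prod_image by blast
      then show "((chart M p' \<circ> chart_inv M p) (fst x), (chart N q' \<circ> chart_inv N q) (snd x))
          = (chart (prod_mfd M N) (p', q') \<circ> chart_inv (prod_mfd M N) (p, q)) x"
        using chart_inv_prod[OF M N p(1,2)] by simp
    qed
  qed
  have o1: "open (chart (prod_mfd M N) (p, q) ` (chart_dom M p \<times> chart_dom N q))"
    if "p \<in> points M" "q \<in> points N" for p q
    unfolding chart_prod_image
    by (intro open_Times premanifold_chart(4)[OF M that(1)] premanifold_chart(4)[OF N that(2)])
  show ?thesis
    unfolding premanifold_def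
    using fdim_prod[OF premanifold_fdim[OF M] premanifold_fdim[OF N]] s o o1 chart_prod_inj[OF M N]
      premanifold_chart(1)[OF M] premanifold_chart(1)[OF N]
      premanifold_chart(2)[OF M, THEN subsetD] premanifold_chart(2)[OF N, THEN subsetD]
    by (auto simp: Times_Int_Times)
qed

text \<open>In product charts the representative is the linear projection, which is its own
  derivative.\<close>

lemma smooth_map_fst:
  assumes M: "premanifold M" and N: "premanifold N"
  shows "smooth_map (prod_mfd M N) M fst"
    and "\<And>p q x y. p \<in> points M \<Longrightarrow> q \<in> points N \<Longrightarrow> x \<in> chart_dom M p \<Longrightarrow> y \<in> chart_dom N q \<Longrightarrow>
      trep (prod_mfd M N) M fst (p, q) p (x, y) v = fst v"
proof -
  have o: "open (chart (prod_mfd M N) (p, q) ` (chart_dom M p \<times> chart_dom N q))"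
    and e: "\<And>x. x \<in> chart (prod_mfd M N) (p, q) ` (chart_dom M p \<times> chart_dom N q) \<Longrightarrow>
      fst x = rep (prod_mfd M N) M fst (p, q) p x"
    if p: "p \<in> points M" "q \<in> points N" for p q
    using premanifold_chart(4)[OF M p(1)] premanifold_chart(4)[OF N p(2)]
      chart_inv_prod[OF M N p] chart_inv_chart[OF M p(1)]
    by (auto simp: chart_prod_image open_Times)
  show "smooth_map (prod_mfd M N) M fst"
  proof (rule smooth_mapI)
    fix z assume "z \<in> points (prod_mfd M N)"
    then obtain p q where z: "z = (p, q)" and p: "p \<in> points M" "q \<in> points N" by auto
    show "fst z \<in> points M" using z p by simp
    have "smooth_on (chart (prod_mfd M N) z ` chart_dom (prod_mfd M N) z) (rep (prod_mfd M N) M fst z (fst z))"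
      unfolding z prod_mfd_simps fst_conv
      by (rule smooth_on_cong[OF o[OF p] e[OF p] smooth_on_bounded_linear[OF bounded_linear_fst]])
    then show "\<exists>X. mfd_open (prod_mfd M N) X \<and> z \<in> X \<and> X \<subseteq> chart_dom (prod_mfd M N) z \<and>
        fst ` X \<subseteq> chart_dom M (fst z) \<and> smooth_on (chart (prod_mfd M N) z ` X) (rep (prod_mfd M N) M fst z (fst z))"
      using mfd_open_chart_dom[OF premanifold_prod[OF M N], of z]
        premanifold_chart(1)[OF premanifold_prod[OF M N], of z] z p
      by (intro exI[of _ "chart_dom (prod_mfd M N) z"]) auto
  qed
  show "trep (prod_mfd M N) M fst (p, q) p (x, y) v = fst v"
    if p: "p \<in> points M" "q \<in> points N" and x: "x \<in> chart_dom M p" "y \<in> chart_dom N q" for p q x y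
  proof -
    have "trep (prod_mfd M N) M fst (p, q) p (x, y) = frd fst (chart (prod_mfd M N) (p, q) (x, y))"
      unfolding trep_def
      by (rule frd_cong[OF o[OF p]]) (use x e[OF p] in \<open>auto simp: chart_prod_image\<close>)
    then show ?thesis using frd_eqI[OF bounded_linear_imp_has_derivative[OF bounded_linear_fst]] by metis
  qed
qed

lemma smooth_map_snd:
  assumes M: "premanifold M" and N: "premanifold N"
  shows "smooth_map (prod_mfd M N) N snd"
    and "\<And>p q x y. p \<in> points M \<Longrightarrow> q \<in> points N \<Longrightarrow> x \<in> chart_dom M p \<Longrightarrow> y \<in> chart_dom N q \<Longrightarrow>
      trep (prod_mfd M N) N snd (p, q) q (x, y) v = snd v"
proof -
  have o: "open (chart (prod_mfd M N) (p, q) ` (chart_dom M p \<times> chart_dom N q))"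
    and e: "\<And>x. x \<in> chart (prod_mfd M N) (p, q) ` (chart_dom M p \<times> chart_dom N q) \<Longrightarrow>
      snd x = rep (prod_mfd M N) N snd (p, q) q x"
    if p: "p \<in> points M" "q \<in> points N" for p q
    using premanifold_chart(4)[OF M p(1)] premanifold_chart(4)[OF N p(2)]
      chart_inv_prod[OF M N p] chart_inv_chart[OF N p(2)]
    by (auto simp: chart_prod_image open_Times)
  show "smooth_map (prod_mfd M N) N snd"
  proof (rule smooth_mapI)
    fix z assume "z \<in> points (prod_mfd M N)"
    then obtain p q where z: "z = (p, q)" and p: "p \<in> points M" "q \<in> points N" by auto
    show "snd z \<in> points N" using z p by simp
    have "smooth_on (chart (prod_mfd M N) z ` chart_dom (prod_mfd M N) z) (rep (prod_mfd M N) N snd z (snd z))"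
      unfolding z prod_mfd_simps snd_conv
      by (rule smooth_on_cong[OF o[OF p] e[OF p] smooth_on_bounded_linear[OF bounded_linear_snd]])
    then show "\<exists>X. mfd_open (prod_mfd M N) X \<and> z \<in> X \<and> X \<subseteq> chart_dom (prod_mfd M N) z \<and>
        snd ` X \<subseteq> chart_dom N (snd z) \<and> smooth_on (chart (prod_mfd M N) z ` X) (rep (prod_mfd M N) N snd z (snd z))"
      using mfd_open_chart_dom[OF premanifold_prod[OF M N], of z]
        premanifold_chart(1)[OF premanifold_prod[OF M N], of z] z p
      by (intro exI[of _ "chart_dom (prod_mfd M N) z"]) auto
  qed
  show "trep (prod_mfd M N) N snd (p, q) q (x, y) v = snd v"
    if p: "p \<in> points M" "q \<in> points N" and x: "x \<in> chart_dom M p" "y \<in> chart_dom N q" for p q x y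
  proof -
    have "trep (prod_mfd M N) N snd (p, q) q (x, y) = frd snd (chart (prod_mfd M N) (p, q) (x, y))"
      unfolding trep_def
      by (rule frd_cong[OF o[OF p]]) (use x e[OF p] in \<open>auto simp: chart_prod_image\<close>)
    then show ?thesis using frd_eqI[OF bounded_linear_imp_has_derivative[OF bounded_linear_snd]] by metis
  qed
qed

lemma tmap_fst:
  assumes "premanifold M" "premanifold N" "z \<in> points M \<times> points N"
  shows "tmap (prod_mfd M N) M fst z v = fst v"
proof -
  obtain p q where z: "z = (p, q)" "p \<in> points M" "q \<in> points N" using assms(3) by blast
  show ?thesis
    using smooth_map_fst(2)[OF assms(1,2) z(2,3) premanifold_chart(1)[OF assms(1) z(2)] premanifold_chart(1)[OF assms(2) z(3)], of v]
    by (simp add: tmap_trep z(1))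
qed

lemma tmap_snd:
  assumes "premanifold M" "premanifold N" "z \<in> points M \<times> points N"
  shows "tmap (prod_mfd M N) N snd z v = snd v"
proof -
  obtain p q where z: "z = (p, q)" "p \<in> points M" "q \<in> points N" using assms(3) by blast
  show ?thesis
    using smooth_map_snd(2)[OF assms(1,2) z(2,3) premanifold_chart(1)[OF assms(1) z(2)] premanifold_chart(1)[OF assms(2) z(3)], of v]
    by (simp add: tmap_trep z(1))
qed

lemma smooth_map_Pair:
  assumes K: "premanifold K" and M: "premanifold M" and N: "premanifold N"
    and f: "smooth_map K M f" and g: "smooth_map K N g"
  shows "smooth_map K (prod_mfd M N) (\<lambda>z. (f z, g z))"
proof (rule smooth_mapI)
  fix p assume p: "p \<in> points K"
  have fp: "f p \<in> points M" and gp: "g p \<in> points N" using smooth_map_points f g p by metis+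
  show "(f p, g p) \<in> points (prod_mfd M N)" using fp gp by simp
  let ?X = "rep_dom K M f p (f p) \<inter> rep_dom K N g p (g p)"
  have X: "mfd_open K ?X" by (intro mfd_open_Int mfd_open_rep_dom assms p fp gp)
  have o: "open (chart K p ` ?X)" by (rule mfd_open_chart_image[OF K X p]) blast
  have "smooth_on (chart K p ` ?X) (\<lambda>x. (rep K M f p (f p) x, rep K N g p (g p) x))"
    by (rule smooth_on_Pair[OF smooth_on_subset[OF smooth_on_rep[OF K M f p fp]] smooth_on_subset[OF smooth_on_rep[OF K N g p gp]] o]) auto
  then have "smooth_on (chart K p ` ?X) (rep K (prod_mfd M N) (\<lambda>z. (f z, g z)) p (f p, g p))"
    by (rule smooth_on_cong[OF o, rotated]) simp
  then show "\<exists>X. mfd_open K X \<and> p \<in> X \<and> X \<subseteq> chart_dom K p \<and> (\<lambda>z. (f z, g z)) ` X \<subseteq> chart_dom (prod_mfd M N) (f p, g p) \<and>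
      smooth_on (chart K p ` X) (rep K (prod_mfd M N) (\<lambda>z. (f z, g z)) p (f p, g p))"
    using X p fp gp premanifold_chart(1)[OF K] premanifold_chart(1)[OF M] premanifold_chart(1)[OF N]
    by (intro exI[of _ ?X]) auto
qed

text \<open>Both components are recovered by composing with the factor projections, whose tangent
  maps are the linear projections.\<close>

lemma tmap_Pair:
  assumes K: "premanifold K" and M: "premanifold M" and N: "premanifold N"
    and f: "smooth_map K M f" and g: "smooth_map K N g" and p: "p \<in> points K"
  shows "tmap K (prod_mfd M N) (\<lambda>z. (f z, g z)) p v = (tmap K M f p v, tmap K N g p v)"
proof -
  have z: "(f p, g p) \<in> points M \<times> points N" using smooth_map_points f g p by (metis SigmaI)
  note s = smooth_map_Pair[OF K M N f g]
  have "tmap K M f p v = fst (tmap K (prod_mfd M N) (\<lambda>z. (f z, g z)) p v)"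
    using tmap_compose[OF K premanifold_prod[OF M N] M s smooth_map_fst(1)[OF M N] p, of v] tmap_fst[OF M N z]
    by simp
  moreover have "tmap K N g p v = snd (tmap K (prod_mfd M N) (\<lambda>z. (f z, g z)) p v)"
    using tmap_compose[OF K premanifold_prod[OF M N] N s smooth_map_snd(1)[OF M N] p, of v] tmap_snd[OF M N z]
    by simp
  ultimately show ?thesis by simp
qed

lemma tcoord_prod:
  assumes M: "premanifold M" and N: "premanifold N" and p: "p \<in> points M" "q \<in> points N"
    and x: "x \<in> chart_dom M p" "y \<in> chart_dom N q"
  shows "tcoord (prod_mfd M N) (p, q) (x, y) v = (tcoord M p x (fst v), tcoord N q y (snd v))"
proof -
  note K = premanifold_prod[OF M N]
  have xy: "x \<in> points M" "y \<in> points N" using premanifold_chart(2)[OF M p(1)] premanifold_chart(2)[OF N p(2)] x by auto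
  have z: "(p, q) \<in> points (prod_mfd M N)" "(x, y) \<in> chart_dom (prod_mfd M N) (p, q)"
    "(x, y) \<in> points M \<times> points N" using p x xy by auto
  have "tcoord M p x (fst v) = fst (tcoord (prod_mfd M N) (p, q) (x, y) v)"
    using tcoord_trep_eq_tmap[OF K M smooth_map_fst(1)[OF M N] z(1) p(1) z(2), of v]
    by (simp add: x smooth_map_fst(2)[OF M N p x] tmap_fst[OF M N z(3)])
  moreover have "tcoord N q y (snd v) = snd (tcoord (prod_mfd M N) (p, q) (x, y) v)"
    using tcoord_trep_eq_tmap[OF K N smooth_map_snd(1)[OF M N] z(1) p(2) z(2), of v]
    by (simp add: x smooth_map_snd(2)[OF M N p x] tmap_snd[OF M N z(3)])
  ultimately show ?thesis by simp
qed

lemma vec_mfd_simps [simp]: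
  "points vec_mfd = UNIV" "chart_dom vec_mfd p = UNIV" "chart vec_mfd p x = x"
  by (simp_all add: vec_mfd_def)

lemma chart_inv_vec_mfd [simp]: "chart_inv vec_mfd p = (\<lambda>x. x)"
  unfolding chart_inv_def by (rule ext) (simp add: vec_mfd_def inv_into_f_f)

lemma premanifold_vec: "fdim TYPE('v::real_inner) \<Longrightarrow> premanifold (vec_mfd :: ('v, 'v) mfd)"
  by (auto simp: premanifold_def comp_def smooth_on_ident inj_on_def image_iff)

lemma fdim_real: "fdim TYPE(real)"
  unfolding fdim_iff
proof (intro exI conjI)
  have "x \<in> span {1}" for x :: real
    using span_scale[OF span_base, of 1 "{1 :: real}" x] by (simp only: real_scaleR_def mult_1_right insertI1)
  then show "span {1::real} = UNIV" by blast
qed simp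

lemmas premanifold_real = premanifold_vec[OF fdim_real]


section \<open>Differential forms\<close>

lemma loc1_chart:
  assumes "premanifold M" "p \<in> points M" "y \<in> chart_dom M p"
  shows "loc1 M \<alpha> p (chart M p y) v = \<alpha> y (tcoord M p y v)"
  by (simp add: loc1_def chart_inv_chart[OF assms])

lemma loc2_chart:
  assumes "premanifold M" "p \<in> points M" "y \<in> chart_dom M p"
  shows "loc2 M \<omega> p (chart M p y) u v = \<omega> y (tcoord M p y u) (tcoord M p y v)"
  by (simp add: loc2_def chart_inv_chart[OF assms])

lemma one_form_linear: "one_form M \<alpha> \<Longrightarrow> p \<in> points M \<Longrightarrow> linear (\<alpha> p)"
  by (simp add: one_form_def)

lemma one_form_smooth: "one_form M \<alpha> \<Longrightarrow> p \<in> points M \<Longrightarrow> smooth_on (chart M p ` chart_dom M p) (\<lambda>x. loc1 M \<alpha> p x v)"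
  by (simp add: one_form_def)

lemma one_form_linear_loc1:
  assumes M: "premanifold M" and \<alpha>: "one_form M \<alpha>" and p: "p \<in> points M" and x: "x \<in> chart M p ` chart_dom M p"
  shows "linear (loc1 M \<alpha> p x)"
proof -
  obtain y where y: "y \<in> chart_dom M p" "x = chart M p y" using x by blast
  have "y \<in> points M" using premanifold_chart(2)[OF M p] y by blast
  then have "linear (\<alpha> y \<circ> tcoord M p y)"
    by (intro linear_compose tcoord_linear[OF M p y(1)] one_form_linear[OF \<alpha>])
  moreover have "loc1 M \<alpha> p x = \<alpha> y \<circ> tcoord M p y" by (rule ext) (simp add: y(2) loc1_chart[OF M p y(1)])
  ultimately show ?thesis by simp
qed

lemma one_form_cong:
  assumes M: "premanifold M" and \<alpha>: "one_form M \<alpha>" and eq: "\<And>p v. p \<in> points M \<Longrightarrow> \<alpha> p v = \<alpha>' p v"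
  shows "one_form M \<alpha>'"
  unfolding one_form_def
proof (intro ballI conjI allI)
  fix p v assume p: "p \<in> points M"
  have "\<alpha> p = \<alpha>' p" using eq[OF p] by blast
  then show "linear (\<alpha>' p)" using one_form_linear[OF \<alpha> p] by simp
  show "smooth_on (chart M p ` chart_dom M p) (\<lambda>x. loc1 M \<alpha>' p x v)"
  proof (rule smooth_on_cong[OF premanifold_chart(4)[OF M p] _ one_form_smooth[OF \<alpha> p]])
    fix x assume "x \<in> chart M p ` chart_dom M p"
    then obtain y where y: "y \<in> chart_dom M p" "x = chart M p y" by blast
    then have "y \<in> points M" using premanifold_chart(2)[OF M p] by blast
    then show "loc1 M \<alpha> p x v = loc1 M \<alpha>' p x v" by (simp add: y loc1_chart[OF M p] eq)
  qed
qed

lemma one_form_diff: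
  assumes M: "premanifold M" and \<alpha>: "one_form M \<alpha>" and \<beta>: "one_form M \<beta>"
  shows "one_form M (\<lambda>p v. \<alpha> p v - \<beta> p v)"
  unfolding one_form_def
proof (intro ballI conjI allI)
  fix p v assume p: "p \<in> points M"
  show "linear (\<lambda>v. \<alpha> p v - \<beta> p v)"
    by (rule linear_compose_sub[OF one_form_linear[OF \<alpha> p] one_form_linear[OF \<beta> p]])
  have "smooth_on (chart M p ` chart_dom M p) (\<lambda>x. loc1 M \<alpha> p x v - loc1 M \<beta> p x v)"
    by (rule smooth_on_diff[OF one_form_smooth[OF \<alpha> p] one_form_smooth[OF \<beta> p] premanifold_chart(4)[OF M p]])
  then show "smooth_on (chart M p ` chart_dom M p) (\<lambda>x. loc1 M (\<lambda>p v. \<alpha> p v - \<beta> p v) p x v)"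
    by (simp add: loc1_def Let_def)
qed

lemma loc1_pull1:
  assumes M: "premanifold M" and N: "premanifold N" and f: "smooth_map M N f"
    and p: "p \<in> points M" and q: "q \<in> points N" and y: "y \<in> chart_dom M p" "f y \<in> chart_dom N q"
  shows "loc1 M (pull1 M N f \<alpha>) p (chart M p y) v = loc1 N \<alpha> q (chart N q (f y)) (trep M N f p q y v)"
  by (simp add: loc1_chart[OF M p y(1)] loc1_chart[OF N q y(2)] pull1_def tcoord_trep_eq_tmap[OF assms])

lemma smooth_on_trep:
  assumes "premanifold M" "premanifold N" "smooth_map M N f" "p \<in> points M" "q \<in> points N"
  shows "smooth_on (chart M p ` rep_dom M N f p q) (\<lambda>x. frd (rep M N f p q) x v)"
  by (rule smooth_on_frd[OF smooth_on_rep[OF assms]])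

text \<open>In charts the pullback is a pairing of two smooth families: the form along the
  representative, and the derivative of the representative in a fixed direction.\<close>

lemma one_form_pull1:
  assumes M: "premanifold M" and N: "premanifold N" and f: "smooth_map M N f" and \<alpha>: "one_form N \<alpha>"
  shows "one_form M (pull1 M N f \<alpha>)"
  unfolding one_form_def
proof (intro ballI conjI allI)
  fix p v assume p: "p \<in> points M"
  have fp: "f p \<in> points N" using smooth_map_points[OF f p] .
  have "linear (\<alpha> (f p) \<circ> tmap M N f p)"
    by (intro linear_compose tmap_linear[OF M N f p] one_form_linear[OF \<alpha> fp])
  then show "linear (pull1 M N f \<alpha> p)" by (simp add: pull1_def[abs_def] comp_def)
  show "smooth_on (chart M p ` chart_dom M p) (\<lambda>x. loc1 M (pull1 M N f \<alpha>) p x v)"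
  proof (rule smooth_on_local)
    fix x assume "x \<in> chart M p ` chart_dom M p"
    then obtain y where y: "y \<in> chart_dom M p" "x = chart M p y" by blast
    have "y \<in> points M" using premanifold_chart(2)[OF M p] y by blast
    then have q: "f y \<in> points N" using smooth_map_points[OF f] by blast
    let ?D = "chart M p ` rep_dom M N f p (f y)"
    let ?B = "chart N (f y) ` chart_dom N (f y)"
    have o: "open ?D" by (rule open_rep_dom[OF M N f p q])
    have im: "rep M N f p (f y) ` ?D \<subseteq> ?B" using chart_inv_chart[OF M p] by auto
    have "smooth_on ?D (\<lambda>x. loc1 N \<alpha> (f y) (rep M N f p (f y) x) (frd (rep M N f p (f y)) x v))"
    proof (rule smooth_on_pairing[OF premanifold_fdim[OF N] _ _ smooth_on_trep[OF M N f p q] o])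
      show "linear (loc1 N \<alpha> (f y) (rep M N f p (f y) x))" if "x \<in> ?D" for x
        by (rule one_form_linear_loc1[OF N \<alpha> q]) (use im that in blast)
      show "smooth_on ?D (\<lambda>x. loc1 N \<alpha> (f y) (rep M N f p (f y) x) v)" for v
        by (rule smooth_on_compose[OF premanifold_fdim[OF N] smooth_on_rep[OF M N f p q] one_form_smooth[OF \<alpha> q] o im])
    qed
    then have "smooth_on ?D (\<lambda>x. loc1 M (pull1 M N f \<alpha>) p x v)"
      by (rule smooth_on_cong[OF o, rotated])
        (auto simp: loc1_pull1[OF M N f p q] trep_def chart_inv_chart[OF M p])
    moreover have "x \<in> ?D" using y premanifold_chart(1)[OF N q] by blast
    ultimately show "\<exists>A. open A \<and> x \<in> A \<and> smooth_on A (\<lambda>x. loc1 M (pull1 M N f \<alpha>) p x v)" using o by blast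
  qed
qed

lemma pull2_compose:
  assumes "premanifold M" "premanifold N" "premanifold K" "smooth_map M N f" "smooth_map N K g" "p \<in> points M"
  shows "pull2 M N f (pull2 N K g \<omega>) p u v = pull2 M K (\<lambda>x. g (f x)) \<omega> p u v"
  by (simp add: pull2_def tmap_compose[OF assms])

lemma pull2_cong:
  assumes "premanifold M" "p \<in> points M" "mfd_open M X" "p \<in> X" "\<And>x. x \<in> X \<Longrightarrow> f x = g x"
  shows "pull2 M N f \<omega> p u v = pull2 M N g \<omega> p u v"
  using tmap_cong[OF assms, where N = N] assms(4,5) by (simp add: pull2_def)


subsection \<open>The exterior derivative of a one-form\<close>

text \<open>The exterior derivative at any point of the chart at \<open>p\<close>, whereas
  \<open>ext_deriv1\<close> changes the chart with the point. Differentiating the exterior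
  derivative once more requires one chart on a whole neighbourhood.\<close>

definition ext_loc :: "('m, 'e::real_inner) mfd \<Rightarrow> ('m \<Rightarrow> 'e \<Rightarrow> real) \<Rightarrow> 'm \<Rightarrow> 'e \<Rightarrow> 'e \<Rightarrow> 'e \<Rightarrow> real" where
  "ext_loc M \<alpha> p x u v = frd (\<lambda>x. loc1 M \<alpha> p x v) x u - frd (\<lambda>x. loc1 M \<alpha> p x u) x v"

lemma ext_deriv1_ext_loc: "ext_deriv1 M \<alpha> p u v = ext_loc M \<alpha> p (chart M p p) u v"
  by (simp add: ext_deriv1_def ext_loc_def)

lemma ext_loc_cong:
  assumes M: "premanifold M" and p: "p \<in> points M" and X: "mfd_open M X" and y: "y \<in> X" "y \<in> chart_dom M p"
    and eq: "\<And>z v. z \<in> X \<Longrightarrow> \<alpha> z v = \<alpha>' z v"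
  shows "ext_loc M \<alpha> p (chart M p y) u v = ext_loc M \<alpha>' p (chart M p y) u v"
proof -
  have "frd (\<lambda>x. loc1 M \<alpha> p x w) (chart M p y) = frd (\<lambda>x. loc1 M \<alpha>' p x w) (chart M p y)" for w
  proof (rule frd_cong)
    show "open (chart M p ` (chart_dom M p \<inter> X))"
      by (rule mfd_open_chart_image[OF M mfd_open_Int[OF mfd_open_chart_dom[OF M p] X] p]) simp
    show "chart M p y \<in> chart M p ` (chart_dom M p \<inter> X)" using y by blast
    show "loc1 M \<alpha> p x w = loc1 M \<alpha>' p x w" if "x \<in> chart M p ` (chart_dom M p \<inter> X)" for x
      using that eq by (auto simp: loc1_chart[OF M p])
  qed
  then show ?thesis by (simp add: ext_loc_def)
qed

lemma ext_deriv1_cong: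
  assumes "premanifold M" "mfd_open M X" "p \<in> X" "\<And>z v. z \<in> X \<Longrightarrow> \<alpha> z v = \<alpha>' z v"
  shows "ext_deriv1 M \<alpha> p u v = ext_deriv1 M \<alpha>' p u v"
proof -
  have p: "p \<in> points M" using mfd_open_subset[OF assms(2)] assms(3) by blast
  show ?thesis unfolding ext_deriv1_ext_loc
    by (rule ext_loc_cong[OF assms(1) p assms(2,3) premanifold_chart(1)[OF assms(1) p] assms(4)])
qed

lemma ext_loc_pull1:
  assumes M: "premanifold M" and N: "premanifold N" and f: "smooth_map M N f" and \<alpha>: "one_form N \<alpha>"
    and p: "p \<in> points M" and q: "q \<in> points N" and y: "y \<in> chart_dom M p" "f y \<in> chart_dom N q"
  shows "ext_loc M (pull1 M N f \<alpha>) p (chart M p y) u v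
    = ext_loc N \<alpha> q (chart N q (f y)) (trep M N f p q y u) (trep M N f p q y v)"
proof -
  let ?D = "chart M p ` rep_dom M N f p q" and ?f = "rep M N f p q" and ?\<alpha> = "loc1 N \<alpha> q"
  have o: "open ?D" by (rule open_rep_dom[OF M N f p q])
  have yD: "chart M p y \<in> ?D" using y by blast
  have im: "?f ` ?D \<subseteq> chart N q ` chart_dom N q" using chart_inv_chart[OF M p] by auto
  have e: "frd (\<lambda>x. loc1 M (pull1 M N f \<alpha>) p x w) (chart M p y) = frd (\<lambda>x. ?\<alpha> (?f x) (frd ?f x w)) (chart M p y)" for w
    by (rule frd_cong[OF o yD]) (auto simp: loc1_pull1[OF M N f p q] trep_def chart_inv_chart[OF M p])
  have "?f (chart M p y) = chart N q (f y)" by (simp add: chart_inv_chart[OF M p y(1)])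
  then show ?thesis
    using pullback_exterior_derivative_local[OF premanifold_fdim[OF N] o yD smooth_on_rep[OF M N f p q] im
        one_form_linear_loc1[OF N \<alpha> q] one_form_smooth[OF \<alpha> q], of v u]
    unfolding ext_loc_def e trep_def by simp
qed

lemma ext_deriv1_pull1:
  assumes M: "premanifold M" and N: "premanifold N" and f: "smooth_map M N f" and \<alpha>: "one_form N \<alpha>"
    and p: "p \<in> points M"
  shows "ext_deriv1 M (pull1 M N f \<alpha>) p u v = pull2 M N f (ext_deriv1 N \<alpha>) p u v"
  using ext_loc_pull1[OF M N f \<alpha> p smooth_map_points[OF f p] premanifold_chart(1)[OF M p]
      premanifold_chart(1)[OF N smooth_map_points[OF f p]]]
  by (simp add: ext_deriv1_ext_loc pull2_def tmap_trep)

text \<open>Chart independence of the exterior derivative: naturality under the identity map, read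
  from the chart at \<open>p\<close> to the chart at \<open>y\<close>.\<close>

lemma loc2_ext_deriv1:
  assumes M: "premanifold M" and \<alpha>: "one_form M \<alpha>" and p: "p \<in> points M" and x: "x \<in> chart M p ` chart_dom M p"
  shows "loc2 M (ext_deriv1 M \<alpha>) p x u v = ext_loc M \<alpha> p x u v"
proof -
  obtain y where y: "y \<in> chart_dom M p" "x = chart M p y" using x by blast
  have yM: "y \<in> points M" using premanifold_chart(2)[OF M p] y by blast
  have "ext_loc M (pull1 M M (\<lambda>x. x) \<alpha>) p x u v = ext_loc M \<alpha> p x u v"
    unfolding y(2)
    by (rule ext_loc_cong[OF M p mfd_open_points[OF M] yM y(1)]) (simp add: pull1_def tmap_ident[OF M])
  then show ?thesis
    using ext_loc_pull1[OF M M smooth_map_ident[OF M] \<alpha> p yM y(1) premanifold_chart(1)[OF M yM], of u v]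
    by (simp add: y(2) loc2_chart[OF M p y(1)] ext_deriv1_ext_loc tcoord_trep)
qed

text \<open>Each term is linear in the direction of differentiation because it is a derivative, and
  in the other vector because differentiation respects linear combinations of forms.\<close>

lemma ext_loc_bilinear:
  assumes M: "premanifold M" and \<alpha>: "one_form M \<alpha>" and p: "p \<in> points M" and x: "x \<in> chart M p ` chart_dom M p"
  shows "bilinear (ext_loc M \<alpha> p x)"
proof -
  let ?D = "chart M p ` chart_dom M p"
  note o = premanifold_chart(4)[OF M p]
  have lin: "linear (\<lambda>v. frd (\<lambda>x. loc1 M \<alpha> p x v) x u)" for u
  proof (rule linearI)
    have hd: "((\<lambda>x. loc1 M \<alpha> p x v) has_derivative frd (\<lambda>x. loc1 M \<alpha> p x v) x) (at x)" for v
      by (rule smooth_on_has_derivative[OF one_form_smooth[OF \<alpha> p] x])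
    show "frd (\<lambda>x. loc1 M \<alpha> p x (v + w)) x u = frd (\<lambda>x. loc1 M \<alpha> p x v) x u + frd (\<lambda>x. loc1 M \<alpha> p x w) x u" for v w
    proof -
      have "frd (\<lambda>x. loc1 M \<alpha> p x (v + w)) x = frd (\<lambda>x. loc1 M \<alpha> p x v + loc1 M \<alpha> p x w) x"
        by (rule frd_cong[OF o x]) (rule linear_add[OF one_form_linear_loc1[OF M \<alpha> p]])
      then show ?thesis using frd_eqI[OF has_derivative_add[OF hd hd], of v w] by simp
    qed
    show "frd (\<lambda>x. loc1 M \<alpha> p x (c *\<^sub>R v)) x u = c *\<^sub>R frd (\<lambda>x. loc1 M \<alpha> p x v) x u" for c v
    proof -
      have "frd (\<lambda>x. loc1 M \<alpha> p x (c *\<^sub>R v)) x = frd (\<lambda>x. c *\<^sub>R loc1 M \<alpha> p x v) x"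
        by (rule frd_cong[OF o x]) (rule linear_scale[OF one_form_linear_loc1[OF M \<alpha> p]])
      then show ?thesis using frd_eqI[OF has_derivative_scaleR_right[OF hd], of c v] by simp
    qed
  qed
  have lin': "linear (frd (\<lambda>x. loc1 M \<alpha> p x v) x)" for v
    by (rule smooth_on_linear_frd[OF one_form_smooth[OF \<alpha> p] x])
  show ?thesis unfolding bilinear_def ext_loc_def
    by (intro conjI allI linear_compose_sub lin lin')
qed

lemma two_form_bilinear: "two_form M \<omega> \<Longrightarrow> p \<in> points M \<Longrightarrow> bilinear (\<omega> p)"
  by (simp add: two_form_def)

lemma two_form_ext_deriv1:
  assumes M: "premanifold M" and \<alpha>: "one_form M \<alpha>"
  shows "two_form M (ext_deriv1 M \<alpha>)"
  unfolding two_form_def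
proof (intro ballI conjI allI)
  fix p u v assume p: "p \<in> points M"
  have "chart M p p \<in> chart M p ` chart_dom M p" using premanifold_chart(1)[OF M p] by blast
  from ext_loc_bilinear[OF M \<alpha> p this]
  show "bilinear (ext_deriv1 M \<alpha> p)" by (simp add: ext_deriv1_ext_loc[abs_def])
  show "ext_deriv1 M \<alpha> p v v = 0" by (simp add: ext_deriv1_def)
  note o = premanifold_chart(4)[OF M p]
  have "smooth_on (chart M p ` chart_dom M p) (\<lambda>x. ext_loc M \<alpha> p x u v)"
    unfolding ext_loc_def by (intro smooth_on_diff smooth_on_frd one_form_smooth[OF \<alpha> p] o)
  then show "smooth_on (chart M p ` chart_dom M p) (\<lambda>x. loc2 M (ext_deriv1 M \<alpha>) p x u v)"
    by (rule smooth_on_cong[OF o, rotated]) (rule loc2_ext_deriv1[OF M \<alpha> p, symmetric])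
qed

lemma ext_deriv1_diff:
  assumes M: "premanifold M" and \<alpha>: "one_form M \<alpha>" and \<beta>: "one_form M \<beta>" and p: "p \<in> points M"
  shows "ext_deriv1 M (\<lambda>p v. \<alpha> p v - \<beta> p v) p u v = ext_deriv1 M \<alpha> p u v - ext_deriv1 M \<beta> p u v"
proof -
  have x: "chart M p p \<in> chart M p ` chart_dom M p" using premanifold_chart(1)[OF M p] by blast
  have hd: "((\<lambda>x. loc1 M \<alpha> p x v) has_derivative frd (\<lambda>x. loc1 M \<alpha> p x v) (chart M p p)) (at (chart M p p))"
    if "one_form M \<alpha>" for \<alpha> v
    by (rule smooth_on_has_derivative[OF one_form_smooth[OF that p] x])
  have e: "loc1 M (\<lambda>p v. \<alpha> p v - \<beta> p v) p x v = loc1 M \<alpha> p x v - loc1 M \<beta> p x v" for x v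
    by (simp add: loc1_def Let_def)
  show ?thesis
    unfolding ext_deriv1_def e
      frd_eqI[OF has_derivative_diff[OF hd[OF \<alpha>] hd[OF \<beta>]]] by simp
qed

lemma ext_deriv2_cong:
  assumes M: "premanifold M" and X: "mfd_open M X" "p \<in> X"
    and eq: "\<And>z u v. z \<in> X \<Longrightarrow> \<omega> z u v = \<omega>' z u v"
  shows "ext_deriv2 M \<omega> p u v w = ext_deriv2 M \<omega>' p u v w"
proof -
  have p: "p \<in> points M" using mfd_open_subset[OF X(1)] X(2) by blast
  have "frd (\<lambda>x. loc2 M \<omega> p x u v) (chart M p p) = frd (\<lambda>x. loc2 M \<omega>' p x u v) (chart M p p)" for u v
  proof (rule frd_cong)
    show "open (chart M p ` (chart_dom M p \<inter> X))"
      by (rule mfd_open_chart_image[OF M mfd_open_Int[OF mfd_open_chart_dom[OF M p] X(1)] p]) simp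
    show "chart M p p \<in> chart M p ` (chart_dom M p \<inter> X)" using X premanifold_chart(1)[OF M p] by blast
    show "loc2 M \<omega> p x u v = loc2 M \<omega>' p x u v" if "x \<in> chart M p ` (chart_dom M p \<inter> X)" for x
      using that eq by (auto simp: loc2_chart[OF M p])
  qed
  then show ?thesis by (simp add: ext_deriv2_def)
qed

text \<open>Six iterated derivatives of the coordinate components remain, and they cancel in pairs
  by symmetry of second derivatives.\<close>

lemma ext_deriv2_ext_deriv1:
  assumes M: "premanifold M" and \<alpha>: "one_form M \<alpha>" and p: "p \<in> points M"
  shows "ext_deriv2 M (ext_deriv1 M \<alpha>) p u v w = 0"
proof -
  let ?D = "chart M p ` chart_dom M p" and ?x = "chart M p p"
  note o = premanifold_chart(4)[OF M p]
  have x: "?x \<in> ?D" using premanifold_chart(1)[OF M p] by blast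
  have s: "smooth_on ?D (\<lambda>x. loc1 M \<alpha> p x v)" for v by (rule one_form_smooth[OF \<alpha> p])
  have "frd (\<lambda>x. loc2 M (ext_deriv1 M \<alpha>) p x a b) ?x c
    = frd (\<lambda>x. frd (\<lambda>x. loc1 M \<alpha> p x b) x a) ?x c - frd (\<lambda>x. frd (\<lambda>x. loc1 M \<alpha> p x a) x b) ?x c" for a b c
  proof -
    have "frd (\<lambda>x. loc2 M (ext_deriv1 M \<alpha>) p x a b) ?x
      = frd (\<lambda>x. frd (\<lambda>x. loc1 M \<alpha> p x b) x a - frd (\<lambda>x. loc1 M \<alpha> p x a) x b) ?x"
      by (rule frd_cong[OF o x]) (simp add: loc2_ext_deriv1[OF M \<alpha> p] ext_loc_def)
    then show ?thesis
      using frd_eqI[OF has_derivative_diff[OF smooth_on_has_derivative[OF smooth_on_frd[OF s] x]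
            smooth_on_has_derivative[OF smooth_on_frd[OF s] x]]] by metis
  qed
  then have "ext_deriv2 M (ext_deriv1 M \<alpha>) p u v w =
      frd (\<lambda>x. frd (\<lambda>x. loc1 M \<alpha> p x w) x v) ?x u - frd (\<lambda>x. frd (\<lambda>x. loc1 M \<alpha> p x v) x w) ?x u
      - (frd (\<lambda>x. frd (\<lambda>x. loc1 M \<alpha> p x w) x u) ?x v - frd (\<lambda>x. frd (\<lambda>x. loc1 M \<alpha> p x u) x w) ?x v)
      + (frd (\<lambda>x. frd (\<lambda>x. loc1 M \<alpha> p x v) x u) ?x w - frd (\<lambda>x. frd (\<lambda>x. loc1 M \<alpha> p x u) x v) ?x w)"
    unfolding ext_deriv2_def by simp
  then show ?thesis
    using second_derivative_symmetric[OF s[of w] o x, of v u] second_derivative_symmetric[OF s[of v] o x, of w u]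
      second_derivative_symmetric[OF s[of u] o x, of w v] by simp
qed


subsection \<open>Restriction to open submanifolds\<close>

lemma smooth_map_inclusion:
  assumes "premanifold M" "mfd_open M X"
  shows "smooth_map (open_sub M X) M (\<lambda>x. x)"
  by (rule smooth_map_open_sub[OF assms smooth_map_ident[OF assms(1)]])

lemma tmap_inclusion:
  assumes "premanifold M" "mfd_open M X" "p \<in> X"
  shows "tmap (open_sub M X) M (\<lambda>x. x) p v = v"
  using assms(3) mfd_open_subset[OF assms(2)] by (auto simp: tmap_open_sub[OF assms] tmap_ident[OF assms(1)])

text \<open>Restriction is pullback along the inclusion, whose tangent map is the identity in these
  charts, so smoothness is inherited from the pullback.\<close>

lemma one_form_open_sub:
  fixes \<alpha> :: "'m \<Rightarrow> 'e::real_inner \<Rightarrow> real"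
  assumes M: "premanifold M" and X: "mfd_open M X" and \<alpha>: "one_form M \<alpha>"
  shows "one_form (open_sub M X) \<alpha>"
  by (rule one_form_cong[OF premanifold_open_sub[OF M X]
        one_form_pull1[OF premanifold_open_sub[OF M X] M smooth_map_inclusion[OF M X] \<alpha>]])
    (simp add: pull1_def tmap_inclusion[OF M X])

lemma ext_deriv1_open_sub:
  assumes M: "premanifold M" and X: "mfd_open M X" and p: "p \<in> X"
  shows "ext_deriv1 (open_sub M X) \<alpha> p u v = ext_deriv1 M \<alpha> p u v"
proof -
  have pM: "p \<in> points M" using mfd_open_subset[OF X] p by blast
  have "frd (\<lambda>x. loc1 (open_sub M X) \<alpha> p x v) (chart M p p) = frd (\<lambda>x. loc1 M \<alpha> p x v) (chart M p p)" for v
  proof (rule frd_cong)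
    show "open (chart M p ` (chart_dom M p \<inter> X))"
      by (rule mfd_open_chart_image[OF M mfd_open_Int[OF mfd_open_chart_dom[OF M pM] X] pM]) simp
    show "chart M p p \<in> chart M p ` (chart_dom M p \<inter> X)" using p premanifold_chart(1)[OF M pM] by blast
    show "loc1 (open_sub M X) \<alpha> p x v = loc1 M \<alpha> p x v" if x: "x \<in> chart M p ` (chart_dom M p \<inter> X)" for x
    proof -
      obtain y where y: "y \<in> chart_dom M p" "y \<in> X" "x = chart M p y" using x by blast
      then have "chart_inv (open_sub M X) p x = y"
        using chart_inv_open_sub[OF M pM x] by (simp add: chart_inv_chart[OF M pM])
      then show ?thesis
        using tcoord_open_sub[OF M X p y(1,2)] y(3) by (simp add: loc1_def chart_inv_chart[OF M pM y(1)])
    qed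
  qed
  then show ?thesis by (simp add: ext_deriv1_def)
qed


lemma ext_deriv2_open_sub:
  assumes M: "premanifold M" and X: "mfd_open M X" and p: "p \<in> X"
  shows "ext_deriv2 (open_sub M X) \<omega> p u v w = ext_deriv2 M \<omega> p u v w"
proof -
  have pM: "p \<in> points M" using mfd_open_subset[OF X] p by blast
  have "frd (\<lambda>x. loc2 (open_sub M X) \<omega> p x u v) (chart M p p) = frd (\<lambda>x. loc2 M \<omega> p x u v) (chart M p p)" for u v
  proof (rule frd_cong)
    show "open (chart M p ` (chart_dom M p \<inter> X))"
      by (rule mfd_open_chart_image[OF M mfd_open_Int[OF mfd_open_chart_dom[OF M pM] X] pM]) simp
    show "chart M p p \<in> chart M p ` (chart_dom M p \<inter> X)" using p premanifold_chart(1)[OF M pM] by blast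
    show "loc2 (open_sub M X) \<omega> p x u v = loc2 M \<omega> p x u v" if x: "x \<in> chart M p ` (chart_dom M p \<inter> X)" for x
    proof -
      obtain y where y: "y \<in> chart_dom M p" "y \<in> X" "x = chart M p y" using x by blast
      then have "chart_inv (open_sub M X) p x = y"
        using chart_inv_open_sub[OF M pM x] by (simp add: chart_inv_chart[OF M pM])
      then show ?thesis
        using tcoord_open_sub[OF M X p y(1,2)] y(3) by (simp add: loc2_def chart_inv_chart[OF M pM y(1)])
    qed
  qed
  then show ?thesis by (simp add: ext_deriv2_def)
qed

lemma one_form_zero: "premanifold M \<Longrightarrow> one_form M (\<lambda>p v. 0 :: real)"
  by (simp add: one_form_def loc1_def smooth_on_const linear_zero)

lemma ext_deriv1_zero: "ext_deriv1 M (\<lambda>p v. 0) p u v = 0"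
  by (simp add: ext_deriv1_def loc1_def)

text \<open>Polarisation of the vanishing on the diagonal.\<close>

lemma two_form_skew:
  assumes "two_form M \<omega>" "p \<in> points M"
  shows "\<omega> p u v = - \<omega> p v u"
proof -
  note b = two_form_bilinear[OF assms]
  have z: "\<omega> p w w = 0" for w using assms by (simp add: two_form_def)
  have "\<omega> p (u + v) (u + v) = \<omega> p u u + \<omega> p u v + (\<omega> p v u + \<omega> p v v)"
    by (simp add: bilinear_ladd[OF b] bilinear_radd[OF b])
  then show ?thesis by (simp add: z)
qed


subsection \<open>Differentials of functions\<close>

lemma loc1_tmap_real:
  assumes M: "premanifold M" and f: "smooth_map M vec_mfd (f :: _ \<Rightarrow> real)"
    and p: "p \<in> points M" and x: "x \<in> chart M p ` chart_dom M p"
  shows "loc1 M (tmap M vec_mfd f) p x v = frd (\<lambda>x. f (chart_inv M p x)) x v"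
proof -
  obtain y where y: "y \<in> chart_dom M p" "x = chart M p y" using x by blast
  have "tcoord vec_mfd 0 (f y) (trep M vec_mfd f p 0 y v) = trep M vec_mfd f p 0 y v"
    by (simp add: tcoord_def comp_def)
  then show ?thesis
    using tcoord_trep_eq_tmap[OF M premanifold_real f p, of 0 y v] y
    by (simp add: loc1_chart[OF M p] trep_def comp_def)
qed

lemma smooth_on_real_rep:
  assumes M: "premanifold M" and f: "smooth_map M vec_mfd (f :: _ \<Rightarrow> real)" and p: "p \<in> points M"
  shows "smooth_on (chart M p ` chart_dom M p) (\<lambda>x. f (chart_inv M p x))"
  using smooth_on_rep[OF M premanifold_real f p, of 0] by (simp add: comp_def)

lemma one_form_tmap_real:
  assumes M: "premanifold M" and f: "smooth_map M vec_mfd (f :: _ \<Rightarrow> real)"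
  shows "one_form M (tmap M vec_mfd f)"
  unfolding one_form_def
proof (intro ballI conjI allI)
  fix p v assume p: "p \<in> points M"
  show "linear (tmap M vec_mfd f p)" by (rule tmap_linear[OF M premanifold_real f p])
  show "smooth_on (chart M p ` chart_dom M p) (\<lambda>x. loc1 M (tmap M vec_mfd f) p x v)"
    by (rule smooth_on_cong[OF premanifold_chart(4)[OF M p] _ smooth_on_frd[OF smooth_on_real_rep[OF M f p]]])
      (rule loc1_tmap_real[OF M f p, symmetric])
qed

lemma ext_deriv1_tmap_real:
  assumes M: "premanifold M" and f: "smooth_map M vec_mfd (f :: _ \<Rightarrow> real)" and p: "p \<in> points M"
  shows "ext_deriv1 M (tmap M vec_mfd f) p u v = 0"
proof -
  note o = premanifold_chart(4)[OF M p]
  have x: "chart M p p \<in> chart M p ` chart_dom M p" using premanifold_chart(1)[OF M p] by blast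
  have "frd (\<lambda>x. loc1 M (tmap M vec_mfd f) p x v) (chart M p p)
    = frd (\<lambda>x. frd (\<lambda>x. f (chart_inv M p x)) x v) (chart M p p)" for v
    by (rule frd_cong[OF o x]) (rule loc1_tmap_real[OF M f p])
  then show ?thesis
    using second_derivative_symmetric[OF smooth_on_real_rep[OF M f p] o x] by (simp add: ext_deriv1_def)
qed

subsection \<open>Two-forms\<close>

lemma loc2_pull2:
  assumes M: "premanifold M" and N: "premanifold N" and f: "smooth_map M N f"
    and p: "p \<in> points M" and q: "q \<in> points N" and y: "y \<in> chart_dom M p" "f y \<in> chart_dom N q"
  shows "loc2 M (pull2 M N f \<omega>) p (chart M p y) u v
    = loc2 N \<omega> q (chart N q (f y)) (trep M N f p q y u) (trep M N f p q y v)"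
  by (simp add: loc2_chart[OF M p y(1)] loc2_chart[OF N q y(2)] pull2_def tcoord_trep_eq_tmap[OF assms])

lemma bilinear_compose_linear:
  assumes "bilinear b" "linear f" "linear g"
  shows "bilinear (\<lambda>u v. b (f u) (g v))"
proof -
  have "linear (b x \<circ> g)" "linear ((\<lambda>x. b x y) \<circ> f)" for x y
    using assms by (auto simp: bilinear_def intro!: linear_compose)
  then show ?thesis by (simp add: bilinear_def comp_def)
qed

lemma two_form_bilinear_loc2:
  assumes M: "premanifold M" and \<omega>: "two_form M \<omega>" and p: "p \<in> points M" and x: "x \<in> chart M p ` chart_dom M p"
  shows "bilinear (loc2 M \<omega> p x)"
proof -
  obtain y where y: "y \<in> chart_dom M p" "x = chart M p y" using x by blast
  have "y \<in> points M" using premanifold_chart(2)[OF M p] y by blast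
  then have "bilinear (\<lambda>u v. \<omega> y (tcoord M p y u) (tcoord M p y v))"
    by (rule bilinear_compose_linear[OF two_form_bilinear[OF \<omega>] tcoord_linear[OF M p y(1)] tcoord_linear[OF M p y(1)]])
  moreover have "loc2 M \<omega> p x = (\<lambda>u v. \<omega> y (tcoord M p y u) (tcoord M p y v))"
    by (intro ext) (simp add: y(2) loc2_chart[OF M p y(1)])
  ultimately show ?thesis by simp
qed

lemma two_form_pull2:
  assumes M: "premanifold M" and N: "premanifold N" and f: "smooth_map M N f" and \<omega>: "two_form N \<omega>"
  shows "two_form M (pull2 M N f \<omega>)"
  unfolding two_form_def
proof (intro ballI conjI allI)
  fix p u v assume p: "p \<in> points M"
  have fp: "f p \<in> points N" using smooth_map_points[OF f p] .
  have "bilinear (\<lambda>u v. \<omega> (f p) (tmap M N f p u) (tmap M N f p v))"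
    by (rule bilinear_compose_linear[OF two_form_bilinear[OF \<omega> fp] tmap_linear[OF M N f p] tmap_linear[OF M N f p]])
  then show "bilinear (pull2 M N f \<omega> p)" by (simp add: pull2_def[abs_def])
  show "pull2 M N f \<omega> p v v = 0" using \<omega> fp by (simp add: pull2_def two_form_def)
  show "smooth_on (chart M p ` chart_dom M p) (\<lambda>x. loc2 M (pull2 M N f \<omega>) p x u v)"
  proof (rule smooth_on_local)
    fix x assume "x \<in> chart M p ` chart_dom M p"
    then obtain y where y: "y \<in> chart_dom M p" "x = chart M p y" by blast
    have "y \<in> points M" using premanifold_chart(2)[OF M p] y by blast
    then have q: "f y \<in> points N" using smooth_map_points[OF f] by blast
    let ?D = "chart M p ` rep_dom M N f p (f y)" and ?f = "rep M N f p (f y)"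
    let ?B = "chart N (f y) ` chart_dom N (f y)"
    have o: "open ?D" by (rule open_rep_dom[OF M N f p q])
    have im: "?f ` ?D \<subseteq> ?B" using chart_inv_chart[OF M p] by auto
    have bil: "bilinear (loc2 N \<omega> (f y) (?f x))" if "x \<in> ?D" for x
      by (rule two_form_bilinear_loc2[OF N \<omega> q]) (use im that in blast)
    have s: "smooth_on ?B (\<lambda>x. loc2 N \<omega> (f y) x a b)" for a b using \<omega> q by (simp add: two_form_def)
    have s1: "smooth_on ?D (\<lambda>x. loc2 N \<omega> (f y) (?f x) a b)" for a b
      by (rule smooth_on_compose[OF premanifold_fdim[OF N] smooth_on_rep[OF M N f p q] s o im])
    \<comment> \<open>The two moving vectors are substituted one at a time; the explicit abstraction
      over \<open>a\<close> exhibits a linear family to which the pairing lemma applies with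
      \<open>b\<close> fixed.\<close>
    have "smooth_on ?D (\<lambda>x. (\<lambda>a. loc2 N \<omega> (f y) (?f x) a b) (frd ?f x u))" for b
      by (rule smooth_on_pairing[OF premanifold_fdim[OF N] _ s1 smooth_on_trep[OF M N f p q] o])
        (use bil in \<open>auto simp: bilinear_def\<close>)
    then have s2: "smooth_on ?D (\<lambda>x. loc2 N \<omega> (f y) (?f x) (frd ?f x u) b)" for b .
    have "smooth_on ?D (\<lambda>x. loc2 N \<omega> (f y) (?f x) (frd ?f x u) (frd ?f x v))"
      by (rule smooth_on_pairing[OF premanifold_fdim[OF N] _ s2 smooth_on_trep[OF M N f p q] o])
        (use bil in \<open>auto simp: bilinear_def\<close>)
    then have "smooth_on ?D (\<lambda>x. loc2 M (pull2 M N f \<omega>) p x u v)"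
      by (rule smooth_on_cong[OF o, rotated])
        (auto simp: loc2_pull2[OF M N f p q] trep_def chart_inv_chart[OF M p])
    moreover have "x \<in> ?D" using y premanifold_chart(1)[OF N q] by blast
    ultimately show "\<exists>A. open A \<and> x \<in> A \<and> smooth_on A (\<lambda>x. loc2 M (pull2 M N f \<omega>) p x u v)" using o by blast
  qed
qed

lemma two_form_diff:
  assumes M: "premanifold M" and \<omega>: "two_form M \<omega>" and \<omega>': "two_form M \<omega>'"
  shows "two_form M (\<lambda>p u v. \<omega> p u v - \<omega>' p u v)"
  unfolding two_form_def
proof (intro ballI conjI allI)
  fix p u v assume p: "p \<in> points M"
  show "bilinear (\<lambda>u v. \<omega> p u v - \<omega>' p u v)"
    using two_form_bilinear[OF \<omega> p] two_form_bilinear[OF \<omega>' p]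
    by (auto simp: bilinear_def intro!: linear_compose_sub)
  show "\<omega> p v v - \<omega>' p v v = 0" using \<omega> \<omega>' p by (simp add: two_form_def)
  have "smooth_on (chart M p ` chart_dom M p) (\<lambda>x. loc2 M \<omega> p x u v - loc2 M \<omega>' p x u v)"
    using \<omega> \<omega>' p by (intro smooth_on_diff premanifold_chart(4)[OF M p]) (simp_all add: two_form_def)
  then show "smooth_on (chart M p ` chart_dom M p) (\<lambda>x. loc2 M (\<lambda>p u v. \<omega> p u v - \<omega>' p u v) p x u v)"
    by (simp add: loc2_def Let_def)
qed

lemma two_form_cong:
  assumes M: "premanifold M" and \<omega>: "two_form M \<omega>" and eq: "\<And>p u v. p \<in> points M \<Longrightarrow> \<omega> p u v = \<omega>' p u v"
  shows "two_form M \<omega>'"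
  unfolding two_form_def
proof (intro ballI conjI allI)
  fix p u v assume p: "p \<in> points M"
  have "\<omega>' p = \<omega> p" by (intro ext) (simp add: eq[OF p])
  then show "bilinear (\<omega>' p)" "\<omega>' p v v = 0" using \<omega> p by (simp_all add: two_form_def)
  have "smooth_on (chart M p ` chart_dom M p) (\<lambda>x. loc2 M \<omega> p x u v)" using \<omega> p by (simp add: two_form_def)
  then show "smooth_on (chart M p ` chart_dom M p) (\<lambda>x. loc2 M \<omega>' p x u v)"
  proof (rule smooth_on_cong[OF premanifold_chart(4)[OF M p], rotated])
    fix x assume "x \<in> chart M p ` chart_dom M p"
    then obtain y where y: "y \<in> chart_dom M p" "x = chart M p y" by blast
    then have "y \<in> points M" using premanifold_chart(2)[OF M p] by blast
    then show "loc2 M \<omega> p x u v = loc2 M \<omega>' p x u v" by (simp add: y loc2_chart[OF M p] eq)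
  qed
qed


section \<open>The cotangent bundle as a manifold\<close>

lemma cotangent_simps:
  "points (cotangent S) = {(y, r). y \<in> points S \<and> linear r}"
  "chart_dom (cotangent S) (x, r0) = {(y, r). y \<in> chart_dom S x \<and> linear r}"
  "chart (cotangent S) (x, r0) (y, r) = (chart S x y, riesz (\<lambda>v. r (tcoord S x y v)))"
  by (simp_all add: cotangent_def)

lemma linear_covector_coord:
  assumes "premanifold S" "x \<in> points S" "y \<in> chart_dom S x" "linear r"
  shows "linear (\<lambda>v. r (tcoord S x y v))"
  using linear_compose[OF tcoord_linear[OF assms(1-3)] assms(4)] by (simp add: comp_def)

lemma linear_covector_of_coord:
  fixes S :: "('m, 'e::real_inner) mfd"
  assumes S: "premanifold S" and x: "x \<in> points S" and y: "y \<in> points S" "z \<in> chart_dom S y" "z \<in> chart_dom S x"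
  shows "linear (\<lambda>w. a \<bullet> trep S S (\<lambda>z. z) y x z w)"
  using linear_compose[OF trep_linear[OF S S smooth_map_ident[OF S] y(1) x y(2,3)]
      bounded_linear.linear[OF bounded_linear_inner_right[of a]]]
  by (simp add: comp_def)

text \<open>The fibre part of the chart is invertible because the tangent coordinate change is, and
  because linear functionals correspond to vectors through \<open>riesz\<close>. A fibre vector
  \<open>a\<close> comes from the functional that pairs \<open>a\<close> with the components of a
  tangent vector in the chart at \<open>x\<close>.\<close>

lemma chart_inv_cotangent:
  assumes S: "premanifold S" and x: "x \<in> points S" and \<xi>: "\<xi> \<in> chart S x ` chart_dom S x"
  shows "chart_inv (cotangent S) (x, r0) (\<xi>, a)
      = (chart_inv S x \<xi>, \<lambda>w. a \<bullet> trep S S (\<lambda>z. z) (chart_inv S x \<xi>) x (chart_inv S x \<xi>) w)" (is ?inv)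
    and "(\<xi>, a) \<in> chart (cotangent S) (x, r0) ` chart_dom (cotangent S) (x, r0)" (is ?mem)
    and "inj_on (chart (cotangent S) (x, r0)) (chart_dom (cotangent S) (x, r0))" (is ?inj)
proof -
  note fd = premanifold_fdim[OF S]
  show ?inj
  proof (rule inj_onI)
    fix z z' assume "z \<in> chart_dom (cotangent S) (x, r0)" "z' \<in> chart_dom (cotangent S) (x, r0)"
      and eq: "chart (cotangent S) (x, r0) z = chart (cotangent S) (x, r0) z'"
    then obtain y r y' r' where z: "z = (y, r)" "y \<in> chart_dom S x" "linear r"
      and z': "z' = (y', r')" "y' \<in> chart_dom S x" "linear r'"
      by (auto simp: cotangent_simps)
    have yy: "y = y'" using eq premanifold_chart(3)[OF S x] z z' by (auto simp: cotangent_simps inj_on_def)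
    have "riesz (\<lambda>v. r (tcoord S x y v)) = riesz (\<lambda>v. r' (tcoord S x y v))"
      using eq by (simp add: z z' yy cotangent_simps)
    then have "r (tcoord S x y v) = r' (tcoord S x y v)" for v
      using riesz_inner[OF fd linear_covector_coord[OF S x z(2,3)]]
        riesz_inner[OF fd linear_covector_coord[OF S x z'(2,3)[folded yy]]] by metis
    then have "r w = r' w" for w using tcoord_inverse(2)[OF S x z(2)] by metis
    then show "z = z'" using z z' yy by auto
  qed
  obtain y where y: "y \<in> chart_dom S x" "\<xi> = chart S x y" using \<xi> by blast
  have yS: "y \<in> points S" using premanifold_chart(2)[OF S x] y by blast
  let ?r = "\<lambda>w. a \<bullet> trep S S (\<lambda>z. z) y x y w"
  have lin: "linear ?r" by (rule linear_covector_of_coord[OF S x yS premanifold_chart(1)[OF S yS] y(1)])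
  have mem: "(y, ?r) \<in> chart_dom (cotangent S) (x, r0)" using y lin by (simp add: cotangent_simps)
  have "riesz (\<lambda>v. ?r (tcoord S x y v)) = a"
    by (rule riesz_unique[OF fd linear_covector_coord[OF S x y(1) lin]]) (simp add: tcoord_inverse(1)[OF S x y(1)])
  then have c: "chart (cotangent S) (x, r0) (y, ?r) = (\<xi>, a)" using y by (simp add: cotangent_simps)
  then show ?mem using mem by (metis imageI)
  show ?inv
    unfolding chart_inv_def[of "cotangent S"] c[symmetric] inv_into_f_f[OF \<open>?inj\<close> mem]
    using y by (simp add: chart_inv_chart[OF S x])
qed

lemma chart_cotangent_image:
  assumes S: "premanifold S" and x: "x \<in> points S" and X: "X \<subseteq> chart_dom S x"
  shows "chart (cotangent S) (x, r0) ` {(y, r). y \<in> X \<and> linear r} = chart S x ` X \<times> UNIV"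
proof safe
  fix y r assume "y \<in> X"
  then show "\<And>a b. (a, b) = chart (cotangent S) (x, r0) (y, r) \<Longrightarrow> a \<in> chart S x ` X" by (simp add: cotangent_simps)
next
  fix y a assume y: "y \<in> X"
  obtain z where z: "z \<in> chart_dom (cotangent S) (x, r0)" "(chart S x y, a) = chart (cotangent S) (x, r0) z"
    using chart_inv_cotangent(2)[OF S x] y X by blast
  obtain y' r where zz: "z = (y', r)" "y' \<in> chart_dom S x" "linear r" using z(1) by (auto simp: cotangent_simps)
  have "y' = y" using z(2) zz premanifold_chart(3)[OF S x] y X by (auto simp: cotangent_simps inj_on_def)
  then show "(chart S x y, a) \<in> chart (cotangent S) (x, r0) ` {(y, r). y \<in> X \<and> linear r}"
    using y z zz by (intro image_eqI[of _ _ z]) auto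
qed simp_all

text \<open>Covectors transform by the transpose of the derivative of the reverse coordinate change,
  the one from \<open>x'\<close> to \<open>x\<close>.\<close>

lemma cotangent_transition:
  assumes S: "premanifold S" and x: "x \<in> points S" and x': "x' \<in> points S"
    and y: "y \<in> chart_dom S x" "y \<in> chart_dom S x'"
  shows "(chart (cotangent S) (x', r1) \<circ> chart_inv (cotangent S) (x, r0)) (chart S x y, a)
    = (chart S x' y, riesz (\<lambda>v. a \<bullet> trep S S (\<lambda>z. z) x' x y v))"
proof -
  have yS: "y \<in> points S" using premanifold_chart(2)[OF S x] y by blast
  have "trep S S (\<lambda>z. z) y x y (tcoord S x' y v) = trep S S (\<lambda>z. z) x' x y v" for v
    using trep_compose[OF S S S smooth_map_ident[OF S] smooth_map_ident[OF S] x' yS x y(2) premanifold_chart(1)[OF S yS] y(1), of v]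
    by (simp add: tcoord_trep)
  then show ?thesis
    using y chart_inv_cotangent(1)[OF S x] by (simp add: cotangent_simps chart_inv_chart[OF S x])
qed

text \<open>Only the fibre part of a transition is at issue. Expanded in an orthonormal basis it is
  a finite sum whose coefficients pair the fibre vector with derivatives of the reverse coordinate
  change, and those are smooth in the base coordinate.\<close>

lemma premanifold_cotangent:
  fixes S :: "('m, 'e::real_inner) mfd"
  assumes S: "premanifold S"
  shows "premanifold (cotangent S)"
proof -
  note fd = premanifold_fdim[OF S]
  obtain B :: "'e set" where B: "finite B" "\<And>x. (\<Sum>b\<in>B. (x \<bullet> b) *\<^sub>R b) = x"
    using fdimE[OF fd] by metis
  have i: "chart_dom (cotangent S) (x, r) \<inter> chart_dom (cotangent S) (x', r')
    = {(y, r). y \<in> chart_dom S x \<inter> chart_dom S x' \<and> linear r}" for x r x' r'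
    by (auto simp: cotangent_simps)
  have o: "open (chart (cotangent S) (x, r) ` {(y, r). y \<in> chart_dom S x \<inter> chart_dom S x' \<and> linear r})"
    and s: "smooth_on (chart (cotangent S) (x, r) ` {(y, r). y \<in> chart_dom S x \<inter> chart_dom S x' \<and> linear r})
      (chart (cotangent S) (x', r') \<circ> chart_inv (cotangent S) (x, r))"
    if x: "x \<in> points S" and x': "x' \<in> points S" for x x' and r r' :: "'e \<Rightarrow> real"
  proof -
    let ?X = "chart_dom S x \<inter> chart_dom S x'" and ?D = "chart S x ` (chart_dom S x \<inter> chart_dom S x')"
    have oD: "open ?D" by (rule premanifold_transition(1)[OF S x x'])
    have im: "chart (cotangent S) (x, r) ` {(y, r). y \<in> ?X \<and> linear r} = ?D \<times> UNIV"
      by (rule chart_cotangent_image[OF S x]) simp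
    have oDU: "open (?D \<times> (UNIV :: 'e set))" by (intro open_Times oD open_UNIV)
    then show "open (chart (cotangent S) (x, r) ` {(y, r). y \<in> ?X \<and> linear r})" unfolding im .
    let ?t = "\<lambda>x x'. rep S S (\<lambda>z. z) x x'"
    have st: "smooth_on ?D (?t x x')"
      using premanifold_transition(2)[OF S x x'] by (simp add: comp_def)
    have "smooth_on (chart S x' ` (chart_dom S x' \<inter> chart_dom S x)) (?t x' x)"
      using premanifold_transition(2)[OF S x' x] by (simp add: comp_def)
    \<comment> \<open>The reverse coordinate change is differentiated at the image point, so its
      derivative must be composed with the forward change to become a function on
      \<open>?D\<close>.\<close>
    then have sb: "smooth_on ?D (\<lambda>\<xi>. frd (?t x' x) (?t x x' \<xi>) b)" for b
      by (intro smooth_on_compose[OF fd st smooth_on_frd oD]) (auto simp: chart_inv_chart[OF S x])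
    have lift: "smooth_on (?D \<times> (UNIV :: 'e set)) (\<lambda>z. g (fst z))" if "smooth_on ?D g" for g :: "'e \<Rightarrow> 'e"
      by (rule smooth_on_compose[OF fd smooth_on_bounded_linear[OF bounded_linear_fst] that oDU]) auto
    have "smooth_on (?D \<times> UNIV) (\<lambda>z. (?t x x' (fst z), \<Sum>b\<in>B. (snd z \<bullet> frd (?t x' x) (?t x x' (fst z)) b) *\<^sub>R b))"
      by (intro smooth_on_Pair lift st smooth_on_sum smooth_on_scaleR smooth_on_inner
          smooth_on_bounded_linear[OF bounded_linear_snd] lift[OF sb] smooth_on_const oDU)
    then have "smooth_on (?D \<times> UNIV) (chart (cotangent S) (x', r') \<circ> chart_inv (cotangent S) (x, r))"
    proof (rule smooth_on_cong[OF oDU, rotated])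
      fix z assume "z \<in> ?D \<times> (UNIV :: 'e set)"
      then obtain y a where y: "y \<in> chart_dom S x" "y \<in> chart_dom S x'" and z: "z = (chart S x y, a)" by auto
      have "riesz (\<lambda>v. a \<bullet> trep S S (\<lambda>z. z) x' x y v) = (\<Sum>b\<in>B. (a \<bullet> trep S S (\<lambda>z. z) x' x y b) *\<^sub>R b)"
        by (rule riesz_eq_sum[OF fd linear_covector_of_coord[OF S x x' y(2,1)] B])
      then show "(?t x x' (fst z), \<Sum>b\<in>B. (snd z \<bullet> frd (?t x' x) (?t x x' (fst z)) b) *\<^sub>R b)
        = (chart (cotangent S) (x', r') \<circ> chart_inv (cotangent S) (x, r)) z"
        unfolding z cotangent_transition[OF S x x' y] using y by (simp add: trep_def chart_inv_chart[OF S x])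
    qed
    then show "smooth_on (chart (cotangent S) (x, r) ` {(y, r). y \<in> ?X \<and> linear r})
      (chart (cotangent S) (x', r') \<circ> chart_inv (cotangent S) (x, r))" unfolding im .
  qed
  show ?thesis
    unfolding premanifold_def
  proof (intro conjI ballI)
    show "fdim TYPE('e \<times> 'e)" by (rule fdim_prod[OF fd fd])
    fix p assume "p \<in> points (cotangent S)"
    then obtain x r where p: "p = (x, r)" and x: "x \<in> points S" and r: "linear r" by (auto simp: cotangent_simps)
    show "p \<in> chart_dom (cotangent S) p" using x r premanifold_chart(1)[OF S x] by (simp add: p cotangent_simps)
    show "chart_dom (cotangent S) p \<subseteq> points (cotangent S)" using premanifold_chart(2)[OF S x] by (auto simp: p cotangent_simps)
    show "inj_on (chart (cotangent S) p) (chart_dom (cotangent S) p)"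
      unfolding p using chart_inv_cotangent(3)[OF S x, of "chart S x x"] premanifold_chart(1)[OF S x] by blast
    show "open (chart (cotangent S) p ` chart_dom (cotangent S) p)"
      using o[OF x x, of r] by (simp add: p cotangent_simps)
    fix q assume "q \<in> points (cotangent S)"
    then obtain x' r' where q: "q = (x', r')" and x': "x' \<in> points S" by (auto simp: cotangent_simps)
    show "open (chart (cotangent S) p ` (chart_dom (cotangent S) p \<inter> chart_dom (cotangent S) q))"
      unfolding p q i by (rule o[OF x x'])
    show "smooth_on (chart (cotangent S) p ` (chart_dom (cotangent S) p \<inter> chart_dom (cotangent S) q))
        (chart (cotangent S) q \<circ> chart_inv (cotangent S) p)"
      unfolding p q i by (rule s[OF x x'])
  qed
qed

lemma chart_image_cotangent:
  assumes S: "premanifold S" and x: "x \<in> points S"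
  shows "chart (cotangent S) (x, r0) ` chart_dom (cotangent S) (x, r0) = chart S x ` chart_dom S x \<times> UNIV"
  using chart_cotangent_image[OF S x, of "chart_dom S x" r0] by (simp add: cotangent_simps)

lemma smooth_map_cotangent_projection:
  fixes S :: "('m, 'e::real_inner) mfd"
  assumes S: "premanifold S"
  shows "smooth_map (cotangent S) S fst"
    and "\<And>x r0 y r w. x \<in> points S \<Longrightarrow> linear r0 \<Longrightarrow> y \<in> chart_dom S x \<Longrightarrow> linear r \<Longrightarrow>
      trep (cotangent S) S fst (x, r0) x (y, r) w = fst w"
proof -
  note K = premanifold_cotangent[OF S]
  have o: "open (chart S x ` chart_dom S x \<times> (UNIV :: 'e set))" if "x \<in> points S" for x
    by (intro open_Times premanifold_chart(4)[OF S that] open_UNIV)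
  have e: "fst z = rep (cotangent S) S fst (x, r0) x z"
    if x: "x \<in> points S" and z: "z \<in> chart S x ` chart_dom S x \<times> UNIV" for x r0 z
  proof -
    obtain y a where y: "y \<in> chart_dom S x" "z = (chart S x y, a)" using z by auto
    have "chart_inv (cotangent S) (x, r0) z = (y, snd (chart_inv (cotangent S) (x, r0) z))"
      using chart_inv_cotangent(1)[OF S x, of "chart S x y" r0 a] y by (simp add: chart_inv_chart[OF S x])
    then have "rep (cotangent S) S fst (x, r0) x z = chart S x y" by (metis comp_apply fst_conv)
    then show ?thesis using y by simp
  qed
  show "smooth_map (cotangent S) S fst"
  proof (rule smooth_mapI)
    fix p assume pp: "p \<in> points (cotangent S)"
    then obtain x r0 where p: "p = (x, r0)" and x: "x \<in> points S" by (auto simp: cotangent_simps)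
    show "fst p \<in> points S" using p x by simp
    have "smooth_on (chart (cotangent S) p ` chart_dom (cotangent S) p) (rep (cotangent S) S fst p (fst p))"
      unfolding p fst_conv chart_image_cotangent[OF S x]
      by (rule smooth_on_cong[OF o[OF x] e[OF x] smooth_on_bounded_linear[OF bounded_linear_fst]])
    moreover have "fst ` chart_dom (cotangent S) p \<subseteq> chart_dom S (fst p)" by (auto simp: p cotangent_simps)
    ultimately show "\<exists>X. mfd_open (cotangent S) X \<and> p \<in> X \<and> X \<subseteq> chart_dom (cotangent S) p \<and>
        fst ` X \<subseteq> chart_dom S (fst p) \<and> smooth_on (chart (cotangent S) p ` X) (rep (cotangent S) S fst p (fst p))"
      using mfd_open_chart_dom[OF K pp] premanifold_chart(1)[OF K pp] by blast
  qed
  show "trep (cotangent S) S fst (x, r0) x (y, r) w = fst w"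
    if x: "x \<in> points S" "linear r0" and y: "y \<in> chart_dom S x" "linear r" for x r0 y r w
  proof -
    have "trep (cotangent S) S fst (x, r0) x (y, r) = frd fst (chart (cotangent S) (x, r0) (y, r))"
      unfolding trep_def
      by (rule frd_cong[OF o[OF x(1)]]) (use y e[OF x(1)] in \<open>auto simp: cotangent_simps\<close>)
    then show ?thesis using frd_eqI[OF bounded_linear_imp_has_derivative[OF bounded_linear_fst]] by metis
  qed
qed

text \<open>The classical expression \<open>p dq\<close>: the fibre coordinate \<open>p\<close> is
  the Riesz vector of the covector in the frame of the chart at \<open>x\<close>.\<close>

lemma loc1_liouville:
  fixes S :: "('m, 'e::real_inner) mfd"
  assumes S: "premanifold S" and x: "x \<in> points S" "linear r0" and z: "z \<in> chart S x ` chart_dom S x \<times> UNIV"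
  shows "loc1 (cotangent S) (liouville S) (x, r0) z w = snd z \<bullet> fst w"
proof -
  note K = premanifold_cotangent[OF S]
  have p: "(x, r0) \<in> points (cotangent S)" using x by (simp add: cotangent_simps)
  obtain Y where Y: "Y \<in> chart_dom (cotangent S) (x, r0)" "z = chart (cotangent S) (x, r0) Y"
    using z chart_image_cotangent[OF S x(1), of r0] by blast
  then obtain y r where yr: "Y = (y, r)" "y \<in> chart_dom S x" "linear r" by (auto simp: cotangent_simps)
  have fY: "fst Y \<in> chart_dom S x" using yr by simp
  have "tmap (cotangent S) S fst Y (tcoord (cotangent S) (x, r0) Y w) = tcoord S x y (fst w)"
    using tcoord_trep_eq_tmap[OF K S smooth_map_cotangent_projection(1)[OF S] p x(1) Y(1) fY, of w]
      smooth_map_cotangent_projection(2)[OF S x yr(2,3), of w] by (simp add: yr(1))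
  then have "loc1 (cotangent S) (liouville S) (x, r0) z w = r (tcoord S x y (fst w))"
    using loc1_chart[OF K p Y(1), of "liouville S" w] Y(2) by (simp add: liouville_def yr(1))
  also have "\<dots> = riesz (\<lambda>v. r (tcoord S x y v)) \<bullet> fst w"
    by (rule riesz_inner[OF premanifold_fdim[OF S] linear_covector_coord[OF S x(1) yr(2,3)], symmetric])
  also have "\<dots> = snd z \<bullet> fst w" by (simp add: Y(2) yr(1) cotangent_simps)
  finally show ?thesis .
qed

lemma one_form_liouville:
  fixes S :: "('m, 'e::real_inner) mfd"
  assumes S: "premanifold S"
  shows "one_form (cotangent S) (liouville S)"
  unfolding one_form_def
proof (intro ballI conjI allI)
  fix p and w :: "'e \<times> 'e" assume pp: "p \<in> points (cotangent S)"
  then obtain x r where p: "p = (x, r)" and x: "x \<in> points S" "linear r" by (auto simp: cotangent_simps)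
  note K = premanifold_cotangent[OF S]
  have "linear (r \<circ> tmap (cotangent S) S fst p)"
    by (rule linear_compose[OF tmap_linear[OF K S smooth_map_cotangent_projection(1)[OF S] pp] x(2)])
  then show "linear (liouville S p)" by (simp add: liouville_def[abs_def] p comp_def)
  have o: "open (chart S x ` chart_dom S x \<times> (UNIV :: 'e set))"
    by (intro open_Times premanifold_chart(4)[OF S x(1)] open_UNIV)
  have "smooth_on (chart S x ` chart_dom S x \<times> UNIV) (\<lambda>z. snd z \<bullet> fst w)"
    by (intro smooth_on_inner smooth_on_bounded_linear[OF bounded_linear_snd] smooth_on_const o)
  then show "smooth_on (chart (cotangent S) p ` chart_dom (cotangent S) p) (\<lambda>z. loc1 (cotangent S) (liouville S) p z w)"
    unfolding p chart_image_cotangent[OF S x(1)]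
    by (rule smooth_on_cong[OF o, rotated]) (rule loc1_liouville[OF S x, symmetric])
qed

text \<open>The expression \<open>p dq\<close> holds throughout the chart image, so it may be
  differentiated there; the result is \<open>dp\<close> wedge \<open>dq\<close>.\<close>

lemma ext_deriv1_liouville:
  fixes S :: "('m, 'e::real_inner) mfd"
  assumes S: "premanifold S" and z: "z \<in> points (cotangent S)"
  shows "ext_deriv1 (cotangent S) (liouville S) z u v = snd u \<bullet> fst v - snd v \<bullet> fst u"
proof -
  obtain x r where p: "z = (x, r)" and x: "x \<in> points S" "linear r" using z by (auto simp: cotangent_simps)
  have o: "open (chart S x ` chart_dom S x \<times> (UNIV :: 'e set))"
    by (intro open_Times premanifold_chart(4)[OF S x(1)] open_UNIV)
  have c: "chart (cotangent S) z z \<in> chart S x ` chart_dom S x \<times> UNIV"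
    using premanifold_chart(1)[OF S x(1)] by (simp add: p cotangent_simps)
  have "frd (\<lambda>x. loc1 (cotangent S) (liouville S) z x w) (chart (cotangent S) z z) = (\<lambda>u. snd u \<bullet> fst w)" for w
  proof -
    have "frd (\<lambda>x. loc1 (cotangent S) (liouville S) z x w) (chart (cotangent S) z z)
      = frd (\<lambda>x. snd x \<bullet> fst w) (chart (cotangent S) z z)"
      by (rule frd_cong[OF o c]) (simp add: p loc1_liouville[OF S x])
    also have "\<dots> = (\<lambda>u. snd u \<bullet> fst w)"
      by (intro frd_eqI bounded_linear_imp_has_derivative bounded_linear_compose[OF bounded_linear_inner_left bounded_linear_snd])
    finally show ?thesis .
  qed
  then show ?thesis by (simp add: ext_deriv1_def)
qed

text \<open>With \<open>\<eta> = dL\<close> the map \<open>\<Phi>\<close> is the discrete Legendre transform, and subtracting the connection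
  term from \<open>\<eta>\<close> turns it into the reduced one.\<close>

lemma second_component_legendre:
  fixes M :: "('m, 'e::real_inner) mfd" and N :: "('n, 'f::real_inner) mfd"
  assumes M: "premanifold M" and N: "premanifold N" and V: "mfd_open (prod_mfd M N) V"
    and \<eta>: "one_form (open_sub (prod_mfd M N) V) \<eta>"
  defines "K \<equiv> open_sub (prod_mfd M N) V" and "\<Phi> \<equiv> \<lambda>z. (snd z, \<lambda>v. \<eta> z (0, v))"
  shows "smooth_map K (cotangent N) \<Phi>"
    and "\<And>z w. z \<in> V \<Longrightarrow> pull1 K (cotangent N) \<Phi> (liouville N) z w = \<eta> z (0, snd w)"
    and "one_form K (\<lambda>z w. \<eta> z (0, snd w))"
proof -
  note MN = premanifold_prod[OF M N] and T = premanifold_cotangent[OF N]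
  have K: "premanifold K" unfolding K_def by (rule premanifold_open_sub[OF MN V])
  have VN: "z \<in> points (prod_mfd M N)" if "z \<in> V" for z using mfd_open_subset[OF V] that by blast
  have snd_smooth: "smooth_map K N snd"
    unfolding K_def by (rule smooth_map_open_sub[OF MN V smooth_map_snd(1)[OF M N]])
  have \<eta>K: "one_form K \<eta>" using \<eta> by (simp add: K_def)
  have lin: "linear (\<lambda>v. \<eta> z (0, v))" if "z \<in> V" for z
  proof -
    have "linear (\<eta> z)" using one_form_linear[OF \<eta>] that by simp
    moreover have "linear (\<lambda>v :: 'f. (0 :: 'e, v))" by (rule linearI) auto
    ultimately have "linear (\<eta> z \<circ> (\<lambda>v. (0, v)))" by (rule linear_compose[rotated])
    then show ?thesis by (simp add: comp_def)
  qed
  obtain B :: "'f set" where B: "finite B" "\<And>x. (\<Sum>b\<in>B. (x \<bullet> b) *\<^sub>R b) = x"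
    using fdimE[OF premanifold_fdim[OF N]] by metis
  show s: "smooth_map K (cotangent N) \<Phi>"
  proof (rule smooth_mapI)
    fix p assume p: "p \<in> points K"
    then have pV: "p \<in> V" by (simp add: K_def)
    obtain a b where ab: "p = (a, b)" "a \<in> points M" "b \<in> points N" using VN[OF pV] by auto
    show "\<Phi> p \<in> points (cotangent N)" using ab lin[OF pV] by (simp add: \<Phi>_def cotangent_simps)
    let ?D = "chart K p ` chart_dom K p"
    have o: "open ?D" by (rule premanifold_chart(4)[OF K p])
    have dom: "snd y \<in> chart_dom N b" "y \<in> V" "y \<in> chart_dom (prod_mfd M N) p" if "y \<in> chart_dom K p" for y
      using that by (auto simp: K_def ab)
    have im: "snd ` chart_dom K p \<subseteq> chart_dom N (snd p)" using dom(1) ab by auto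
    \<comment> \<open>The coordinate change of a product acts factorwise, so vectors supported in
      the second factor stay there and the fibre coordinate becomes a component of the local
      expression of \<eta>.\<close>
    have e: "\<eta> y (0, tcoord N b (snd y) v) = loc1 K \<eta> p (chart K p y) (0, v)" if y: "y \<in> chart_dom K p" for y v
    proof -
      obtain c d where cd: "y = (c, d)" "c \<in> chart_dom M a" "d \<in> chart_dom N b" using dom(3)[OF y] by (auto simp: ab)
      have "tcoord K p y (0, v) = (tcoord M a c 0, tcoord N b d v)"
        using tcoord_open_sub[OF MN V pV dom(3,2)[OF y]] tcoord_prod[OF M N ab(2,3) cd(2,3), of "(0, v)"]
        by (simp add: K_def ab(1) cd(1))
      then show ?thesis
        using loc1_chart[OF K p y, of \<eta> "(0, v)"] linear_0[OF tcoord_linear[OF M ab(2) cd(2)]] by (simp add: cd(1))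
    qed
    have "smooth_on ?D (\<lambda>x. (rep K N snd p b x, \<Sum>i\<in>B. loc1 K \<eta> p x (0, i) *\<^sub>R i))"
    proof (intro smooth_on_Pair o smooth_on_sum smooth_on_scaleR smooth_on_const one_form_smooth[OF \<eta>K p])
      show "smooth_on ?D (rep K N snd p b)"
        by (rule smooth_on_subset[OF smooth_on_rep[OF K N snd_smooth p ab(3)]]) (use dom(1) in auto)
    qed
    then have "smooth_on ?D (rep K (cotangent N) \<Phi> p (\<Phi> p))"
    proof (rule smooth_on_cong[OF o, rotated])
      fix x assume "x \<in> ?D"
      then obtain y where y: "y \<in> chart_dom K p" "x = chart K p y" by blast
      have "riesz (\<lambda>v. \<eta> y (0, tcoord N b (snd y) v)) = (\<Sum>i\<in>B. \<eta> y (0, tcoord N b (snd y) i) *\<^sub>R i)"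
        by (rule riesz_eq_sum[OF premanifold_fdim[OF N] linear_covector_coord[OF N ab(3) dom(1)[OF y(1)] lin[OF dom(2)[OF y(1)]]] B])
      then show "(rep K N snd p b x, \<Sum>i\<in>B. loc1 K \<eta> p x (0, i) *\<^sub>R i) = rep K (cotangent N) \<Phi> p (\<Phi> p) x"
        using e[OF y(1)] chart_inv_chart[OF K p y(1)] by (simp add: y(2) \<Phi>_def ab cotangent_simps)
    qed
    moreover have "\<Phi> ` chart_dom K p \<subseteq> chart_dom (cotangent N) (\<Phi> p)"
      using dom lin by (auto simp: \<Phi>_def ab cotangent_simps)
    ultimately show "\<exists>X. mfd_open K X \<and> p \<in> X \<and> X \<subseteq> chart_dom K p \<and> \<Phi> ` X \<subseteq> chart_dom (cotangent N) (\<Phi> p) \<and>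
        smooth_on (chart K p ` X) (rep K (cotangent N) \<Phi> p (\<Phi> p))"
      using mfd_open_chart_dom[OF K p] premanifold_chart(1)[OF K p] by blast
  qed
  show pull: "pull1 K (cotangent N) \<Phi> (liouville N) z w = \<eta> z (0, snd w)" if z: "z \<in> V" for z w
  proof -
    have zK: "z \<in> points K" using z by (simp add: K_def)
    \<comment> \<open>The base point of \<open>\<Phi> z\<close> is \<open>snd z\<close>; hence the
      Liouville form sees only the second component of a vector.\<close>
    have "tmap (cotangent N) N fst (\<Phi> z) (tmap K (cotangent N) \<Phi> z w) = tmap K N (\<lambda>x. fst (\<Phi> x)) z w"
      by (rule tmap_compose[OF K T N s smooth_map_cotangent_projection(1)[OF N] zK, symmetric])
    also have "\<dots> = tmap K N snd z w" by (simp add: \<Phi>_def)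
    also have "\<dots> = snd w"
      unfolding K_def tmap_open_sub[OF MN V z] by (rule tmap_snd[OF M N]) (use VN[OF z] in auto)
    finally show ?thesis by (simp add: pull1_def liouville_def) (simp add: \<Phi>_def)
  qed
  show "one_form K (\<lambda>z w. \<eta> z (0, snd w))"
    by (rule one_form_cong[OF K one_form_pull1[OF K T s one_form_liouville[OF N]]]) (rule pull, simp add: K_def)
qed


section \<open>Partial derivatives and diffeomorphisms\<close>

text \<open>A slice through a point of \<open>V\<close> may leave \<open>V\<close>, so it is
  restricted to the preimage of \<open>V\<close>, which is an open neighbourhood of the base
  point.\<close>

lemma smooth_map_open_slice:
  assumes M: "premanifold M" and N: "premanifold N" and V: "mfd_open (prod_mfd M N) V" and z: "(a, b) \<in> V"
  shows "\<exists>X. mfd_open M X \<and> a \<in> X \<and> smooth_map (open_sub M X) (open_sub (prod_mfd M N) V) (\<lambda>x. (x, b)) \<and>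
      (\<forall>v. tmap (open_sub M X) (open_sub (prod_mfd M N) V) (\<lambda>x. (x, b)) a v = (v, 0))"
    and "\<exists>Y. mfd_open N Y \<and> b \<in> Y \<and> smooth_map (open_sub N Y) (open_sub (prod_mfd M N) V) (\<lambda>y. (a, y)) \<and>
      (\<forall>v. tmap (open_sub N Y) (open_sub (prod_mfd M N) V) (\<lambda>y. (a, y)) b v = (0, v))"
proof -
  note MN = premanifold_prod[OF M N]
  have ab: "a \<in> points M" "b \<in> points N" using mfd_open_subset[OF V] z by auto
  note i1 = smooth_map_Pair[OF M M N smooth_map_ident[OF M] smooth_map_const[OF M N ab(2)]]
  note i2 = smooth_map_Pair[OF N M N smooth_map_const[OF N M ab(1)] smooth_map_ident[OF N]]
  let ?X = "{x \<in> points M. (x, b) \<in> V}" and ?Y = "{y \<in> points N. (a, y) \<in> V}"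
  have X: "mfd_open M ?X" by (rule smooth_map_preimage[OF M MN i1 V])
  have Y: "mfd_open N ?Y" by (rule smooth_map_preimage[OF N MN i2 V])
  have "smooth_map (open_sub M ?X) (open_sub (prod_mfd M N) V) (\<lambda>x. (x, b))"
    using smooth_map_open_sub[OF M X i1] by (subst smooth_map_into_open_sub[OF V]) auto
  moreover have "tmap (open_sub M ?X) (open_sub (prod_mfd M N) V) (\<lambda>x. (x, b)) a v = (v, 0)" for v
  proof -
    have "a \<in> ?X" using z ab by simp
    then show ?thesis
      using tmap_Pair[OF M M N smooth_map_ident[OF M] smooth_map_const[OF M N ab(2)] ab(1), of v]
      by (simp add: tmap_open_sub[OF M X] tmap_ident[OF M ab(1)] tmap_const)
  qed
  ultimately show "\<exists>X. mfd_open M X \<and> a \<in> X \<and> smooth_map (open_sub M X) (open_sub (prod_mfd M N) V) (\<lambda>x. (x, b)) \<and>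
      (\<forall>v. tmap (open_sub M X) (open_sub (prod_mfd M N) V) (\<lambda>x. (x, b)) a v = (v, 0))"
    using X z ab by (intro exI[of _ ?X]) auto
  have "smooth_map (open_sub N ?Y) (open_sub (prod_mfd M N) V) (\<lambda>y. (a, y))"
    using smooth_map_open_sub[OF N Y i2] by (subst smooth_map_into_open_sub[OF V]) auto
  moreover have "tmap (open_sub N ?Y) (open_sub (prod_mfd M N) V) (\<lambda>y. (a, y)) b v = (0, v)" for v
  proof -
    have "b \<in> ?Y" using z ab by simp
    then show ?thesis
      using tmap_Pair[OF N M N smooth_map_const[OF N M ab(1)] smooth_map_ident[OF N] ab(2), of v]
      by (simp add: tmap_open_sub[OF N Y] tmap_ident[OF N ab(2)] tmap_const)
  qed
  ultimately show "\<exists>Y. mfd_open N Y \<and> b \<in> Y \<and> smooth_map (open_sub N Y) (open_sub (prod_mfd M N) V) (\<lambda>y. (a, y)) \<and>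
      (\<forall>v. tmap (open_sub N Y) (open_sub (prod_mfd M N) V) (\<lambda>y. (a, y)) b v = (0, v))"
    using Y z ab by (intro exI[of _ ?Y]) auto
qed

text \<open>The chain rule along the slices. It replaces partial derivatives by one tangent map,
  whose exterior derivative is available.\<close>

lemma slot_eq_tmap:
  assumes M: "premanifold M" and V: "mfd_open (prod_mfd M M) V"
    and f: "smooth_map (open_sub (prod_mfd M M) V) vec_mfd f" and z: "z \<in> V"
  shows "slot1 M f z v = tmap (open_sub (prod_mfd M M) V) vec_mfd f z (v, 0)"
    and "slot2 M f z v = tmap (open_sub (prod_mfd M M) V) vec_mfd f z (0, v)"
proof -
  let ?K = "open_sub (prod_mfd M M) V"
  obtain a b where ab: "z = (a, b)" by (cases z)
  have K: "premanifold ?K" by (rule premanifold_open_sub[OF premanifold_prod[OF M M] V])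
  obtain X where X: "mfd_open M X" "a \<in> X" "smooth_map (open_sub M X) ?K (\<lambda>x. (x, b))"
    "\<And>v. tmap (open_sub M X) ?K (\<lambda>x. (x, b)) a v = (v, 0)"
    using smooth_map_open_slice(1)[OF M M V z[unfolded ab]] by blast
  have aX: "a \<in> points (open_sub M X)" using X(2) by simp
  show "slot1 M f z v = tmap ?K vec_mfd f z (v, 0)"
    using tmap_compose[OF premanifold_open_sub[OF M X(1)] K premanifold_real X(3) f aX, of v]
    by (simp only: slot1_def ab fst_conv snd_conv tmap_open_sub[OF M X(1,2)] X(4)[unfolded tmap_open_sub[OF M X(1,2)]])
  obtain Y where Y: "mfd_open M Y" "b \<in> Y" "smooth_map (open_sub M Y) ?K (\<lambda>y. (a, y))"
    "\<And>v. tmap (open_sub M Y) ?K (\<lambda>y. (a, y)) b v = (0, v)"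
    using smooth_map_open_slice(2)[OF M M V z[unfolded ab]] by blast
  have bY: "b \<in> points (open_sub M Y)" using Y(2) by simp
  show "slot2 M f z v = tmap ?K vec_mfd f z (0, v)"
    using tmap_compose[OF premanifold_open_sub[OF M Y(1)] K premanifold_real Y(3) f bY, of v]
    by (simp only: slot2_def ab fst_conv snd_conv tmap_open_sub[OF M Y(1,2)] Y(4)[unfolded tmap_open_sub[OF M Y(1,2)]])
qed

lemma diffeo_tmap_inverse:
  assumes M: "premanifold M" and N: "premanifold N" and f: "diffeo M N f" and p: "p \<in> points M"
  shows "tmap N M (inv_into (points M) f) (f p) (tmap M N f p u) = u"
    and "tmap M N f p (tmap N M (inv_into (points M) f) (f p) v) = v"
proof -
  let ?g = "inv_into (points M) f"
  have bij: "bij_betw f (points M) (points N)" and sf: "smooth_map M N f" and sg: "smooth_map N M ?g"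
    using f by (auto simp: diffeo_def)
  have gf: "?g (f x) = x" if "x \<in> points M" for x using bij_betw_inv_into_left[OF bij that] .
  have fg: "f (?g y) = y" if "y \<in> points N" for y using bij_betw_inv_into_right[OF bij that] .
  have fp: "f p \<in> points N" using smooth_map_points[OF sf p] .
  have "tmap M M (\<lambda>x. ?g (f x)) p u = u"
    using tmap_cong[OF M p mfd_open_points[OF M] p, of "\<lambda>x. ?g (f x)" "\<lambda>x. x" M] gf tmap_ident[OF M p] by simp
  then show "tmap N M ?g (f p) (tmap M N f p u) = u"
    using tmap_compose[OF M N M sf sg p, of u] by simp
  have "tmap N N (\<lambda>x. f (?g x)) (f p) v = v"
    using tmap_cong[OF N fp mfd_open_points[OF N] fp, of "\<lambda>x. f (?g x)" "\<lambda>x. x" N] fg tmap_ident[OF N fp] by simp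
  then show "tmap M N f p (tmap N M ?g (f p) v) = v"
    using tmap_compose[OF N M N sg sf fp, of v] gf[OF p] by simp
qed

text \<open>The smooth local inverse has a tangent map that undoes the one of
  \<open>f\<close>.\<close>

lemma local_diffeo_tmap_inj:
  assumes M: "premanifold M" and N: "premanifold N" and f: "local_diffeo M N f" and p: "p \<in> points M"
    and u: "tmap M N f p u = 0"
  shows "u = 0"
proof -
  obtain X where X: "mfd_open M X" "p \<in> X" "mfd_open N (f ` X)" "diffeo (open_sub M X) (open_sub N (f ` X)) f"
    using f p unfolding local_diffeo_def openin_mfd_top by blast
  note MX = premanifold_open_sub[OF M X(1)] and NX = premanifold_open_sub[OF N X(3)]
  have pX: "p \<in> points (open_sub M X)" using X(2) by simp
  let ?g = "tmap (open_sub N (f ` X)) (open_sub M X) (inv_into (points (open_sub M X)) f) (f p)"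
  have s: "smooth_map (open_sub N (f ` X)) (open_sub M X) (inv_into (points (open_sub M X)) f)"
    using X(4) by (simp add: diffeo_def)
  have "u = ?g (tmap (open_sub M X) (open_sub N (f ` X)) f p u)"
    by (rule diffeo_tmap_inverse(1)[OF MX NX X(4) pX, symmetric])
  also have "\<dots> = ?g 0" by (simp add: tmap_open_sub[OF M X(1,2)] u)
  also have "\<dots> = 0" by (rule linear_0[OF tmap_linear[OF NX MX s]]) (use X(2) in simp)
  finally show ?thesis .
qed

text \<open>Obtained by differentiating \<open>f (s x) = x\<close>; it supplies the lifts of tangent
  vectors along the bundle projections.\<close>

lemma tmap_section:
  assumes M: "premanifold M" and B: "premanifold B" and f: "smooth_map M B f"
    and X: "mfd_open B X" "b \<in> X" and s: "smooth_map (open_sub B X) M s" and fs: "\<And>x. x \<in> X \<Longrightarrow> f (s x) = x"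
  shows "tmap M B f (s b) (tmap (open_sub B X) M s b w) = w"
proof -
  note BX = premanifold_open_sub[OF B X(1)]
  have b: "b \<in> points (open_sub B X)" using X(2) by simp
  have bB: "b \<in> points B" using mfd_open_subset[OF X(1)] X(2) by blast
  have "tmap M B f (s b) (tmap (open_sub B X) M s b w) = tmap (open_sub B X) B (\<lambda>x. f (s x)) b w"
    by (rule tmap_compose[OF BX M B s f b, symmetric])
  also have "\<dots> = tmap (open_sub B X) B (\<lambda>x. x) b w"
    using tmap_cong[OF BX b mfd_open_points[OF BX] b, of "\<lambda>x. f (s x)" "\<lambda>x. x" B] fs by simp
  also have "\<dots> = w" by (rule tmap_inclusion[OF B X])
  finally show ?thesis .
qed


section \<open>Principal bundles\<close>

text \<open>Only the pointwise laws of an action. \<open>group_action\<close> also makes each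
  \<open>act g\<close> extensional on its set, which cannot be expected of the diagonal action
  restricted to \<open>U\<close>.\<close>

definition action_on :: "('g, 'x) monoid_scheme \<Rightarrow> 'm set \<Rightarrow> ('g \<Rightarrow> 'm \<Rightarrow> 'm) \<Rightarrow> bool" where
  "action_on G E act \<longleftrightarrow> (\<forall>x\<in>E. act \<one>\<^bsub>G\<^esub> x = x \<and>
     (\<forall>g\<in>carrier G. act g x \<in> E \<and> (\<forall>h\<in>carrier G. act (g \<otimes>\<^bsub>G\<^esub> h) x = act g (act h x))))"

lemma group_action_action_on:
  assumes "group_action G E act"
  shows "action_on G E act"
  unfolding action_on_def
proof (intro ballI conjI)
  fix x assume x: "x \<in> E"
  then show "act \<one>\<^bsub>G\<^esub> x = x" using fun_cong[OF group_action.id_eq_one[OF assms], of x] by simp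
  fix g assume g: "g \<in> carrier G"
  show "act g x \<in> E" by (rule group_action.element_image[OF assms g x refl])
  show "act (g \<otimes>\<^bsub>G\<^esub> h) x = act g (act h x)" if "h \<in> carrier G" for h
    by (rule group_action.composition_rule[OF assms x g that])
qed

lemma action_on_orbit:
  assumes G: "group G" and act: "action_on G E act" and x: "x \<in> E" and g: "g \<in> carrier G"
  shows "orbit G act (act g x) = orbit G act x"
proof -
  interpret group G by (rule G)
  have comp: "act (h \<otimes>\<^bsub>G\<^esub> k) x = act h (act k x)" if "h \<in> carrier G" "k \<in> carrier G" for h k
    using act x that unfolding action_on_def by blast
  show ?thesis
    unfolding orbit_def
  proof safe
    fix h assume h: "h \<in> carrier G"
    show "\<exists>k. act h (act g x) = act k x \<and> k \<in> carrier G"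
      using comp[OF h g] h g by (intro exI[of _ "h \<otimes>\<^bsub>G\<^esub> g"]) simp
    show "\<exists>k. act h x = act k (act g x) \<and> k \<in> carrier G"
      using comp[of "h \<otimes>\<^bsub>G\<^esub> inv\<^bsub>G\<^esub> g" g] h g
      by (intro exI[of _ "h \<otimes>\<^bsub>G\<^esub> inv\<^bsub>G\<^esub> g"]) (simp add: m_assoc)
  qed
qed

text \<open>Used for two bundles: \<open>Q\<close> over \<open>S\<close>, and \<open>U\<close> with
  the diagonal action over its orbit space. For this reason freeness and local structure enter
  through the trivializations of \<open>quotient_manifold\<close>.\<close>

locale principal_bundle =
  fixes G :: "('g, 'x) monoid_scheme" and GM :: "('g, 'l::real_inner) mfd"
    and M :: "('m, 'e::real_inner) mfd" and act :: "'g \<Rightarrow> 'm \<Rightarrow> 'm" and B :: "('m set, 's::real_inner) mfd"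
  assumes lie: "lie_group G GM" and M: "premanifold M" and act: "action_on G (points M) act"
    and quotient: "quotient_manifold G GM M act B"
begin

lemma group: "group G"
  using lie by (simp add: lie_group_def)

lemma GM: "premanifold GM"
  using lie by (simp add: lie_group_def smooth_manifold_premanifold)

lemma points_GM: "points GM = carrier G"
  using lie by (simp add: lie_group_def)

lemma B: "premanifold B"
  using quotient by (simp add: quotient_manifold_def smooth_manifold_premanifold)

lemma points_B: "points B = orbits G (points M) act"
  using quotient by (simp add: quotient_manifold_def)

lemma proj_smooth: "smooth_map M B (orbit G act)"
  using quotient by (simp add: quotient_manifold_def)

lemma one_carrier: "\<one>\<^bsub>G\<^esub> \<in> carrier G"
  using group.is_monoid[OF group] by (rule monoid.one_closed)

lemma act_one: "x \<in> points M \<Longrightarrow> act \<one>\<^bsub>G\<^esub> x = x"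
  using act by (simp add: action_on_def)

lemma act_mult: "x \<in> points M \<Longrightarrow> g \<in> carrier G \<Longrightarrow> h \<in> carrier G \<Longrightarrow> act (g \<otimes>\<^bsub>G\<^esub> h) x = act g (act h x)"
  using act by (simp add: action_on_def)

lemma orbit_act: "x \<in> points M \<Longrightarrow> g \<in> carrier G \<Longrightarrow> orbit G act (act g x) = orbit G act x"
  by (rule action_on_orbit[OF group act])

lemma right_translation_smooth:
  assumes g: "g \<in> carrier G"
  shows "smooth_map GM GM (\<lambda>h. h \<otimes>\<^bsub>G\<^esub> g)"
proof -
  have m: "smooth_map (prod_mfd GM GM) GM (\<lambda>(g, h). g \<otimes>\<^bsub>G\<^esub> h)" using lie by (simp add: lie_group_def)
  have "smooth_map GM GM (\<lambda>h. (\<lambda>(g, h). g \<otimes>\<^bsub>G\<^esub> h) (h, g))"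
    by (rule smooth_map_compose[OF GM premanifold_prod[OF GM GM] GM
          smooth_map_Pair[OF GM GM GM smooth_map_ident[OF GM] smooth_map_const[OF GM GM]] m])
      (simp add: points_GM g)
  then show ?thesis by simp
qed

text \<open>The trivialization is onto the part of \<open>M\<close> above \<open>X\<close>, so
  \<open>z\<close> is a translate of some \<open>\<sigma> x\<close>; applying the projection
  identifies \<open>x\<close> with the orbit of \<open>z\<close>.\<close>

lemma trivialization:
  assumes z: "z \<in> points M"
  obtains X \<sigma> g where "mfd_open B X" "orbit G act z \<in> X" "smooth_map (open_sub B X) M \<sigma>"
    "\<forall>x\<in>X. orbit G act (\<sigma> x) = x" "mfd_open M {q \<in> points M. orbit G act q \<in> X}"
    "diffeo (prod_mfd GM (open_sub B X)) (open_sub M {q \<in> points M. orbit G act q \<in> X}) (\<lambda>(g, x). act g (\<sigma> x))"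
    "g \<in> carrier G" "act g (\<sigma> (orbit G act z)) = z"
proof -
  have "orbit G act z \<in> points B" using z by (auto simp: points_B orbits_def)
  then obtain X \<sigma> where X: "mfd_open B X" "orbit G act z \<in> X" "smooth_map (open_sub B X) M \<sigma>"
    "\<forall>x\<in>X. orbit G act (\<sigma> x) = x"
    and d: "diffeo (prod_mfd GM (open_sub B X)) (open_sub M {q \<in> points M. orbit G act q \<in> X}) (\<lambda>(g, x). act g (\<sigma> x))"
    using quotient unfolding quotient_manifold_def openin_mfd_top by blast
  have "z \<in> (\<lambda>(g, x). act g (\<sigma> x)) ` (points GM \<times> X)"
    using d z X(2) unfolding diffeo_def bij_betw_def by simp
  then obtain g x where g: "g \<in> carrier G" "x \<in> X" "z = act g (\<sigma> x)" by (auto simp: points_GM)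
  have "\<sigma> x \<in> points M" using smooth_map_points[OF X(3), of x] g(2) by simp
  then have "orbit G act z = x" using orbit_act[of "\<sigma> x" g] X(4) g by simp
  then show ?thesis
    using that[OF X smooth_map_preimage[OF M B proj_smooth X(1)] d g(1)] g(3) by simp
qed

text \<open>The section of a trivialization is translated by the group element that moves its value
  at the orbit of \<open>z\<close> to \<open>z\<close>.\<close>

lemma local_section:
  assumes z: "z \<in> points M"
  obtains X s where "mfd_open B X" "orbit G act z \<in> X" "smooth_map (open_sub B X) M s"
    "\<forall>x\<in>X. orbit G act (s x) = x" "s (orbit G act z) = z"
proof -
  obtain X \<sigma> g where X: "mfd_open B X" "orbit G act z \<in> X" "smooth_map (open_sub B X) M \<sigma>"
    "\<forall>x\<in>X. orbit G act (\<sigma> x) = x" and Z: "mfd_open M {q \<in> points M. orbit G act q \<in> X}"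
    and d: "diffeo (prod_mfd GM (open_sub B X)) (open_sub M {q \<in> points M. orbit G act q \<in> X}) (\<lambda>(g, x). act g (\<sigma> x))"
    and g: "g \<in> carrier G" "act g (\<sigma> (orbit G act z)) = z"
    by (rule trivialization[OF z])
  note BX = premanifold_open_sub[OF B X(1)] and MZ = premanifold_open_sub[OF M Z]
  have s: "smooth_map (prod_mfd GM (open_sub B X)) (open_sub M {q \<in> points M. orbit G act q \<in> X}) (\<lambda>(g, x). act g (\<sigma> x))"
    using d by (simp add: diffeo_def)
  have "smooth_map (open_sub B X) (open_sub M {q \<in> points M. orbit G act q \<in> X}) (\<lambda>x. (\<lambda>(g, x). act g (\<sigma> x)) (g, x))"
    by (rule smooth_map_compose[OF BX premanifold_prod[OF GM BX] MZ
          smooth_map_Pair[OF BX GM BX smooth_map_const[OF BX GM] smooth_map_ident[OF BX]] s])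
      (simp add: points_GM g)
  then have "smooth_map (open_sub B X) (open_sub M {q \<in> points M. orbit G act q \<in> X}) (\<lambda>x. act g (\<sigma> x))"
    by simp
  then have "smooth_map (open_sub B X) M (\<lambda>x. act g (\<sigma> x))"
    by (rule smooth_map_into_open_sub[OF Z, THEN iffD1, THEN conjunct1])
  moreover have "orbit G act (act g (\<sigma> x)) = x" if "x \<in> X" for x
    using orbit_act[OF _ g(1), of "\<sigma> x"] smooth_map_points[OF X(3), of x] X(4) that by simp
  ultimately show ?thesis using that[OF X(1,2)] g(2) by blast
qed

text \<open>In a trivialization the orbit map is a right translation in the group factor. A vector
  killed by the projection has no base component there, so it comes from the group factor, and right
  translation carries that component back to the identity.\<close>

lemma orbit_map_smooth:
  assumes z: "z \<in> points M"
  shows "smooth_map GM M (\<lambda>g. act g z)"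
    and "\<And>v. tmap M B (orbit G act) z v = 0 \<Longrightarrow> \<exists>\<xi>. inf_gen G GM M act \<xi> z = v"
proof -
  interpret group G by (rule group)
  obtain X \<sigma> g where X: "mfd_open B X" "orbit G act z \<in> X" "smooth_map (open_sub B X) M \<sigma>"
    "\<forall>x\<in>X. orbit G act (\<sigma> x) = x" and Z: "mfd_open M {q \<in> points M. orbit G act q \<in> X}"
    and d: "diffeo (prod_mfd GM (open_sub B X)) (open_sub M {q \<in> points M. orbit G act q \<in> X}) (\<lambda>(g, x). act g (\<sigma> x))"
    and g: "g \<in> carrier G" "act g (\<sigma> (orbit G act z)) = z"
    by (rule trivialization[OF z])
  define Z where "Z = {q \<in> points M. orbit G act q \<in> X}"
  define b where "b = orbit G act z"
  define K where "K = prod_mfd GM (open_sub B X)"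
  define \<Phi> where "\<Phi> = (\<lambda>(g, x). act g (\<sigma> x))"
  note BX = premanifold_open_sub[OF B X(1)]
  note ZM = \<open>mfd_open M {q \<in> points M. orbit G act q \<in> X}\<close>[folded Z_def]
  note MZ = premanifold_open_sub[OF M ZM]
  have K: "premanifold K" unfolding K_def by (rule premanifold_prod[OF GM BX])
  have d: "diffeo K (open_sub M Z) \<Phi>" using d by (simp add: K_def Z_def \<Phi>_def)
  have sZ: "smooth_map K (open_sub M Z) \<Phi>" using d by (simp add: diffeo_def)
  have s: "smooth_map K M \<Phi>" using sZ smooth_map_into_open_sub[OF ZM] by blast
  have bX: "b \<in> X" using X(2) by (simp add: b_def)
  have \<sigma>M: "\<sigma> x \<in> points M" if "x \<in> X" for x using smooth_map_points[OF X(3), of x] that by simp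
  \<comment> \<open>Since \<open>z\<close> is \<open>act g (\<sigma> b)\<close>, acting by
    \<open>h\<close> on \<open>z\<close> replaces the group coordinate \<open>g\<close> by the
    product of \<open>h\<close> and \<open>g\<close> and fixes the base coordinate.\<close>
  have j: "smooth_map GM K (\<lambda>h. (h \<otimes>\<^bsub>G\<^esub> g, b))"
    unfolding K_def
    by (rule smooth_map_Pair[OF GM GM BX right_translation_smooth[OF g(1)] smooth_map_const[OF GM BX]]) (simp add: bX)
  have eq: "\<Phi> (h \<otimes>\<^bsub>G\<^esub> g, b) = act h z" if "h \<in> points GM" for h
    using that g act_mult[OF \<sigma>M[OF bX], of h g] by (simp add: \<Phi>_def b_def points_GM)
  show "smooth_map GM M (\<lambda>g. act g z)"
    by (rule smooth_map_cong[OF GM smooth_map_compose[OF GM K M j s] eq])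
  fix v assume v: "tmap M B (orbit G act) z v = 0"
  have p: "(g, b) \<in> points K" using g(1) bX by (simp add: K_def points_GM)
  have \<Phi>p: "\<Phi> (g, b) = z" using g(2) by (simp add: \<Phi>_def b_def)
  obtain w where w: "tmap K M \<Phi> (g, b) w = v"
    using diffeo_tmap_inverse(2)[OF K MZ d p, of v] by auto
  have "tmap M B (orbit G act) z v = tmap K B (\<lambda>x. orbit G act (\<Phi> x)) (g, b) w"
    using tmap_compose[OF K M B s proj_smooth p, of w] by (simp add: \<Phi>p w)
  also have "\<dots> = tmap K B snd (g, b) w"
  proof -
    have "orbit G act (\<Phi> x) = snd x" if "x \<in> points K" for x
      using that orbit_act[OF \<sigma>M, of "snd x" "fst x"] X(4) by (auto simp: K_def \<Phi>_def points_GM)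
    then show ?thesis using tmap_cong[OF K p mfd_open_points[OF K] p, of "\<lambda>x. orbit G act (\<Phi> x)" snd B] by simp
  qed
  also have "\<dots> = snd w"
    using tmap_snd[OF GM BX, of "(g, b)" w] p by (simp add: K_def)
  finally have w0: "snd w = 0" using v by simp
  let ?R = "tmap GM GM (\<lambda>h. h \<otimes>\<^bsub>G\<^esub> g) \<one>\<^bsub>G\<^esub>"
  \<comment> \<open>The group component of \<open>w\<close> is tangent at \<open>g\<close>; right
    translation by the inverse of \<open>g\<close> makes it an element of the Lie algebra.\<close>
  define \<xi> where "\<xi> = tmap GM GM (\<lambda>h. h \<otimes>\<^bsub>G\<^esub> inv\<^bsub>G\<^esub> g) g (fst w)"
  have gG: "g \<in> points GM" "\<one>\<^bsub>G\<^esub> \<in> points GM" using g(1) by (simp_all add: points_GM)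
  have "?R \<xi> = tmap GM GM (\<lambda>h. h \<otimes>\<^bsub>G\<^esub> inv\<^bsub>G\<^esub> g \<otimes>\<^bsub>G\<^esub> g) g (fst w)"
    using tmap_compose[OF GM GM GM right_translation_smooth[of "inv\<^bsub>G\<^esub> g"] right_translation_smooth[OF g(1)] gG(1), of "fst w"] g(1)
    by (simp add: \<xi>_def)
  also have "\<dots> = tmap GM GM (\<lambda>h. h) g (fst w)"
    using tmap_cong[OF GM gG(1) mfd_open_points[OF GM] gG(1), of "\<lambda>h. h \<otimes>\<^bsub>G\<^esub> inv\<^bsub>G\<^esub> g \<otimes>\<^bsub>G\<^esub> g" "\<lambda>h. h" GM] g(1)
    by (simp add: points_GM m_assoc)
  finally have R: "?R \<xi> = fst w" by (simp add: tmap_ident[OF GM gG(1)])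
  have "inf_gen G GM M act \<xi> z = tmap GM M (\<lambda>h. \<Phi> (h \<otimes>\<^bsub>G\<^esub> g, b)) \<one>\<^bsub>G\<^esub> \<xi>"
    unfolding inf_gen_def
    using tmap_cong[OF GM gG(2) mfd_open_points[OF GM] gG(2), of "\<lambda>h. act h z" "\<lambda>h. \<Phi> (h \<otimes>\<^bsub>G\<^esub> g, b)" M] eq
    by simp
  also have "\<dots> = tmap K M \<Phi> (g, b) (tmap GM K (\<lambda>h. (h \<otimes>\<^bsub>G\<^esub> g, b)) \<one>\<^bsub>G\<^esub> \<xi>)"
    using tmap_compose[OF GM K M j s gG(2), of \<xi>] g(1) by simp
  also have "tmap GM K (\<lambda>h. (h \<otimes>\<^bsub>G\<^esub> g, b)) \<one>\<^bsub>G\<^esub> \<xi> = (?R \<xi>, 0)"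
    unfolding K_def
    using tmap_Pair[OF GM GM BX right_translation_smooth[OF g(1)] smooth_map_const[OF GM BX] gG(2), of b \<xi>] bX
    by (simp add: tmap_const)
  also have "(?R \<xi>, 0) = w" using R w0 by (simp add: prod_eq_iff)
  finally show "\<exists>\<xi>. inf_gen G GM M act \<xi> z = v" using w by blast
qed

text \<open>The projection is constant along the orbit map.\<close>

lemma tmap_proj_inf_gen:
  assumes z: "z \<in> points M"
  shows "tmap M B (orbit G act) z (inf_gen G GM M act \<xi> z) = 0"
proof -
  have o: "\<one>\<^bsub>G\<^esub> \<in> points GM" using one_carrier by (simp add: points_GM)
  have "tmap M B (orbit G act) z (inf_gen G GM M act \<xi> z) = tmap GM B (\<lambda>g. orbit G act (act g z)) \<one>\<^bsub>G\<^esub> \<xi>"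
    using tmap_compose[OF GM M B orbit_map_smooth(1)[OF z] proj_smooth o, of \<xi>] act_one[OF z]
    by (simp add: inf_gen_def)
  also have "\<dots> = tmap GM B (\<lambda>g. orbit G act z) \<one>\<^bsub>G\<^esub> \<xi>"
    using tmap_cong[OF GM o mfd_open_points[OF GM] o, of "\<lambda>g. orbit G act (act g z)" "\<lambda>g. orbit G act z" B]
      orbit_act[OF z] by (simp add: points_GM)
  finally show ?thesis by (simp add: tmap_const)
qed

end


section \<open>Discrete Routh reduction\<close>

locale discrete_routh =
  fixes G :: "('g, 'x) monoid_scheme"
    and GM :: "('g, 'l::real_inner) mfd"
    and Q :: "('q, 'e::real_inner) mfd"
    and act :: "'g \<Rightarrow> 'q \<Rightarrow> 'q"
    and S :: "('q set, 's::real_inner) mfd"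
    and L :: "'q \<times> 'q \<Rightarrow> real"
    and \<mu> :: "'l \<Rightarrow> real"
    and Onb :: "('q \<times> 'q) set"
    and P :: "('q \<times> 'q, 'p::real_inner) mfd"
    and U :: "('q \<times> 'q) set"
    and UG :: "(('q \<times> 'q) set, 'u::real_inner) mfd"
    and V :: "('q set \<times> 'q set) set"
    and \<phi>\<mu> :: "('q \<times> 'q) set \<Rightarrow> 'q set \<times> 'q set"
    and Lh :: "'q set \<times> 'q set \<Rightarrow> real"
    and \<AA> :: "'q \<Rightarrow> 'e \<Rightarrow> 'l"
    and \<beta> :: "'q set \<Rightarrow> 's \<Rightarrow> 's \<Rightarrow> real"
    and Ah :: "'q set \<times> 'q set \<Rightarrow> 's \<times> 's \<Rightarrow> real"
    and W :: "('q set \<times> 'q set) set"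
    and F :: "'q set \<times> 'q set \<Rightarrow> 'q set \<times> 'q set"
  assumes lie: "lie_group G GM"
    and Q: "smooth_manifold Q"
    and action: "smooth_action G GM Q act"
    and S: "quotient_manifold G GM Q act S"
    and L_smooth: "smooth_map (prod_mfd Q Q) vec_mfd L"
    and L_invariant: "\<forall>g\<in>carrier G. \<forall>z\<in>points (prod_mfd Q Q). L (diag_act act g z) = L z"
    and \<mu>: "linear \<mu>"
    and Onb: "openin (mfd_top (prod_mfd Q Q)) Onb"
      "local_diffeo (open_sub (prod_mfd Q Q) Onb) (cotangent Q) (discrete_legendre Q L)"
    and P: "embedded_submanifold P (prod_mfd Q Q)"
      "points P = {z \<in> points (prod_mfd Q Q). momentum G GM Q act L z = \<mu>} \<inter> Onb"
    and U: "openin (mfd_top P) U" "invariant_set G (diag_act act) U"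
    and UG: "quotient_manifold G GM (open_sub P U) (diag_act act) UG"
    and V: "openin (mfd_top (prod_mfd S S)) V"
    and \<phi>\<mu>: "\<forall>z\<in>U. \<phi>\<mu> (orbit G (diag_act act) z) = pair_proj G act z"
      "diffeo UG (open_sub (prod_mfd S S) V) \<phi>\<mu>"
    and Lh: "\<forall>z\<in>U. Lh (pair_proj G act z) = L z"
    and connection: "principal_connection G GM Q act \<AA>"
    and \<beta>: "two_form S \<beta>"
      "\<forall>q\<in>points Q. \<forall>u v. pull2 Q S (orbit G act) \<beta> q u v = ext_deriv1 Q (mu_form \<mu> \<AA>) q u v"
    and Ah: "one_form (open_sub (prod_mfd S S) V) Ah"
      "\<forall>z\<in>U. \<forall>w. pull1 (open_sub P U) (open_sub (prod_mfd S S) V) (pair_proj G act) Ah z w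
         = pull1 (open_sub P U) (prod_mfd Q Q) (\<lambda>z. z) (diff_form Q (mu_form \<mu> \<AA>)) z w"
    and F: "DR_flow_map S V Lh Ah W F"
begin

abbreviation "A \<equiv> mu_form \<mu> \<AA>"
abbreviation "QQ \<equiv> prod_mfd Q Q"
abbreviation "SS \<equiv> prod_mfd S S"
abbreviation "VM \<equiv> open_sub SS V"
abbreviation "PU \<equiv> open_sub P U"
abbreviation "OM \<equiv> open_sub QQ Onb"
abbreviation "pr \<equiv> pair_proj G act"
abbreviation "orb \<equiv> orbit G act"

section \<open>Manifolds, bundles and tangent maps of the reduction setting\<close>

lemma pmQ: "premanifold Q" and pmS: "premanifold S" and pmP: "premanifold P" and pmUG: "premanifold UG"
  using Q S P(1) UG by (simp_all add: quotient_manifold_def embedded_submanifold_def smooth_manifold_premanifold)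

lemma openV: "mfd_open SS V" and openO: "mfd_open QQ Onb" and openU: "mfd_open P U"
  using V Onb(1) U(1) by (simp_all add: openin_mfd_top)

lemma pmQQ: "premanifold QQ" and pmSS: "premanifold SS"
  by (rule premanifold_prod[OF pmQ pmQ], rule premanifold_prod[OF pmS pmS])

lemma pmVM: "premanifold VM" and pmPU: "premanifold PU" and pmOM: "premanifold OM"
  by (rule premanifold_open_sub[OF pmSS openV], rule premanifold_open_sub[OF pmP openU],
      rule premanifold_open_sub[OF pmQQ openO])

lemma U_points:
  assumes "z \<in> U"
  shows "z \<in> points QQ" "z \<in> Onb" "momentum G GM Q act L z = \<mu>" "fst z \<in> points Q" "snd z \<in> points Q"
proof -
  have "z \<in> points P" using assms mfd_open_subset[OF openU] by blast
  then show "z \<in> points QQ" "z \<in> Onb" "momentum G GM Q act L z = \<mu>" using P(2) by auto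
  then show "fst z \<in> points Q" "snd z \<in> points Q" by auto
qed

lemma V_points: "z \<in> V \<Longrightarrow> z \<in> points S \<times> points S"
  using mfd_open_subset[OF openV] by auto

lemma bundleQ: "principal_bundle G GM Q act S"
  using lie pmQ group_action_action_on[of G "points Q" act] S action
  by (simp add: principal_bundle_def smooth_action_def)

lemma act_diag: "action_on G U (diag_act act)"
proof -
  interpret config: principal_bundle G GM Q act S by (rule bundleQ)
  have "diag_act act \<one>\<^bsub>G\<^esub> z = z" "\<And>g h. g \<in> carrier G \<Longrightarrow> h \<in> carrier G \<Longrightarrow>
      diag_act act (g \<otimes>\<^bsub>G\<^esub> h) z = diag_act act g (diag_act act h z)" if "z \<in> U" for z
    using U_points(4,5)[OF that] config.act_one config.act_mult by (simp_all add: diag_act_def split_beta)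
  then show ?thesis using U(2) by (simp add: action_on_def invariant_set_def)
qed

lemma bundleU: "principal_bundle G GM PU (diag_act act) UG"
  using lie pmPU act_diag UG by (simp add: principal_bundle_def)

sublocale config: principal_bundle G GM Q act S by (rule bundleQ)
sublocale pairs: principal_bundle G GM PU "diag_act act" UG by (rule bundleU)

lemma inclusion_smooth: "smooth_map PU QQ (\<lambda>z. z)" "smooth_map PU OM (\<lambda>z. z)"
proof -
  show "smooth_map PU QQ (\<lambda>z. z)"
    by (rule smooth_map_open_sub[OF pmP openU]) (use P(1) in \<open>simp add: embedded_submanifold_def\<close>)
  then show "smooth_map PU OM (\<lambda>z. z)"
    using U_points(2) by (subst smooth_map_into_open_sub[OF openO]) auto
qed

lemma component_smooth: "smooth_map PU Q fst" "smooth_map PU Q snd"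
  using smooth_map_compose[OF pmPU pmQQ pmQ inclusion_smooth(1) smooth_map_fst(1)[OF pmQ pmQ]]
    smooth_map_compose[OF pmPU pmQQ pmQ inclusion_smooth(1) smooth_map_snd(1)[OF pmQ pmQ]] by simp_all

abbreviation "Ti \<equiv> tmap PU QQ (\<lambda>z. z)"
abbreviation "Tp \<equiv> tmap PU SS pr"
abbreviation "TQ \<equiv> tmap Q S orb"

lemma tmap_component:
  assumes "z \<in> U"
  shows "tmap PU Q fst z w = fst (Ti z w)" "tmap PU Q snd z w = snd (Ti z w)"
proof -
  have z: "z \<in> points PU" "z \<in> points Q \<times> points Q" using assms U_points(1) by auto
  show "tmap PU Q fst z w = fst (Ti z w)"
    using tmap_compose[OF pmPU pmQQ pmQ inclusion_smooth(1) smooth_map_fst(1)[OF pmQ pmQ] z(1), of w]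
    by (simp add: tmap_fst[OF pmQ pmQ z(2)])
  show "tmap PU Q snd z w = snd (Ti z w)"
    using tmap_compose[OF pmPU pmQQ pmQ inclusion_smooth(1) smooth_map_snd(1)[OF pmQ pmQ] z(1), of w]
    by (simp add: tmap_snd[OF pmQ pmQ z(2)])
qed

lemma pr_eq: "pr z = (orb (fst z), orb (snd z))"
  by (simp add: pair_proj_def split_beta)

lemma Tp_eq:
  assumes z: "z \<in> U"
  shows "Tp z w = (TQ (fst z) (fst (Ti z w)), TQ (snd z) (snd (Ti z w)))"
proof -
  have zP: "z \<in> points PU" using z by simp
  note c1 = smooth_map_compose[OF pmPU pmQ pmS component_smooth(1) config.proj_smooth]
  note c2 = smooth_map_compose[OF pmPU pmQ pmS component_smooth(2) config.proj_smooth]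
  have "Tp z w = tmap PU SS (\<lambda>z. (orb (fst z), orb (snd z))) z w" by (simp add: pr_eq[abs_def])
  also have "\<dots> = (tmap PU S (\<lambda>z. orb (fst z)) z w, tmap PU S (\<lambda>z. orb (snd z)) z w)"
    by (rule tmap_Pair[OF pmPU pmS pmS c1 c2 zP])
  finally show ?thesis
    by (simp add: tmap_compose[OF pmPU pmQ pmS component_smooth(1) config.proj_smooth zP]
        tmap_compose[OF pmPU pmQ pmS component_smooth(2) config.proj_smooth zP] tmap_component[OF z])
qed

section \<open>The projection from the momentum level set as a submersion\<close>

lemma V_eq: "V = pr ` U"
proof -
  have "V = \<phi>\<mu> ` points UG" using \<phi>\<mu>(2) by (simp add: diffeo_def bij_betw_def)
  also have "points UG = orbit G (diag_act act) ` U" by (auto simp: pairs.points_B orbits_def)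
  also have "\<phi>\<mu> ` \<dots> = pr ` U" using \<phi>\<mu>(1) by (simp add: image_image)
  finally show ?thesis .
qed

lemma pr_smooth: "smooth_map PU VM pr"
proof -
  have "smooth_map UG VM \<phi>\<mu>" using \<phi>\<mu>(2) by (simp add: diffeo_def)
  from smooth_map_compose[OF pmPU pmUG pmVM pairs.proj_smooth this]
  show ?thesis by (rule smooth_map_cong[OF pmPU]) (use \<phi>\<mu>(1) in simp)
qed

text \<open>A local section of the orbit projection of \<open>U\<close>, preceded by the inverse of
  the diffeomorphism \<open>\<phi>\<mu>\<close>.\<close>

lemma section_of_pr:
  assumes z: "z \<in> U"
  obtains X s where "mfd_open VM X" "pr z \<in> X" "smooth_map (open_sub VM X) PU s"
    "\<forall>x\<in>X. pr (s x) = x" "s (pr z) = z"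
proof -
  let ?\<psi> = "inv_into (points UG) \<phi>\<mu>" and ?o = "orbit G (diag_act act)"
  have bij: "bij_betw \<phi>\<mu> (points UG) V" and \<psi>: "smooth_map VM UG ?\<psi>" using \<phi>\<mu>(2) by (simp_all add: diffeo_def)
  have zP: "z \<in> points PU" using z by simp
  obtain X s where X: "mfd_open UG X" "?o z \<in> X" "smooth_map (open_sub UG X) PU s"
    "\<forall>x\<in>X. ?o (s x) = x" "s (?o z) = z"
    by (rule pairs.local_section[OF zP])
  define Y where "Y = {y \<in> points VM. ?\<psi> y \<in> X}"
  have Y: "mfd_open VM Y" unfolding Y_def by (rule smooth_map_preimage[OF pmVM pmUG \<psi> X(1)])
  have "smooth_map (open_sub VM Y) (open_sub UG X) ?\<psi>"
    using smooth_map_open_sub[OF pmVM Y \<psi>] by (subst smooth_map_into_open_sub[OF X(1)]) (auto simp: Y_def)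
  from smooth_map_compose[OF premanifold_open_sub[OF pmVM Y] premanifold_open_sub[OF pmUG X(1)] pmPU this X(3)]
  have s: "smooth_map (open_sub VM Y) PU (\<lambda>y. s (?\<psi> y))" .
  have ozP: "?o z \<in> points UG" using mfd_open_subset[OF X(1)] X(2) by blast
  have e: "?\<psi> (pr z) = ?o z" using bij_betw_inv_into_left[OF bij ozP] \<phi>\<mu>(1) z by simp
  have "pr (s (?\<psi> y)) = y" if y: "y \<in> Y" for y
  proof -
    have yX: "y \<in> V" "?\<psi> y \<in> X" using y by (auto simp: Y_def)
    have "s (?\<psi> y) \<in> U" using smooth_map_points[OF X(3), of "?\<psi> y"] yX(2) by simp
    then have "pr (s (?\<psi> y)) = \<phi>\<mu> (?\<psi> y)" using \<phi>\<mu>(1) X(4) yX(2) by (metis (no_types, lifting))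
    then show ?thesis using bij_betw_inv_into_right[OF bij yX(1)] by simp
  qed
  moreover have "pr z \<in> Y" using e X(2) z V_eq by (simp add: Y_def)
  ultimately show ?thesis using that[OF Y _ s] e X(5) by simp
qed

text \<open>This makes a form on \<open>V\<close> determined by its pullback to \<open>U\<close>,
  and it lifts vectors on \<open>V\<close> to vectors tangent to the level set.\<close>

lemma Tp_surj:
  assumes z: "z \<in> U"
  obtains w where "Tp z w = v"
proof -
  obtain X s where X: "mfd_open VM X" "pr z \<in> X" "smooth_map (open_sub VM X) PU s"
    "\<forall>x\<in>X. pr (s x) = x" "s (pr z) = z"
    by (rule section_of_pr[OF z])
  have "tmap PU VM pr (s (pr z)) (tmap (open_sub VM X) PU s (pr z) v) = v"
    by (rule tmap_section[OF pmPU pmVM pr_smooth X(1-3)]) (use X(4) in blast)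
  then show ?thesis using that X(5) by simp
qed

text \<open>\<open>Lh\<close> is known only through its values along \<open>pr\<close>; composed
  with a local section these give \<open>L\<close> restricted to the level set, which is
  smooth.\<close>

lemma Lh_smooth: "smooth_map VM vec_mfd Lh"
proof (rule smooth_map_local[OF pmVM])
  fix y assume "y \<in> points VM"
  then obtain z where z: "z \<in> U" "y = pr z" using V_eq by auto
  obtain X s where X: "mfd_open VM X" "pr z \<in> X" "smooth_map (open_sub VM X) PU s"
    "\<forall>x\<in>X. pr (s x) = x" "s (pr z) = z"
    by (rule section_of_pr[OF z(1)])
  have "smooth_map PU vec_mfd L"
    using smooth_map_compose[OF pmPU pmQQ premanifold_real inclusion_smooth(1) L_smooth] .
  from smooth_map_compose[OF premanifold_open_sub[OF pmVM X(1)] pmPU premanifold_real X(3) this]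
  have "smooth_map (open_sub VM X) vec_mfd (\<lambda>x. L (s x))" .
  moreover have "Lh x = L (s x)" if x: "x \<in> X" for x
  proof -
    have "s x \<in> U" using smooth_map_points[OF X(3), of x] x by simp
    then have "Lh (pr (s x)) = L (s x)" using Lh by simp
    then show ?thesis using X(4) x by simp
  qed
  ultimately show "\<exists>X g. mfd_open VM X \<and> y \<in> X \<and> smooth_map (open_sub VM X) vec_mfd g \<and> (\<forall>x\<in>X. Lh x = g x)"
    using X(1,2) z(2) by blast
qed

lemma L_smooth_OM: "smooth_map OM vec_mfd L"
  by (rule smooth_map_open_sub[OF pmQQ openO L_smooth])

section \<open>The connection form and the covectors that descend\<close>

lemma A_one_form: "one_form Q A"
  unfolding one_form_def
proof (intro ballI conjI allI)
  fix q v assume q: "q \<in> points Q"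
  have \<AA>: "one_form Q \<AA>" using connection by (simp add: principal_connection_def)
  have "linear (\<mu> \<circ> \<AA> q)" by (rule linear_compose[OF one_form_linear[OF \<AA> q] \<mu>])
  then show "linear (A q)" by (simp add: mu_form_def[abs_def] comp_def)
  have "smooth_on (chart Q q ` chart_dom Q q) (\<lambda>x. \<mu> (loc1 Q \<AA> q x v))"
    by (rule smooth_on_linear_compose[OF premanifold_fdim[OF config.GM] one_form_smooth[OF \<AA> q] \<mu> premanifold_chart(4)[OF pmQ q]])
  then show "smooth_on (chart Q q ` chart_dom Q q) (\<lambda>x. loc1 Q A q x v)"
    by (simp add: loc1_def mu_form_def Let_def)
qed

lemma A_inf_gen: "q \<in> points Q \<Longrightarrow> A q (inf_gen G GM Q act \<xi> q) = \<mu> \<xi>"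
  using connection by (simp add: principal_connection_def mu_form_def)

lemma diff_form_eq: "z \<in> points QQ \<Longrightarrow> diff_form Q A z w = A (snd z) (snd w) - A (fst z) (fst w)"
  using tmap_fst[OF pmQ pmQ] tmap_snd[OF pmQ pmQ] by (simp add: diff_form_def pull1_def)

text \<open>On \<open>U\<close> the covector \<open>\<zeta>\<close> annihilates the vertical directions of each factor separately, which is
  what allows its two components to descend.\<close>

definition \<eta> :: "'q set \<times> 'q set \<Rightarrow> 's \<times> 's \<Rightarrow> real" where
  "\<eta> z w = tmap VM vec_mfd Lh z w - Ah z w"

definition \<zeta> :: "'q \<times> 'q \<Rightarrow> 'e \<times> 'e \<Rightarrow> real" where
  "\<zeta> z w = tmap OM vec_mfd L z w - diff_form Q A z w"

lemma dLh_one_form: "one_form VM (tmap VM vec_mfd Lh)"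
  by (rule one_form_tmap_real[OF pmVM Lh_smooth])

lemma dL_one_form: "one_form OM (tmap OM vec_mfd L)"
  by (rule one_form_tmap_real[OF pmOM L_smooth_OM])

lemma \<eta>_one_form: "one_form VM \<eta>"
  unfolding \<eta>_def[abs_def] by (rule one_form_diff[OF pmVM dLh_one_form Ah(1)])

text \<open>Differentiation of \<open>Lh (pr x) = L x\<close> along \<open>U\<close>, combined with
  the defining property of \<open>Ah\<close>.\<close>

lemma \<eta>_pr:
  assumes z: "z \<in> U"
  shows "\<eta> (pr z) (Tp z w) = \<zeta> z (Ti z w)"
proof -
  have zP: "z \<in> points PU" using z by simp
  have "tmap VM vec_mfd Lh (pr z) (Tp z w) = tmap PU vec_mfd (\<lambda>x. Lh (pr x)) z w"
    using tmap_compose[OF pmPU pmVM premanifold_real pr_smooth Lh_smooth zP, of w] by simp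
  also have "\<dots> = tmap PU vec_mfd L z w"
    using tmap_cong[OF pmPU zP mfd_open_points[OF pmPU] zP, of "\<lambda>x. Lh (pr x)" L vec_mfd] Lh by simp
  also have "\<dots> = tmap OM vec_mfd L z (Ti z w)"
    using tmap_compose[OF pmPU pmOM premanifold_real inclusion_smooth(2) L_smooth_OM zP, of w] by simp
  finally show ?thesis
    using Ah(2) z by (simp add: \<eta>_def \<zeta>_def pull1_def)
qed

lemma \<zeta>_linear: "z \<in> U \<Longrightarrow> linear (\<zeta> z)"
proof -
  assume z: "z \<in> U"
  have zO: "z \<in> points OM" using U_points(2)[OF z] by simp
  have l: "linear (\<lambda>w :: 'e \<times> 'e. A (snd z) (snd w))" "linear (\<lambda>w :: 'e \<times> 'e. A (fst z) (fst w))"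
    using linear_compose[OF bounded_linear.linear[OF bounded_linear_snd] one_form_linear[OF A_one_form U_points(5)[OF z]]]
      linear_compose[OF bounded_linear.linear[OF bounded_linear_fst] one_form_linear[OF A_one_form U_points(4)[OF z]]]
    by (simp_all add: comp_def)
  have "diff_form Q A z = (\<lambda>w. A (snd z) (snd w) - A (fst z) (fst w))"
    by (rule ext) (rule diff_form_eq[OF U_points(1)[OF z]])
  then have "linear (diff_form Q A z)" using linear_compose_sub[OF l] by simp
  then show ?thesis
    unfolding \<zeta>_def[abs_def] by (rule linear_compose_sub[OF one_form_linear[OF dL_one_form zO]])
qed

definition diag_gen :: "'l \<Rightarrow> 'q \<times> 'q \<Rightarrow> 'p" where
  "diag_gen \<xi> z = inf_gen G GM PU (diag_act act) \<xi> z"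

lemma Ti_diag_gen:
  assumes z: "z \<in> U"
  shows "Ti z (diag_gen \<xi> z) = (inf_gen G GM Q act \<xi> (fst z), inf_gen G GM Q act \<xi> (snd z))"
proof -
  note GM = config.GM
  have zP: "z \<in> points PU" using z by simp
  have o: "\<one>\<^bsub>G\<^esub> \<in> points GM" using config.one_carrier by (simp add: config.points_GM)
  have "Ti z (diag_gen \<xi> z) = tmap GM QQ (\<lambda>g. diag_act act g z) \<one>\<^bsub>G\<^esub> \<xi>"
    using tmap_compose[OF GM pmPU pmQQ pairs.orbit_map_smooth(1)[OF zP] inclusion_smooth(1) o, of \<xi>]
      pairs.act_one[OF zP]
    by (simp add: diag_gen_def inf_gen_def)
  also have "\<dots> = tmap GM QQ (\<lambda>g. (act g (fst z), act g (snd z))) \<one>\<^bsub>G\<^esub> \<xi>"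
    by (simp add: diag_act_def split_beta)
  finally show ?thesis
    using tmap_Pair[OF GM pmQ pmQ config.orbit_map_smooth(1)[OF U_points(4)[OF z]]
        config.orbit_map_smooth(1)[OF U_points(5)[OF z]] o, of \<xi>]
    by (simp add: inf_gen_def)
qed

lemma Tp_diag_gen: "z \<in> U \<Longrightarrow> Tp z (diag_gen \<xi> z) = 0"
  by (simp add: Tp_eq Ti_diag_gen config.tmap_proj_inf_gen U_points(4,5) zero_prod_def)

lemma slot_L:
  assumes "z \<in> Onb"
  shows "slot1 Q L z v = tmap OM vec_mfd L z (v, 0)" "slot2 Q L z v = tmap OM vec_mfd L z (0, v)"
  by (rule slot_eq_tmap[OF pmQ openO L_smooth_OM assms])+

lemma slot_Lh:
  assumes "z \<in> V"
  shows "slot1 S Lh z v = tmap VM vec_mfd Lh z (v, 0)" "slot2 S Lh z v = tmap VM vec_mfd Lh z (0, v)"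
  by (rule slot_eq_tmap[OF pmS openV Lh_smooth assms])+

text \<open>In the second slot both terms equal \<open>\<mu> \<xi>\<close>: one by the momentum
  condition, the other because the connection reproduces \<xi>. A diagonal generator projects to
  zero, so \<zeta> vanishes on it through \<open>\<eta>_pr\<close>; subtraction of the second slot
  leaves the first.\<close>

lemma \<zeta>_vertical:
  assumes z: "z \<in> U"
  shows "\<zeta> z (0, inf_gen G GM Q act \<xi> (snd z)) = 0" "\<zeta> z (inf_gen G GM Q act \<xi> (fst z), 0) = 0"
proof -
  note lin = \<zeta>_linear[OF z]
  let ?a = "inf_gen G GM Q act \<xi> (fst z)" and ?b = "inf_gen G GM Q act \<xi> (snd z)"
  have A0: "A (fst z) 0 = 0" "A (snd z) 0 = 0"
    using linear_0[OF one_form_linear[OF A_one_form]] U_points(4,5)[OF z] by auto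
  have "tmap OM vec_mfd L z (0, ?b) = momentum G GM Q act L z \<xi>"
    by (simp add: momentum_def slot_L[OF U_points(2)[OF z]])
  then show b: "\<zeta> z (0, ?b) = 0"
    using U_points(3,5)[OF z] by (simp add: \<zeta>_def diff_form_eq[OF U_points(1)[OF z]] A0 A_inf_gen)
  have "\<zeta> z (?a, ?b) = \<eta> (pr z) (Tp z (diag_gen \<xi> z))"
    by (simp add: \<eta>_pr[OF z] Ti_diag_gen[OF z])
  also have "\<dots> = 0"
    using linear_0[OF one_form_linear[OF \<eta>_one_form]] z V_eq by (simp add: Tp_diag_gen[OF z])
  finally have "\<zeta> z (?a, ?b) = 0" .
  moreover have "\<zeta> z (?a, ?b) = \<zeta> z (?a, 0) + \<zeta> z (0, ?b)"
    using linear_add[OF lin, of "(?a, 0)" "(0, ?b)"] by simp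
  ultimately show "\<zeta> z (?a, 0) = 0" using b by simp
qed

text \<open>The vector \<open>(0, b)\<close> need not be tangent to \<open>U\<close>, so
  \<open>\<eta>_pr\<close> cannot be applied to it. A tangent lift of its projection differs from it
  by a vertical vector in each slot, and \<zeta> ignores these.\<close>

lemma \<eta>_second:
  assumes z: "z \<in> U"
  shows "\<eta> (pr z) (0, TQ (snd z) b) = \<zeta> z (0, b)"
proof -
  note lin = \<zeta>_linear[OF z]
  obtain w where w: "Tp z w = (0, TQ (snd z) b)" by (rule Tp_surj[OF z])
  have w0: "TQ (fst z) (fst (Ti z w)) = 0" "TQ (snd z) (snd (Ti z w)) = TQ (snd z) b"
    using w Tp_eq[OF z, of w] by simp_all
  have "TQ (snd z) (snd (Ti z w) - b) = 0"
    using linear_diff[OF tmap_linear[OF pmQ pmS config.proj_smooth U_points(5)[OF z]]] w0(2) by simp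
  then obtain \<xi> where \<xi>: "inf_gen G GM Q act \<xi> (snd z) = snd (Ti z w) - b"
    using config.orbit_map_smooth(2)[OF U_points(5)[OF z]] by blast
  obtain \<xi>' where \<xi>': "inf_gen G GM Q act \<xi>' (fst z) = fst (Ti z w)"
    using config.orbit_map_smooth(2)[OF U_points(4)[OF z] w0(1)] by blast
  \<comment> \<open>The first two summands are vertical in one slot each; only the third contributes
    to \<zeta>.\<close>
  have "Ti z w = (fst (Ti z w), 0) + ((0, snd (Ti z w) - b) + (0, b))" by simp
  then have "\<zeta> z (Ti z w) = \<zeta> z (fst (Ti z w), 0) + (\<zeta> z (0, snd (Ti z w) - b) + \<zeta> z (0, b))"
    using linear_add[OF lin] by metis
  also have "\<dots> = \<zeta> z (0, b)"
    using \<zeta>_vertical(1)[OF z, of \<xi>] \<zeta>_vertical(2)[OF z, of \<xi>'] by (simp add: \<xi> \<xi>')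
  finally show ?thesis using \<eta>_pr[OF z, of w] w by simp
qed

section \<open>Legendre transforms as maps into cotangent bundles\<close>

definition \<Gamma> :: "'q set \<times> 'q set \<Rightarrow> 's \<times> 's \<Rightarrow> real" where
  "\<Gamma> z w = \<eta> z (0, snd w)"

text \<open>The reduced Legendre transform, rewritten with \<eta> so that it has the shape of
  \<open>second_component_legendre\<close>; the two agree on \<open>V\<close>, where the slot
  derivative is a value of the tangent map.\<close>

definition \<Phi> :: "'q set \<times> 'q set \<Rightarrow> 'q set \<times> ('s \<Rightarrow> real)" where
  "\<Phi> z = (snd z, \<lambda>v. \<eta> z (0, v))"

lemma \<Phi>_smooth: "smooth_map VM (cotangent S) \<Phi>"
  and \<Phi>_pull: "z \<in> V \<Longrightarrow> pull1 VM (cotangent S) \<Phi> (liouville S) z w = \<Gamma> z w"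
  and \<Gamma>_one_form: "one_form VM \<Gamma>"
  using second_component_legendre[OF pmS pmS openV \<eta>_one_form]
  by (simp_all add: \<Phi>_def[abs_def] \<Gamma>_def[abs_def])

lemma \<Phi>_eq: "z \<in> V \<Longrightarrow> reduced_legendre S Lh Ah z = \<Phi> z"
  by (simp add: reduced_legendre_def \<Phi>_def comp2_def \<eta>_def slot_Lh)

text \<open>The same rewriting for the unreduced Legendre transform, with agreement on
  \<open>Onb\<close>.\<close>

definition \<Psi> :: "'q \<times> 'q \<Rightarrow> 'q \<times> ('e \<Rightarrow> real)" where
  "\<Psi> z = (snd z, \<lambda>v. tmap OM vec_mfd L z (0, v))"

lemma \<Psi>_smooth: "smooth_map OM (cotangent Q) \<Psi>"
  and \<Psi>_pull: "z \<in> Onb \<Longrightarrow> pull1 OM (cotangent Q) \<Psi> (liouville Q) z w = tmap OM vec_mfd L z (0, snd w)"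
  and Theta_one_form': "one_form OM (\<lambda>z w. tmap OM vec_mfd L z (0, snd w))"
  using second_component_legendre[OF pmQ pmQ openO dL_one_form]
  by (simp_all add: \<Psi>_def[abs_def])

lemma Theta_L_eq: "z \<in> Onb \<Longrightarrow> Theta_L Q L z w = tmap OM vec_mfd L z (0, snd w)"
  by (simp add: Theta_L_def slot_L)

lemma Theta_one_form: "one_form OM (Theta_L Q L)"
  by (rule one_form_cong[OF pmOM Theta_one_form']) (simp add: Theta_L_eq)

lemma pull_\<Gamma>:
  assumes z: "z \<in> U"
  shows "pull1 PU VM pr \<Gamma> z w = pull1 PU OM (\<lambda>z. z) (Theta_L Q L) z w - pull1 PU Q snd A z w"
proof -
  have A0: "A (fst z) 0 = 0"
    using linear_0[OF one_form_linear[OF A_one_form U_points(4)[OF z]]] .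
  have "pull1 PU VM pr \<Gamma> z w = \<eta> (pr z) (0, TQ (snd z) (snd (Ti z w)))"
    by (simp add: pull1_def \<Gamma>_def Tp_eq[OF z])
  also have "\<dots> = \<zeta> z (0, snd (Ti z w))" by (rule \<eta>_second[OF z])
  finally show ?thesis
    by (simp add: pull1_def \<zeta>_def diff_form_eq[OF U_points(1)[OF z]] A0 Theta_L_eq[OF U_points(2)[OF z]]
        tmap_component[OF z])
qed

section \<open>Pullback of the reduced form to the level set\<close>

abbreviation "d\<Gamma> \<equiv> ext_deriv1 VM \<Gamma>"
abbreviation "\<beta>1 \<equiv> pull2 VM S fst \<beta>"
abbreviation "\<beta>2 \<equiv> pull2 VM S snd \<beta>"

lemma fst_VM: "smooth_map VM S fst" and snd_VM: "smooth_map VM S snd"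
  by (rule smooth_map_open_sub[OF pmSS openV smooth_map_fst(1)[OF pmS pmS]],
      rule smooth_map_open_sub[OF pmSS openV smooth_map_snd(1)[OF pmS pmS]])

lemma tmap_VM: 
  assumes "z \<in> V"
  shows "tmap VM S fst z w = fst w" "tmap VM S snd z w = snd w"
  by (simp_all add: tmap_open_sub[OF pmSS openV assms] tmap_fst[OF pmS pmS V_points[OF assms]]
      tmap_snd[OF pmS pmS V_points[OF assms]])

text \<open>Projecting to \<open>V\<close> and then to a factor is the same as taking that component
  in \<open>Q\<close> and then its orbit; on \<open>Q\<close> the form \<beta> pulls back to the
  differential of \<open>A\<close>.\<close>

lemma pull_\<beta>:
  assumes z: "z \<in> U"
  shows "pull2 PU VM pr \<beta>1 z u v = pull2 PU Q fst (ext_deriv1 Q A) z u v"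
    and "pull2 PU VM pr \<beta>2 z u v = pull2 PU Q snd (ext_deriv1 Q A) z u v"
proof -
  have V: "pr z \<in> V" using z V_eq by blast
  show "pull2 PU VM pr \<beta>1 z u v = pull2 PU Q fst (ext_deriv1 Q A) z u v"
    using \<beta>(2) U_points(4)[OF z] by (simp add: pull2_def tmap_VM[OF V[unfolded pr_eq]] Tp_eq[OF z] pr_eq tmap_component[OF z])
  show "pull2 PU VM pr \<beta>2 z u v = pull2 PU Q snd (ext_deriv1 Q A) z u v"
    using \<beta>(2) U_points(5)[OF z] by (simp add: pull2_def tmap_VM[OF V[unfolded pr_eq]] Tp_eq[OF z] pr_eq tmap_component[OF z])
qed

text \<open>The identity \<open>pull_\<Gamma>\<close> holds along \<open>U\<close> only, so it is
  differentiated on the manifold \<open>PU\<close>; naturality then moves each derivative to the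
  space where its form lives.\<close>

lemma pull_d\<Gamma>:
  assumes z: "z \<in> U"
  shows "pull2 PU VM pr d\<Gamma> z u v = pull2 PU QQ (\<lambda>z. z) (ext_deriv1 QQ (Theta_L Q L)) z u v - pull2 PU VM pr \<beta>2 z u v"
proof -
  have zP: "z \<in> points PU" using z by simp
  have "pull2 PU VM pr d\<Gamma> z u v = ext_deriv1 PU (pull1 PU VM pr \<Gamma>) z u v"
    by (rule ext_deriv1_pull1[OF pmPU pmVM pr_smooth \<Gamma>_one_form zP, symmetric])
  also have "\<dots> = ext_deriv1 PU (\<lambda>z w. pull1 PU OM (\<lambda>z. z) (Theta_L Q L) z w - pull1 PU Q snd A z w) z u v"
    by (rule ext_deriv1_cong[OF pmPU mfd_open_points[OF pmPU] zP]) (simp add: pull_\<Gamma>)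
  also have "\<dots> = ext_deriv1 PU (pull1 PU OM (\<lambda>z. z) (Theta_L Q L)) z u v - ext_deriv1 PU (pull1 PU Q snd A) z u v"
    by (rule ext_deriv1_diff[OF pmPU one_form_pull1[OF pmPU pmOM inclusion_smooth(2) Theta_one_form]
          one_form_pull1[OF pmPU pmQ component_smooth(2) A_one_form] zP])
  also have "\<dots> = pull2 PU OM (\<lambda>z. z) (ext_deriv1 OM (Theta_L Q L)) z u v - pull2 PU Q snd (ext_deriv1 Q A) z u v"
    by (simp add: ext_deriv1_pull1[OF pmPU pmOM inclusion_smooth(2) Theta_one_form zP]
        ext_deriv1_pull1[OF pmPU pmQ component_smooth(2) A_one_form zP])
  finally show ?thesis
    by (simp add: pull_\<beta>[OF z]) (simp add: pull2_def ext_deriv1_open_sub[OF pmQQ openO U_points(2)[OF z]])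
qed

abbreviation "\<Omega> \<equiv> Omega_mu S V Lh Ah \<beta>"

lemma \<Omega>_eq:
  assumes z: "z \<in> V"
  shows "\<Omega> z u v = - d\<Gamma> z u v - \<beta>2 z u v"
proof -
  note T = premanifold_cotangent[OF pmS]
  have zV: "z \<in> points VM" using z by simp
  have "\<Omega> z u v = pull2 VM (cotangent S) \<Phi> (\<lambda>z u v. canonical_symplectic S z u v - pull2 (cotangent S) S fst \<beta> z u v) z u v"
    unfolding Omega_mu_def
    by (rule pull2_cong[OF pmVM zV mfd_open_points[OF pmVM] zV]) (simp add: \<Phi>_eq)
  also have "\<dots> = - pull2 VM (cotangent S) \<Phi> (ext_deriv1 (cotangent S) (liouville S)) z u v
      - pull2 VM (cotangent S) \<Phi> (pull2 (cotangent S) S fst \<beta>) z u v"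
    by (simp add: pull2_def canonical_symplectic_def)
  \<comment> \<open>The map \<open>\<Phi>\<close> covers the second projection, which is why \<beta>
    appears through the second factor.\<close>
  also have "pull2 VM (cotangent S) \<Phi> (pull2 (cotangent S) S fst \<beta>) z u v = \<beta>2 z u v"
    using pull2_compose[OF pmVM T pmS \<Phi>_smooth smooth_map_cotangent_projection(1)[OF pmS] zV]
    by (simp add: \<Phi>_def)
  also have "pull2 VM (cotangent S) \<Phi> (ext_deriv1 (cotangent S) (liouville S)) z u v
      = ext_deriv1 VM (pull1 VM (cotangent S) \<Phi> (liouville S)) z u v"
    by (rule ext_deriv1_pull1[OF pmVM T \<Phi>_smooth one_form_liouville[OF pmS] zV, symmetric])
  also have "\<dots> = d\<Gamma> z u v"
    by (rule ext_deriv1_cong[OF pmVM mfd_open_points[OF pmVM] zV]) (simp add: \<Phi>_pull)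
  finally show ?thesis .
qed

theorem pull_\<Omega>:
  assumes z: "z \<in> U"
  shows "pull2 PU VM pr \<Omega> z u v = pull2 PU QQ (\<lambda>z. z) (Omega_L Q L) z u v"
proof -
  have "pr z \<in> V" using z V_eq by blast
  then have "pull2 PU VM pr \<Omega> z u v = - pull2 PU VM pr d\<Gamma> z u v - pull2 PU VM pr \<beta>2 z u v"
    by (simp add: pull2_def \<Omega>_eq)
  then show ?thesis
    unfolding pull_d\<Gamma>[OF z] by (simp add: pull2_def Omega_L_def)
qed

subsection \<open>Invariance under the flow\<close>

text \<open>Tangent vectors are lifted to \<open>U\<close>, where \<open>Ah\<close> pulls back to
  the difference of the connection forms on the two components, and that difference can be
  differentiated termwise.\<close>

lemma dAh:
  assumes y: "y \<in> V"
  shows "ext_deriv1 VM Ah y u v = \<beta>2 y u v - \<beta>1 y u v"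
proof -
  obtain z where z: "z \<in> U" "y = pr z" using y V_eq by blast
  have zP: "z \<in> points PU" using z by simp
  obtain u' where u': "Tp z u' = u" by (rule Tp_surj[OF z(1)])
  obtain v' where v': "Tp z v' = v" by (rule Tp_surj[OF z(1)])
  have "ext_deriv1 VM Ah y u v = pull2 PU VM pr (ext_deriv1 VM Ah) z u' v'"
    by (simp add: pull2_def z(2) u' v')
  also have "\<dots> = ext_deriv1 PU (pull1 PU VM pr Ah) z u' v'"
    by (rule ext_deriv1_pull1[OF pmPU pmVM pr_smooth Ah(1) zP, symmetric])
  also have "\<dots> = ext_deriv1 PU (\<lambda>z w. pull1 PU Q snd A z w - pull1 PU Q fst A z w) z u' v'"
  proof (rule ext_deriv1_cong[OF pmPU mfd_open_points[OF pmPU] zP])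
    fix x w assume "x \<in> points PU"
    then have x: "x \<in> U" by simp
    show "pull1 PU VM pr Ah x w = pull1 PU Q snd A x w - pull1 PU Q fst A x w"
      using Ah(2) x by (simp add: pull1_def[of _ Q] pull1_def[of _ QQ] diff_form_eq[OF U_points(1)[OF x]] tmap_component[OF x])
  qed
  also have "\<dots> = ext_deriv1 PU (pull1 PU Q snd A) z u' v' - ext_deriv1 PU (pull1 PU Q fst A) z u' v'"
    by (rule ext_deriv1_diff[OF pmPU one_form_pull1[OF pmPU pmQ component_smooth(2) A_one_form]
          one_form_pull1[OF pmPU pmQ component_smooth(1) A_one_form] zP])
  also have "\<dots> = pull2 PU VM pr \<beta>2 z u' v' - pull2 PU VM pr \<beta>1 z u' v'"
    by (simp add: ext_deriv1_pull1[OF pmPU pmQ component_smooth(2) A_one_form zP]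
        ext_deriv1_pull1[OF pmPU pmQ component_smooth(1) A_one_form zP] pull_\<beta>[OF z(1)])
  also have "\<dots> = \<beta>2 y u v - \<beta>1 y u v" by (simp add: pull2_def[of PU] z(2) u' v')
  finally show ?thesis .
qed

text \<open>The DR equation says that the flow map pulls \<open>\<Gamma>'\<close>, which is minus the first component of \<open>\<eta>\<close>,
  back to \<open>\<Gamma>\<close>.\<close>

definition \<Gamma>' :: "'q set \<times> 'q set \<Rightarrow> 's \<times> 's \<Rightarrow> real" where
  "\<Gamma>' z w = \<Gamma> z w - \<eta> z w"

lemma \<Gamma>'_one_form: "one_form VM \<Gamma>'"
  unfolding \<Gamma>'_def[abs_def] by (rule one_form_diff[OF pmVM \<Gamma>_one_form \<eta>_one_form])

lemma \<Gamma>'_eq: "z \<in> V \<Longrightarrow> \<Gamma>' z w = - \<eta> z (fst w, 0)"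
  using linear_add[OF one_form_linear[OF \<eta>_one_form], of z "(fst w, 0)" "(0, snd w)"]
  by (simp add: \<Gamma>'_def \<Gamma>_def)

text \<open>The differential of \<open>Lh\<close> is closed, so \<eta> and \<open>Ah\<close> have
  opposite exterior derivatives; passing from \<Gamma> to \<Gamma>' therefore exchanges the second
  copy of \<beta> for the first.\<close>

lemma \<Omega>_eq':
  assumes z: "z \<in> V"
  shows "\<Omega> z u v = - ext_deriv1 VM \<Gamma>' z u v - \<beta>1 z u v"
proof -
  have zV: "z \<in> points VM" using z by simp
  have "ext_deriv1 VM \<eta> z u v = - ext_deriv1 VM Ah z u v"
    unfolding \<eta>_def[abs_def]
    by (simp add: ext_deriv1_diff[OF pmVM dLh_one_form Ah(1) zV] ext_deriv1_tmap_real[OF pmVM Lh_smooth zV])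
  moreover have "ext_deriv1 VM \<Gamma>' z u v = d\<Gamma> z u v - ext_deriv1 VM \<eta> z u v"
    unfolding \<Gamma>'_def[abs_def] by (rule ext_deriv1_diff[OF pmVM \<Gamma>_one_form \<eta>_one_form zV])
  ultimately show ?thesis by (simp add: \<Omega>_eq[OF z] dAh[OF z])
qed

lemma openW: "mfd_open SS W" and WV: "W \<subseteq> V" and F_smooth: "smooth_map (open_sub SS W) VM F"
  using F by (simp_all add: DR_flow_map_def openin_mfd_top)

abbreviation "WM \<equiv> open_sub SS W"

lemma pmWM: "premanifold WM"
  by (rule premanifold_open_sub[OF pmSS openW])

text \<open>The last identity is the DR equation with each connection term moved next to its
  Lagrangian term, so that both pairs become values of \<eta>.\<close>

lemma F_step:
  assumes z: "z \<in> W"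
  shows "fst (F z) = snd z" "F z \<in> V" "\<eta> (F z) (v, 0) = - \<eta> z (0, v)"
proof -
  obtain x0 x1 where x: "z = (x0, x1)" by (cases z)
  obtain x2 where x2: "F z = (x1, x2)" "DR_equation S Lh Ah x0 x1 x2"
    using F z x unfolding DR_flow_map_def by blast
  show "fst (F z) = snd z" using x x2 by simp
  show FV: "F z \<in> V" using smooth_map_points[OF F_smooth, of z] z by simp
  have zV: "z \<in> V" using z WV by blast
  show "\<eta> (F z) (v, 0) = - \<eta> z (0, v)"
  proof -
    have "slot2 S Lh z v + slot1 S Lh (F z) v = Ah z (0, v) + Ah (F z) (v, 0)"
      using x2(2) by (simp add: DR_equation_def comp1_def comp2_def x2(1)) (simp add: x)
    then show ?thesis by (simp add: \<eta>_def slot_Lh(1)[OF FV] slot_Lh(2)[OF zV])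
  qed
qed

text \<open>\<open>\<Omega>_eq'\<close> is used at the image and \<open>\<Omega>_eq\<close> at the
  source: pulled back by \<open>F\<close>, the forms \<Gamma>' and \<beta>1 become \<Gamma> and
  \<beta>2, so the two expressions match term by term.\<close>

theorem pull_F_\<Omega>:
  assumes z: "z \<in> W"
  shows "pull2 WM VM F \<Omega> z u v = \<Omega> z u v"
proof -
  have zW: "z \<in> points WM" using z by simp
  have zV: "z \<in> V" using z WV by blast
  \<comment> \<open>Differentiates the shift property, that the first entry of \<open>F x\<close> is
    the second entry of \<open>x\<close>.\<close>
  have fstF: "tmap VM S fst (F x) (tmap WM SS F x w) = snd w" if x: "x \<in> W" for x w
  proof -
    have xW: "x \<in> points WM" using x by simp
    have xS: "x \<in> points S \<times> points S" using x WV V_points by blast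
    have "tmap VM S fst (F x) (tmap WM SS F x w) = tmap WM S (\<lambda>y. fst (F y)) x w"
      using tmap_compose[OF pmWM pmVM pmS F_smooth fst_VM xW, of w] by simp
    also have "\<dots> = tmap WM S snd x w"
      using tmap_cong[OF pmWM xW mfd_open_points[OF pmWM] xW, of "\<lambda>y. fst (F y)" snd S] F_step(1) by simp
    finally show ?thesis by (simp add: tmap_open_sub[OF pmSS openW x] tmap_snd[OF pmS pmS xS])
  qed
  have "pull1 WM VM F \<Gamma>' x w = \<Gamma> x w" if x: "x \<in> W" for x w
    using fstF[OF x, of w] F_step(3)[OF x]
    by (simp add: pull1_def \<Gamma>'_eq[OF F_step(2)[OF x]] tmap_VM[OF F_step(2)[OF x]] \<Gamma>_def)
  then have "ext_deriv1 WM (pull1 WM VM F \<Gamma>') z u v = ext_deriv1 WM \<Gamma> z u v"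
    by (intro ext_deriv1_cong[OF pmWM mfd_open_points[OF pmWM] zW]) simp
  also have "ext_deriv1 WM \<Gamma> z u v = d\<Gamma> z u v"
    by (simp add: ext_deriv1_open_sub[OF pmSS openW z] ext_deriv1_open_sub[OF pmSS openV zV])
  also have "ext_deriv1 WM (pull1 WM VM F \<Gamma>') z u v = pull2 WM VM F (ext_deriv1 VM \<Gamma>') z u v"
    by (rule ext_deriv1_pull1[OF pmWM pmVM F_smooth \<Gamma>'_one_form zW])
  finally have "pull2 WM VM F (ext_deriv1 VM \<Gamma>') z u v = d\<Gamma> z u v" .
  moreover have "pull2 WM VM F \<beta>1 z u v = \<beta>2 z u v"
    using fstF[OF z] F_step(1)[OF z] by (simp add: pull2_def tmap_VM[OF zV])
  moreover have "pull2 WM VM F \<Omega> z u v = - pull2 WM VM F (ext_deriv1 VM \<Gamma>') z u v - pull2 WM VM F \<beta>1 z u v"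
    using \<Omega>_eq'[OF F_step(2)[OF z]] by (simp add: pull2_def)
  ultimately show ?thesis by (simp add: \<Omega>_eq[OF zV])
qed

lemma flow_dom_Suc: "flow_dom V W F (Suc n) = {z \<in> flow_dom V W F n. (F ^^ n) z \<in> W}"
  by (auto simp: flow_dom_def less_Suc_eq)

text \<open>Openness, smoothness and invariance go through the induction together: the next domain
  is a preimage under the current iterate, and its openness is what lets tangent maps be compared
  with those on the larger domain.\<close>

theorem pull_flow_\<Omega>:
  "mfd_open SS (flow_dom V W F n) \<and> smooth_map (open_sub SS (flow_dom V W F n)) VM (F ^^ n) \<and>
    (\<forall>z\<in>flow_dom V W F n. \<forall>u v. pull2 (open_sub SS (flow_dom V W F n)) VM (F ^^ n) \<Omega> z u v = \<Omega> z u v)"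
proof (induction n)
  case 0
  \<comment> \<open>No step of the flow is taken yet, so the domain is all of \<open>V\<close> and
    not \<open>W\<close>.\<close>
  have D: "flow_dom V W F 0 = V" by (simp add: flow_dom_def)
  have "pull2 VM VM (\<lambda>x. x) \<Omega> z u v = \<Omega> z u v" if "z \<in> V" for z u v
    using that tmap_ident[OF pmVM, of z] by (simp add: pull2_def)
  then show ?case using openV smooth_map_ident[OF pmVM] by (simp add: D id_def)
next
  case (Suc n)
  let ?D = "flow_dom V W F n" and ?E = "flow_dom V W F (Suc n)"
  let ?DM = "open_sub SS ?D" and ?EM = "open_sub SS ?E"
  have D: "mfd_open SS ?D" and s: "smooth_map ?DM VM (F ^^ n)"
    and inv: "\<And>z u v. z \<in> ?D \<Longrightarrow> pull2 ?DM VM (F ^^ n) \<Omega> z u v = \<Omega> z u v" using Suc by auto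
  note pmD = premanifold_open_sub[OF pmSS D]
  have WVM: "mfd_open VM W" using mfd_open_open_sub[OF pmSS openV] openW WV by blast
  have ED: "?E = {z \<in> points ?DM. (F ^^ n) z \<in> W}" by (simp add: flow_dom_Suc)
  have "mfd_open ?DM ?E" unfolding ED by (rule smooth_map_preimage[OF pmD pmVM s WVM])
  then have E: "mfd_open SS ?E" "?E \<subseteq> ?D" using mfd_open_open_sub[OF pmSS D] by auto
  note pmE = premanifold_open_sub[OF pmSS E(1)]
  have "smooth_map ?DM SS (F ^^ n)"
    by (rule smooth_map_into_open_sub[OF openV, THEN iffD1, THEN conjunct1, OF s])
  from smooth_map_compose[OF pmE pmD pmSS _ this]
  have "smooth_map ?EM SS (\<lambda>x. (F ^^ n) x)"
    using smooth_map_into_open_sub[OF D, THEN iffD2, OF conjI[OF smooth_map_inclusion[OF pmSS E(1)]]] E(2) by simp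
  then have sW: "smooth_map ?EM WM (F ^^ n)"
    by (subst smooth_map_into_open_sub[OF openW]) (auto simp: flow_dom_Suc)
  have sE: "smooth_map ?EM VM (F ^^ Suc n)"
    using smooth_map_compose[OF pmE pmWM pmVM sW F_smooth] by (simp add: comp_def)
  have "pull2 ?EM VM (F ^^ Suc n) \<Omega> z u v = \<Omega> z u v" if z: "z \<in> ?E" for z u v
  proof -
    have zE: "z \<in> points ?EM" and zD: "z \<in> ?D" and FW: "(F ^^ n) z \<in> W" using z E(2) by (auto simp: flow_dom_Suc)
    have "pull2 ?EM VM (F ^^ Suc n) \<Omega> z u v = pull2 ?EM WM (F ^^ n) (pull2 WM VM F \<Omega>) z u v"
      using pull2_compose[OF pmE pmWM pmVM sW F_smooth zE, of \<Omega> u v] by (simp add: comp_def)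
    also have "\<dots> = pull2 ?DM VM (F ^^ n) \<Omega> z u v"
      using pull_F_\<Omega>[OF FW]
      by (simp add: pull2_def[of ?EM] pull2_def[of ?DM] tmap_open_sub[OF pmSS E(1) z] tmap_open_sub[OF pmSS D zD])
    finally show ?thesis using inv[OF zD] by simp
  qed
  then show ?case using E(1) sE by blast
qed

subsection \<open>Closedness and nondegeneracy\<close>

text \<open>Negation is written as a difference from the zero form, so the rules for differences of
  forms cover it.\<close>

lemma neg_\<Gamma>_one_form: "one_form VM (\<lambda>z w. 0 - \<Gamma> z w)"
  by (rule one_form_diff[OF pmVM one_form_zero[OF pmVM] \<Gamma>_one_form])

lemma \<Omega>_eq_ext_deriv1:
  assumes "z \<in> V"
  shows "\<Omega> z u v = ext_deriv1 VM (\<lambda>z w. 0 - \<Gamma> z w) z u v - \<beta>2 z u v"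
proof -
  have "z \<in> points VM" using assms by simp
  from ext_deriv1_diff[OF pmVM one_form_zero[OF pmVM] \<Gamma>_one_form this]
  show ?thesis by (simp add: \<Omega>_eq[OF assms] ext_deriv1_zero)
qed

lemma \<Omega>_two_form: "two_form VM \<Omega>"
proof (rule two_form_cong[OF pmVM])
  show "two_form VM (\<lambda>z u v. ext_deriv1 VM (\<lambda>z w. 0 - \<Gamma> z w) z u v - \<beta>2 z u v)"
    by (rule two_form_diff[OF pmVM two_form_ext_deriv1[OF pmVM neg_\<Gamma>_one_form] two_form_pull2[OF pmVM pmS snd_VM \<beta>(1)]])
qed (simp add: \<Omega>_eq_ext_deriv1)

text \<open>Pulling \<open>A\<close> back by a local section \<open>s\<close> gives a local primitive of \<open>\<beta>\<close>, so \<open>\<Omega>\<close> is locally exact.\<close>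

lemma \<Omega>_closed:
  assumes z: "z \<in> V"
  shows "ext_deriv2 VM \<Omega> z u v w = 0"
proof -
  have "snd z \<in> points S" using V_points[OF z] by auto
  then obtain q where q: "q \<in> points Q" "orb q = snd z" by (auto simp: config.points_B orbits_def)
  obtain X s where X: "mfd_open S X" "orb q \<in> X" "smooth_map (open_sub S X) Q s"
    "\<forall>x\<in>X. orb (s x) = x" "s (orb q) = q"
    by (rule config.local_section[OF q(1)])
  let ?SX = "open_sub S X" and ?\<kappa> = "pull1 (open_sub S X) Q s A"
  have pmSX: "premanifold ?SX" by (rule premanifold_open_sub[OF pmS X(1)])
  have \<kappa>: "one_form ?SX ?\<kappa>" by (rule one_form_pull1[OF pmSX pmQ X(3) A_one_form])
  have d\<kappa>: "ext_deriv1 ?SX ?\<kappa> x u v = \<beta> x u v" if x: "x \<in> X" for x u v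
  proof -
    have xX: "x \<in> points ?SX" using x by simp
    have sx: "s x \<in> points Q" using smooth_map_points[OF X(3) xX] .
    have "ext_deriv1 ?SX ?\<kappa> x u v = pull2 ?SX Q s (ext_deriv1 Q A) x u v"
      by (rule ext_deriv1_pull1[OF pmSX pmQ X(3) A_one_form xX])
    \<comment> \<open>The differential of \<open>A\<close> is the pullback of \<beta> along
      \<open>orb\<close>, and \<open>orb\<close> after the section is the identity.\<close>
    also have "\<dots> = pull2 ?SX Q s (pull2 Q S orb \<beta>) x u v"
      using \<beta>(2) sx by (simp add: pull2_def[of ?SX])
    also have "\<dots> = \<beta> x u v"
      using tmap_section[OF pmQ pmS config.proj_smooth X(1) x X(3)] X(4) x by (simp add: pull2_def)
    finally show ?thesis .
  qed
  define Y where "Y = {y \<in> points VM. snd y \<in> X}"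
  have Y: "mfd_open VM Y" unfolding Y_def by (rule smooth_map_preimage[OF pmVM pmS snd_VM X(1)])
  let ?YM = "open_sub VM Y"
  have pmY: "premanifold ?YM" by (rule premanifold_open_sub[OF pmVM Y])
  have zY: "z \<in> Y" using z X(2) q(2) by (simp add: Y_def)
  have "smooth_map ?YM S snd" by (rule smooth_map_open_sub[OF pmVM Y snd_VM])
  then have sY: "smooth_map ?YM ?SX snd"
    by (subst smooth_map_into_open_sub[OF X(1)]) (auto simp: Y_def)
  \<comment> \<open>The first summand is a primitive of the \<Gamma> part; the second takes the
    local primitive of \<beta> along the second projection.\<close>
  let ?prim = "\<lambda>z w. (0 - \<Gamma> z w) - pull1 ?YM ?SX snd ?\<kappa> z w"
  have neg: "one_form ?YM (\<lambda>z w. 0 - \<Gamma> z w)" by (rule one_form_open_sub[OF pmVM Y neg_\<Gamma>_one_form])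
  have pk: "one_form ?YM (pull1 ?YM ?SX snd ?\<kappa>)" by (rule one_form_pull1[OF pmY pmSX sY \<kappa>])
  have prim: "one_form ?YM ?prim" by (rule one_form_diff[OF pmY neg pk])
  have "\<Omega> y a b = ext_deriv1 ?YM ?prim y a b" if y: "y \<in> Y" for y a b
  proof -
    have yY: "y \<in> points ?YM" and yV: "y \<in> V" and yX: "snd y \<in> X" using y by (auto simp: Y_def)
    have "ext_deriv1 ?YM ?prim y a b
      = ext_deriv1 ?YM (\<lambda>z w. 0 - \<Gamma> z w) y a b - ext_deriv1 ?YM (pull1 ?YM ?SX snd ?\<kappa>) y a b"
      by (rule ext_deriv1_diff[OF pmY neg pk yY])
    also have "ext_deriv1 ?YM (pull1 ?YM ?SX snd ?\<kappa>) y a b = \<beta>2 y a b"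
      by (simp add: ext_deriv1_pull1[OF pmY pmSX sY \<kappa> yY] pull2_def d\<kappa>[OF yX] tmap_open_sub[OF pmVM Y y])
    finally show ?thesis by (simp add: \<Omega>_eq_ext_deriv1[OF yV] ext_deriv1_open_sub[OF pmVM Y y])
  qed
  then have "ext_deriv2 ?YM \<Omega> z u v w = ext_deriv2 ?YM (ext_deriv1 ?YM ?prim) z u v w"
    by (intro ext_deriv2_cong[OF pmY mfd_open_points[OF pmY]]) (simp_all add: zY)
  then show ?thesis
    using ext_deriv2_ext_deriv1[OF pmY prim, of z u v w] zY by (simp add: ext_deriv2_open_sub[OF pmVM Y zY])
qed

text \<open>The form \<open>dp\<close> wedge \<open>dq\<close> pulled back along
  \<open>\<Phi>\<close>, whose base component is the second projection. In this shape a vector from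
  the first factor enters only through its covector component.\<close>

lemma d\<Gamma>_eq:
  assumes z: "z \<in> V"
  shows "d\<Gamma> z u v = snd (tmap VM (cotangent S) \<Phi> z u) \<bullet> snd v - snd (tmap VM (cotangent S) \<Phi> z v) \<bullet> snd u"
proof -
  note T = premanifold_cotangent[OF pmS]
  have zV: "z \<in> points VM" using z by simp
  have f: "fst (tmap VM (cotangent S) \<Phi> z w) = snd w" for w
  proof -
    have "tmap VM S (\<lambda>x. fst (\<Phi> x)) z w = tmap (cotangent S) S fst (\<Phi> z) (tmap VM (cotangent S) \<Phi> z w)"
      by (rule tmap_compose[OF pmVM T pmS \<Phi>_smooth smooth_map_cotangent_projection(1)[OF pmS] zV])
    moreover have "tmap (cotangent S) S fst (\<Phi> z) y = fst y" for y
      using smooth_map_points[OF \<Phi>_smooth zV] smooth_map_cotangent_projection(2)[OF pmS, of "snd z" _ "snd z"]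
        premanifold_chart(1)[OF pmS, of "snd z"]
      by (simp add: tmap_trep \<Phi>_def cotangent_simps)
    ultimately show ?thesis using tmap_VM(2)[OF z, of w] by (simp add: \<Phi>_def)
  qed
  have "d\<Gamma> z u v = ext_deriv1 VM (pull1 VM (cotangent S) \<Phi> (liouville S)) z u v"
    by (rule ext_deriv1_cong[OF pmVM mfd_open_points[OF pmVM] zV]) (simp add: \<Phi>_pull)
  also have "\<dots> = pull2 VM (cotangent S) \<Phi> (ext_deriv1 (cotangent S) (liouville S)) z u v"
    by (rule ext_deriv1_pull1[OF pmVM T \<Phi>_smooth one_form_liouville[OF pmS] zV])
  finally show ?thesis
    by (simp add: pull2_def ext_deriv1_liouville[OF pmS smooth_map_points[OF \<Phi>_smooth zV]] f)
qed

text \<open>The analogous formula upstairs, together with the base component of the tangent map of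
  \<open>\<Psi>\<close>; injectivity of that tangent map is applied through both.\<close>

lemma dTheta_eq:
  assumes z: "z \<in> Onb"
  shows "ext_deriv1 QQ (Theta_L Q L) z u v
      = snd (tmap OM (cotangent Q) \<Psi> z u) \<bullet> snd v - snd (tmap OM (cotangent Q) \<Psi> z v) \<bullet> snd u"
    and "fst (tmap OM (cotangent Q) \<Psi> z u) = snd u"
proof -
  note T = premanifold_cotangent[OF pmQ]
  have zO: "z \<in> points OM" using z by simp
  have zQ: "z \<in> points Q \<times> points Q" using mfd_open_subset[OF openO] z by auto
  show f: "fst (tmap OM (cotangent Q) \<Psi> z w) = snd w" for w
  proof -
    have "tmap OM Q (\<lambda>x. fst (\<Psi> x)) z w = tmap (cotangent Q) Q fst (\<Psi> z) (tmap OM (cotangent Q) \<Psi> z w)"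
      by (rule tmap_compose[OF pmOM T pmQ \<Psi>_smooth smooth_map_cotangent_projection(1)[OF pmQ] zO])
    moreover have "tmap (cotangent Q) Q fst (\<Psi> z) y = fst y" for y
      using smooth_map_points[OF \<Psi>_smooth zO] smooth_map_cotangent_projection(2)[OF pmQ, of "snd z" _ "snd z"]
        premanifold_chart(1)[OF pmQ, of "snd z"]
      by (simp add: tmap_trep \<Psi>_def cotangent_simps)
    moreover have "tmap OM Q snd z w = snd w"
      by (simp add: tmap_open_sub[OF pmQQ openO z] tmap_snd[OF pmQ pmQ zQ])
    ultimately show ?thesis by (simp add: \<Psi>_def)
  qed
  have "ext_deriv1 QQ (Theta_L Q L) z u v = ext_deriv1 OM (Theta_L Q L) z u v"
    by (rule ext_deriv1_open_sub[OF pmQQ openO z, symmetric])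
  also have "\<dots> = ext_deriv1 OM (pull1 OM (cotangent Q) \<Psi> (liouville Q)) z u v"
    by (rule ext_deriv1_cong[OF pmOM mfd_open_points[OF pmOM] zO]) (simp add: \<Psi>_pull Theta_L_eq)
  also have "\<dots> = pull2 OM (cotangent Q) \<Psi> (ext_deriv1 (cotangent Q) (liouville Q)) z u v"
    by (rule ext_deriv1_pull1[OF pmOM T \<Psi>_smooth one_form_liouville[OF pmQ] zO])
  finally show "ext_deriv1 QQ (Theta_L Q L) z u v
      = snd (tmap OM (cotangent Q) \<Psi> z u) \<bullet> snd v - snd (tmap OM (cotangent Q) \<Psi> z v) \<bullet> snd u"
    by (simp add: pull2_def ext_deriv1_liouville[OF pmQ smooth_map_points[OF \<Psi>_smooth zO]] f)
qed

lemma \<Psi>_inj: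
  assumes z: "z \<in> Onb" and u: "tmap OM (cotangent Q) \<Psi> z u = 0"
  shows "u = 0"
proof (rule local_diffeo_tmap_inj[OF pmOM premanifold_cotangent[OF pmQ] Onb(2)])
  show zO: "z \<in> points OM" using z by simp
  have "discrete_legendre Q L x = \<Psi> x" if "x \<in> Onb" for x
    by (simp add: discrete_legendre_def \<Psi>_def slot_L[OF that] fun_eq_iff)
  then show "tmap OM (cotangent Q) (discrete_legendre Q L) z u = 0"
    using tmap_cong[OF pmOM zO mfd_open_points[OF pmOM] zO, of "discrete_legendre Q L" \<Psi> "cotangent Q"] u
    by simp
qed

text \<open>A vector \<open>(a, 0)\<close> lifts to \<open>(c, 0)\<close> tangent to \<open>U\<close>, after subtracting a vertical vector.\<close>

lemma \<Phi>_fst_inj: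
  assumes y: "y \<in> V" and a: "snd (tmap VM (cotangent S) \<Phi> y (a, 0)) = 0"
  shows "a = 0"
proof -
  obtain z where z: "z \<in> U" "y = pr z" using y V_eq by blast
  have zP: "z \<in> points PU" using z by simp
  note linT = tmap_linear[OF pmPU pmQQ inclusion_smooth(1) zP]
    and linP = tmap_linear[OF pmPU pmVM pr_smooth zP, unfolded tmap_into_open_sub]
  \<comment> \<open>If the second component of a lift has the same projection as \<open>b\<close>,
    the two differ by a vertical vector. Subtracting the diagonal generator with that second
    component corrects it and leaves the projection to \<open>V\<close> unchanged.\<close>
  have lift: "\<exists>w'. Tp z w' = Tp z w \<and> snd (Ti z w') = b" if "TQ (snd z) (snd (Ti z w)) = TQ (snd z) b" for w b
  proof -
    have "TQ (snd z) (snd (Ti z w) - b) = 0"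
      using linear_diff[OF tmap_linear[OF pmQ pmS config.proj_smooth U_points(5)[OF z(1)]]] that by simp
    then obtain \<xi> where \<xi>: "inf_gen G GM Q act \<xi> (snd z) = snd (Ti z w) - b"
      using config.orbit_map_smooth(2)[OF U_points(5)[OF z(1)]] by blast
    have "Tp z (w - diag_gen \<xi> z) = Tp z w" "snd (Ti z (w - diag_gen \<xi> z)) = b"
      by (simp_all add: linear_diff[OF linT] linear_diff[OF linP] Tp_diag_gen[OF z(1)] Ti_diag_gen[OF z(1)] \<xi>)
    then show ?thesis by blast
  qed
  obtain w0 where w0: "Tp z w0 = (a, 0)" by (rule Tp_surj[OF z(1)])
  have TQ0: "TQ (snd z) 0 = 0"
    by (rule linear_0[OF tmap_linear[OF pmQ pmS config.proj_smooth U_points(5)[OF z(1)]]])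
  have "TQ (snd z) (snd (Ti z w0)) = TQ (snd z) 0" using w0 Tp_eq[OF z(1), of w0] TQ0 by simp
  from lift[OF this] obtain w where w: "Tp z w = (a, 0)" "snd (Ti z w) = 0" using w0 by auto
  \<comment> \<open>The second component of \<open>Ti z w\<close> is zero, so the tangent map of
    \<open>\<Psi>\<close> has no base component there; it remains to test its covector component
    against every \<open>b\<close>, realised as the second component of a vector tangent to
    \<open>U\<close>.\<close>
  have "snd (tmap OM (cotangent Q) \<Psi> z (Ti z w)) \<bullet> b = 0" for b
  proof -
    obtain x0 where "Tp z x0 = (0, TQ (snd z) b)" by (rule Tp_surj[OF z(1)])
    then have "TQ (snd z) (snd (Ti z x0)) = TQ (snd z) b" using Tp_eq[OF z(1), of x0] by simp
    from lift[OF this] obtain x where x: "snd (Ti z x) = b" by blast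
    have "pull2 PU VM pr \<beta>2 z w x = pull2 PU Q snd (ext_deriv1 Q A) z w x" by (rule pull_\<beta>(2)[OF z(1)])
    also have "\<dots> = ext_deriv1 Q A (snd z) 0 b" by (simp add: pull2_def tmap_component[OF z(1)] w(2) x)
    also have "\<dots> = 0"
      by (rule bilinear_lzero[OF two_form_bilinear[OF two_form_ext_deriv1[OF pmQ A_one_form] U_points(5)[OF z(1)]]])
    finally have "pull2 PU VM pr d\<Gamma> z w x = ext_deriv1 QQ (Theta_L Q L) z (Ti z w) (Ti z x)"
      by (simp add: pull_d\<Gamma>[OF z(1)]) (simp add: pull2_def)
    moreover have "pull2 PU VM pr d\<Gamma> z w x = 0"
      using a y z(2) by (simp add: pull2_def w(1) d\<Gamma>_eq)
    ultimately show ?thesis by (simp add: dTheta_eq(1)[OF U_points(2)[OF z(1)]] w(2) x)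
  qed
  then have "snd (tmap OM (cotangent Q) \<Psi> z (Ti z w)) = 0" using inner_eq_zero_iff by blast
  moreover have "fst (tmap OM (cotangent Q) \<Psi> z (Ti z w)) = 0"
    by (simp add: dTheta_eq(2)[OF U_points(2)[OF z(1)]] w(2))
  ultimately have "tmap OM (cotangent Q) \<Psi> z (Ti z w) = 0" by (simp add: prod_eq_iff)
  then have "Ti z w = 0" by (rule \<Psi>_inj[OF U_points(2)[OF z(1)]])
  \<comment> \<open>The lift itself vanishes, hence so does its projection
    \<open>(a, 0)\<close>.\<close>
  then have "Tp z w = 0"
    using linear_0[OF tmap_linear[OF pmQ pmS config.proj_smooth]] U_points(4,5)[OF z(1)]
    by (simp add: Tp_eq[OF z(1)] zero_prod_def)
  then show ?thesis using w(1) by (simp add: zero_prod_def)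
qed

text \<open>The form vanishes on pairs of vectors from the first factor, so on such a vector it
  reduces to the mixed block \<open>b\<close>. Injectivity of this block on the left is
  \<open>\<Phi>_fst_inj\<close>; both factors have the same model space, which gives injectivity on
  the right.\<close>

lemma \<Omega>_nondegenerate:
  assumes z: "z \<in> V"
  shows "nondegenerate_on UNIV (\<Omega> z)"
proof -
  have zV: "z \<in> points VM" using z by simp
  note lin = tmap_linear[OF pmVM premanifold_cotangent[OF pmS] \<Phi>_smooth zV]
  define b where "b c d = snd (tmap VM (cotangent S) \<Phi> z (c, 0)) \<bullet> d" for c d
  have bil: "bilinear b"
  proof -
    have "linear (\<lambda>c :: 's. (c, 0 :: 's))" by (rule linearI) auto
    from linear_compose[OF linear_compose[OF this lin] bounded_linear.linear[OF bounded_linear_snd]]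
    have l: "linear (\<lambda>c. snd (tmap VM (cotangent S) \<Phi> z (c, 0)))" by (simp add: comp_def)
    have "linear (b c)" "linear (\<lambda>c. b c d)" for c d
      unfolding b_def
      using linear_compose[OF l bounded_linear.linear[OF bounded_linear_inner_left[of d]]]
      by (simp_all add: comp_def bounded_linear.linear[OF bounded_linear_inner_right])
    then show ?thesis by (simp add: bilinear_def)
  qed
  have left: "c = 0" if "\<And>d. b c d = 0" for c
  proof (rule \<Phi>_fst_inj[OF z])
    show "snd (tmap VM (cotangent S) \<Phi> z (c, 0)) = 0" using that unfolding b_def by (metis inner_eq_zero_iff)
  qed
  have \<beta>0: "\<beta>2 z (c, 0) v = 0" for c v
    using bilinear_lzero[OF two_form_bilinear[OF \<beta>(1)]] V_points[OF z]
    by (auto simp: pull2_def tmap_VM[OF z])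
  have \<Omega>0: "\<Omega> z (c, 0) v = - b c (snd v)" for c v
    by (simp add: \<Omega>_eq[OF z] d\<Gamma>_eq[OF z] \<beta>0 b_def)
  have main: "u = 0" if u: "\<And>v. \<Omega> z u v = 0" for u
  proof -
    \<comment> \<open>Pairing with the vectors \<open>(c, 0)\<close> isolates the second component
      of \<open>u\<close> in the right argument of the block; afterwards \<open>u\<close> itself
      lies in the first factor and the vectors \<open>(0, d)\<close> remove what is left.\<close>
    have "snd u = 0"
    proof (rule bilinear_left_right_nondegenerate[OF premanifold_fdim[OF pmS] bil])
      show "c = 0" if "\<And>d. b c d = 0" for c by (rule left[OF that])
      show "b c (snd u) = 0" for c
        using \<Omega>0[of c u] two_form_skew[OF \<Omega>_two_form zV, of "(c, 0)" u] u by simp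
    qed
    then have u0: "u = (fst u, 0)" by (simp add: prod_eq_iff)
    have "b (fst u) d = 0" for d using \<Omega>0[of "fst u" "(0, d)"] u[of "(0, d)"] u0 by simp
    then have "fst u = 0" by (rule left)
    then show ?thesis using u0 by (simp add: prod_eq_iff)
  qed
  have "v = 0" if "\<And>u. \<Omega> z u v = 0" for v
    by (rule main) (use two_form_skew[OF \<Omega>_two_form zV, of v] that in simp)
  then show ?thesis using main unfolding nondegenerate_on_def by blast
qed

theorem \<Omega>_symplectic: "symplectic_form VM \<Omega>"
  unfolding symplectic_form_def using \<Omega>_two_form \<Omega>_closed \<Omega>_nondegenerate by simp

end

theorem theorem2p5:
  fixes G :: "('g, 'x) monoid_scheme"
    and GM :: "('g, 'l::real_inner) mfd"
    and Q :: "('q, 'e::real_inner) mfd"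
    and act :: "'g \<Rightarrow> 'q \<Rightarrow> 'q"
    and S :: "('q set, 's::real_inner) mfd"
    and L :: "'q \<times> 'q \<Rightarrow> real"
    and \<mu> :: "'l \<Rightarrow> real"
    and Onb :: "('q \<times> 'q) set"
    and P :: "('q \<times> 'q, 'p::real_inner) mfd"
    and U :: "('q \<times> 'q) set"
    and UG :: "(('q \<times> 'q) set, 'u::real_inner) mfd"
    and V :: "('q set \<times> 'q set) set"
    and \<phi>\<mu> :: "('q \<times> 'q) set \<Rightarrow> 'q set \<times> 'q set"
    and Lh :: "'q set \<times> 'q set \<Rightarrow> real"
    and \<AA> :: "'q \<Rightarrow> 'e \<Rightarrow> 'l"
    and \<beta> :: "'q set \<Rightarrow> 's \<Rightarrow> 's \<Rightarrow> real"
    and Ah :: "'q set \<times> 'q set \<Rightarrow> 's \<times> 's \<Rightarrow> real"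
    and W :: "('q set \<times> 'q set) set"
    and F :: "'q set \<times> 'q set \<Rightarrow> 'q set \<times> 'q set"
  assumes lie: "lie_group G GM" and abelian: "comm_group G"
    and Q: "smooth_manifold Q"
    and action: "smooth_action G GM Q act" "free_action G Q act" "proper_action GM Q act"
    and S: "quotient_manifold G GM Q act S"
    and L_smooth: "smooth_map (prod_mfd Q Q) vec_mfd L"
    and L_invariant: "\<forall>g\<in>carrier G. \<forall>z\<in>points (prod_mfd Q Q). L (diag_act act g z) = L z"
    and \<mu>: "linear \<mu>"
    and regular: "\<forall>q\<in>points Q. nondegenerate_on UNIV (slot21 Q L (q, q))"
    and group_regular:
      "\<forall>q\<in>points Q. nondegenerate_on (vertical G GM Q act q) (slot21 Q L (q, q))"
    and Onb: "openin (mfd_top (prod_mfd Q Q)) Onb" "\<forall>q\<in>points Q. (q, q) \<in> Onb"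
      "invariant_set G (diag_act act) Onb"
      "local_diffeo (open_sub (prod_mfd Q Q) Onb) (cotangent Q) (discrete_legendre Q L)"
    and P: "embedded_submanifold P (prod_mfd Q Q)"
      "points P = {z \<in> points (prod_mfd Q Q). momentum G GM Q act L z = \<mu>} \<inter> Onb"
    and U: "openin (mfd_top P) U" "invariant_set G (diag_act act) U"
    and UG: "quotient_manifold G GM (open_sub P U) (diag_act act) UG"
    and V: "openin (mfd_top (prod_mfd S S)) V"
    and \<phi>\<mu>: "\<forall>z\<in>U. \<phi>\<mu> (orbit G (diag_act act) z) = pair_proj G act z"
      "diffeo UG (open_sub (prod_mfd S S) V) \<phi>\<mu>"
    and Lh: "\<forall>z\<in>U. Lh (pair_proj G act z) = L z"
    and connection: "principal_connection G GM Q act \<AA>"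
    and \<beta>: "two_form S \<beta>"
      "\<forall>q\<in>points Q. \<forall>u v. pull2 Q S (orbit G act) \<beta> q u v = ext_deriv1 Q (mu_form \<mu> \<AA>) q u v"
    and Ah: "one_form (open_sub (prod_mfd S S) V) Ah"
      "\<forall>z\<in>U. \<forall>w. pull1 (open_sub P U) (open_sub (prod_mfd S S) V) (pair_proj G act) Ah z w
         = pull1 (open_sub P U) (prod_mfd Q Q) (\<lambda>z. z) (diff_form Q (mu_form \<mu> \<AA>)) z w"
    and F: "DR_flow_map S V Lh Ah W F"
  shows "symplectic_form (open_sub (prod_mfd S S) V) (Omega_mu S V Lh Ah \<beta>)
    \<and> (\<forall>z\<in>W. \<forall>u v.
         pull2 (open_sub (prod_mfd S S) W) (open_sub (prod_mfd S S) V) F (Omega_mu S V Lh Ah \<beta>) z u v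
         = Omega_mu S V Lh Ah \<beta> z u v)
    \<and> (\<forall>n. \<forall>z\<in>flow_dom V W F n. \<forall>u v.
         pull2 (open_sub (prod_mfd S S) (flow_dom V W F n)) (open_sub (prod_mfd S S) V) (F ^^ n)
           (Omega_mu S V Lh Ah \<beta>) z u v
         = Omega_mu S V Lh Ah \<beta> z u v)
    \<and> (\<forall>z\<in>U. \<forall>u v.
         pull2 (open_sub P U) (open_sub (prod_mfd S S) V) (pair_proj G act) (Omega_mu S V Lh Ah \<beta>) z u v
         = pull2 (open_sub P U) (prod_mfd Q Q) (\<lambda>z. z) (Omega_L Q L) z u v)"
proof -
  interpret discrete_routh G GM Q act S L \<mu> Onb P U UG V \<phi>\<mu> Lh \<AA> \<beta> Ah W F
    by (rule discrete_routh.intro[OF lie Q action(1) S L_smooth L_invariant \<mu> Onb(1,4) P U UG V \<phi>\<mu> Lh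
          connection \<beta> Ah F])
  show ?thesis
    using \<Omega>_symplectic pull_F_\<Omega> pull_flow_\<Omega> pull_\<Omega> by blast
qed

end
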